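(* Let $k$ be an algebraically closed field of arbitrary characteristic, let $n\ge 1$, and let $G=SL(n+1)=SL_{n+1}(k)$. Let $g\in G$ have Jordan decomposition $g=su$ ($s$ semisimple, $u$ unipotent, $su=us$), and let $\mathcal O$ be the conjugacy class of $g$ in $G$. Then $\mathcal O$ is spherical if and only if one of the following holds: (a) $u=1$ and $s$ has at most $2$ (distinct) eigenvalues; (b) $u\neq 1$, $s\in Z(G)$ and $u$ has Jordan blocks of sizes at most $2$.
   Context: A conjugacy class $\mathcal O$ of an algebraic group $G$ is called spherical if a Borel subgroup of $G$, acting by conjugation, has a dense orbit on $\mathcal O$. *)

theory Defs
  imports
    "HOL-Computational_Algebra.Polynomial"
    "HOL-Algebra.Solvable_Groups"
    "HOL-Analysis.Abstract_Topology"
    "Jordan_Normal_Form.Jordan_Normal_Form"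
    "Jordan_Normal_Form.Determinant"
begin

section \<open>The Zariski topology on square matrices\<close>

text \<open>
  The polynomial functions in the \<open>m\<^sup>2\<close> entries of an \<open>m \<times> m\<close> matrix: the algebra of functions
  generated by the entries. Values outside \<^term>\<open>carrier_mat m m\<close> are irrelevant.
\<close>

inductive_set poly_funs :: "nat \<Rightarrow> ('a::comm_ring_1 mat \<Rightarrow> 'a) set" for m :: nat where
  const: "(\<lambda>_. c) \<in> poly_funs m"
| entry: "i < m \<Longrightarrow> j < m \<Longrightarrow> (\<lambda>A. A $$ (i, j)) \<in> poly_funs m"
| add: "f \<in> poly_funs m \<Longrightarrow> g \<in> poly_funs m \<Longrightarrow> (\<lambda>A. f A + g A) \<in> poly_funs m"
| mult: "f \<in> poly_funs m \<Longrightarrow> g \<in> poly_funs m \<Longrightarrow> (\<lambda>A. f A * g A) \<in> poly_funs m"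

definition zero_locus :: "nat \<Rightarrow> ('a::comm_ring_1 mat \<Rightarrow> 'a) set \<Rightarrow> 'a mat set" where
  "zero_locus m F = {A \<in> carrier_mat m m. \<forall>f\<in>F. f A = 0}"

definition zariski :: "nat \<Rightarrow> 'a::idom mat topology" where
  "zariski m = topology (\<lambda>U. \<exists>F \<subseteq> poly_funs m. U = carrier_mat m m - zero_locus m F)"

lemma compl_zero_locus_iff:
  "A \<in> carrier_mat m m - zero_locus m F \<longleftrightarrow> A \<in> carrier_mat m m \<and> (\<exists>f\<in>F. f A \<noteq> 0)"
  by (auto simp: zero_locus_def)

lemma istopology_zariski:
  "istopology (\<lambda>U. \<exists>F \<subseteq> poly_funs m. U = carrier_mat m m - zero_locus m (F :: ('a::idom mat \<Rightarrow> 'a) set))"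
  (is "istopology ?L")
  unfolding istopology_def
proof (intro conjI allI impI)
  fix S T assume "?L S" "?L T"
  then obtain F G where F: "F \<subseteq> poly_funs m" "S = carrier_mat m m - zero_locus m F"
    and G: "G \<subseteq> poly_funs m" "T = carrier_mat m m - zero_locus m G"
    by blast
  define H where "H = {\<lambda>A. f A * g A | f g. f \<in> F \<and> g \<in> G}"
  have "H \<subseteq> poly_funs m"
    unfolding H_def using F(1) G(1) by (auto intro: poly_funs.mult)
  moreover have "S \<inter> T = carrier_mat m m - zero_locus m H"
  proof (rule Set.set_eqI, rule iffI)
    fix A assume "A \<in> S \<inter> T"
    then obtain f g where fg: "A \<in> carrier_mat m m" "f \<in> F" "f A \<noteq> 0" "g \<in> G" "g A \<noteq> 0"
      unfolding F(2) G(2) Int_iff compl_zero_locus_iff by (elim conjE bexE)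
    have "(\<lambda>A. f A * g A) \<in> H"
      unfolding H_def using fg(2,4) by blast
    moreover have "f A * g A \<noteq> 0"
      using fg(3,5) by simp
    ultimately show "A \<in> carrier_mat m m - zero_locus m H"
      unfolding compl_zero_locus_iff using fg(1) by (intro conjI bexI)
  next
    fix A assume "A \<in> carrier_mat m m - zero_locus m H"
    then obtain h where h: "A \<in> carrier_mat m m" "h \<in> H" "h A \<noteq> 0"
      unfolding compl_zero_locus_iff by (elim conjE bexE)
    from h(2) obtain f g where fg: "h = (\<lambda>A. f A * g A)" "f \<in> F" "g \<in> G"
      unfolding H_def mem_Collect_eq by (elim exE conjE)
    from h(3) have "f A \<noteq> 0" "g A \<noteq> 0"
      unfolding fg(1) by simp_all
    then show "A \<in> S \<inter> T"
      unfolding F(2) G(2) Int_iff compl_zero_locus_iff using h(1) fg(2,3)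
      by (intro conjI bexI)
  qed
  ultimately show "?L (S \<inter> T)"
    by (intro exI conjI)
next
  fix K assume K: "\<forall>U\<in>K. ?L U"
  define H where
    "H = {f \<in> poly_funs m. \<exists>U\<in>K. \<forall>A\<in>carrier_mat m m. f A \<noteq> 0 \<longrightarrow> A \<in> U}"
  have "H \<subseteq> poly_funs m"
    by (simp add: H_def)
  moreover have "\<Union>K = carrier_mat m m - zero_locus m H"
  proof (rule Set.set_eqI, rule iffI)
    fix A assume "A \<in> \<Union>K"
    then obtain U where U: "U \<in> K" "A \<in> U"
      by (elim UnionE)
    from bspec[OF K U(1)] obtain F where F: "F \<subseteq> poly_funs m" "U = carrier_mat m m - zero_locus m F"
      by (elim exE conjE)
    from U(2) obtain f where f: "A \<in> carrier_mat m m" "f \<in> F" "f A \<noteq> 0"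
      unfolding F(2) compl_zero_locus_iff by (elim conjE bexE)
    have "\<forall>A\<in>carrier_mat m m. f A \<noteq> 0 \<longrightarrow> A \<in> U"
      using f(2) unfolding F(2) compl_zero_locus_iff by (intro ballI impI conjI bexI)
    then have "f \<in> H"
      unfolding H_def mem_Collect_eq using subsetD[OF F(1) f(2)] U(1) by (intro conjI bexI)
    then show "A \<in> carrier_mat m m - zero_locus m H"
      unfolding compl_zero_locus_iff using f(1,3) by (intro conjI bexI)
  next
    fix A assume "A \<in> carrier_mat m m - zero_locus m H"
    then obtain f where f: "A \<in> carrier_mat m m" "f \<in> H" "f A \<noteq> 0"
      unfolding compl_zero_locus_iff by (elim conjE bexE)
    from f(2) obtain U where "U \<in> K" "\<forall>A\<in>carrier_mat m m. f A \<noteq> 0 \<longrightarrow> A \<in> U"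
      unfolding H_def mem_Collect_eq by (elim conjE bexE)
    with f show "A \<in> \<Union>K"
      by (intro UnionI[of U]) simp_all
  qed
  ultimately show "?L (\<Union>K)"
    by (intro exI conjI)
qed

lemma openin_zariski:
  "openin (zariski m) U \<longleftrightarrow> (\<exists>F \<subseteq> poly_funs m. U = carrier_mat m m - zero_locus m F)"
  unfolding zariski_def topology_inverse'[OF istopology_zariski] ..

lemma topspace_zariski [simp]: "topspace (zariski m :: 'a::idom mat topology) = carrier_mat m m"
proof
  show "topspace (zariski m :: 'a mat topology) \<subseteq> carrier_mat m m"
    unfolding topspace_def openin_zariski by auto
  have "openin (zariski m) (carrier_mat m m :: 'a mat set)"
    unfolding openin_zariski
    by (rule exI[of _ "{\<lambda>_. 1}"]) (auto simp: zero_locus_def intro: poly_funs.const)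
  then show "carrier_mat m m \<subseteq> topspace (zariski m :: 'a mat topology)"
    by (rule openin_subset)
qed

lemma closedin_zariski:
  "closedin (zariski m) (Z :: 'a::idom mat set) \<longleftrightarrow> (\<exists>F \<subseteq> poly_funs m. Z = zero_locus m F)"
proof
  assume Z: "closedin (zariski m) Z"
  then obtain F where F: "F \<subseteq> poly_funs m" "carrier_mat m m - Z = carrier_mat m m - zero_locus m F"
    unfolding closedin_def openin_zariski by auto
  have "Z \<subseteq> carrier_mat m m" "zero_locus m F \<subseteq> carrier_mat m m"
    using closedin_subset[OF Z] by (auto simp: zero_locus_def)
  with F(2) have "Z = zero_locus m F"
    by blast
  with F(1) show "\<exists>F \<subseteq> poly_funs m. Z = zero_locus m F"
    by blast
next
  assume "\<exists>F \<subseteq> poly_funs m. Z = zero_locus m F"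
  then obtain F where F: "F \<subseteq> poly_funs m" "Z = zero_locus m F"
    by blast
  then have "Z \<subseteq> carrier_mat m m"
    by (simp add: zero_locus_def)
  with F show "closedin (zariski m) Z"
    unfolding closedin_def openin_zariski topspace_zariski by blast
qed


section \<open>Linear algebraic groups\<close>

text \<open>
  A linear algebraic group is represented by the record \<open>G\<close> of a group of invertible \<open>m \<times> m\<close>
  matrices; its Zariski topology is the one that \<^term>\<open>zariski m\<close> induces on its carrier.
\<close>

definition special_linear_group :: "nat \<Rightarrow> 'a::comm_ring_1 mat monoid" ("SL") where
  "SL m = \<lparr>carrier = {A \<in> carrier_mat m m. det A = 1}, monoid.mult = (*), one = 1\<^sub>m m\<rparr>"

lemma group_SL: "group (SL m :: 'a::field mat monoid)"
proof (rule groupI)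
  fix A :: "'a mat" assume A: "A \<in> carrier (SL m)"
  then have A': "A \<in> carrier_mat m m" "det A = 1"
    by (auto simp: special_linear_group_def)
  then obtain B where B: "B \<in> carrier_mat m m" "B * A = 1\<^sub>m m"
    using det_non_zero_imp_unit[of A m "()"] by (auto simp: Units_def ring_mat_def)
  then have "det B * det A = 1"
    using A' det_mult[of B m A] by simp
  with A' B show "\<exists>B\<in>carrier (SL m). B \<otimes>\<^bsub>SL m\<^esub> A = \<one>\<^bsub>SL m\<^esub>"
    by (auto simp: special_linear_group_def)
qed (auto simp: special_linear_group_def det_mult intro: assoc_mult_mat)

definition Borel_subgroup :: "nat \<Rightarrow> 'a mat set \<Rightarrow> 'a::idom mat monoid \<Rightarrow> bool" where
  "Borel_subgroup m B G \<longleftrightarrow>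
    (let P = (\<lambda>H. subgroup H G
                \<and> closedin (subtopology (zariski m) (carrier G)) H
                \<and> connectedin (zariski m) H
                \<and> solvable (G\<lparr>carrier := H\<rparr>))
     in P B \<and> (\<forall>H. P H \<longrightarrow> B \<subseteq> H \<longrightarrow> H = B))"

definition conjugates :: "('a, 'b) monoid_scheme \<Rightarrow> 'a set \<Rightarrow> 'a \<Rightarrow> 'a set" where
  "conjugates G H x = {h \<otimes>\<^bsub>G\<^esub> x \<otimes>\<^bsub>G\<^esub> inv\<^bsub>G\<^esub> h | h. h \<in> H}"

abbreviation conjugacy_class :: "('a, 'b) monoid_scheme \<Rightarrow> 'a \<Rightarrow> 'a set" where
  "conjugacy_class G x \<equiv> conjugates G (carrier G) x"

definition spherical :: "nat \<Rightarrow> 'a::idom mat monoid \<Rightarrow> 'a mat set \<Rightarrow> bool" where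
  "spherical m G C \<longleftrightarrow>
    (\<exists>B. Borel_subgroup m B G
       \<and> (\<exists>x\<in>C. Abstract_Topology.closure_of (subtopology (zariski m) C) (conjugates G B x) = C))"

definition group_center :: "('a, 'b) monoid_scheme \<Rightarrow> 'a set" where
  "group_center G = {z \<in> carrier G. \<forall>x\<in>carrier G. z \<otimes>\<^bsub>G\<^esub> x = x \<otimes>\<^bsub>G\<^esub> z}"


section \<open>Jordan decomposition\<close>

text \<open>Over an algebraically closed field, semisimple means diagonalizable.\<close>

definition semisimple_mat :: "'a::field mat \<Rightarrow> bool" where
  "semisimple_mat s \<longleftrightarrow> (\<exists>D. diagonal_mat D \<and> similar_mat s D)"

definition unipotent_mat :: "'a::field mat \<Rightarrow> bool" where
  "unipotent_mat u \<longleftrightarrow>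
    (\<exists>k. (u - 1\<^sub>m (dim_row u)) ^\<^sub>m k = 0\<^sub>m (dim_row u) (dim_row u))"

definition Jordan_decomposition ::
    "'a::field mat monoid \<Rightarrow> 'a mat \<Rightarrow> 'a mat \<Rightarrow> 'a mat \<Rightarrow> bool" where
  "Jordan_decomposition G g s u \<longleftrightarrow>
    s \<in> carrier G \<and> u \<in> carrier G \<and> semisimple_mat s \<and> unipotent_mat u
    \<and> g = s \<otimes>\<^bsub>G\<^esub> u \<and> s \<otimes>\<^bsub>G\<^esub> u = u \<otimes>\<^bsub>G\<^esub> s"

end

theory Submission
  imports Defs
begin

text \<open>
  Both conditions say that \<open>g\<close> is a root of a quadratic polynomial.

  If a Borel subgroup \<open>B\<close> has a dense orbit on the class of \<open>g\<close>, then by Lie and Kolchin \<open>B\<close> has an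
  eigenvector \<open>v\<close> and an eigenform \<open>w\<close>. Along a \<open>B\<close>-orbit the triple \<open>(w v, w y v, w y\<^sup>2 v)\<close> only changes
  by a scalar factor, so a linear relation between its entries that holds at one point of the orbit
  holds on the whole class by density. For \<open>M = a g\<^sup>2 + b g + c\<close> this means that \<open>w N v = 0\<close> for all
  conjugates \<open>N\<close> of \<open>M\<close>, and this forces \<open>M\<close> to be scalar.

  Conversely, let \<open>B\<close> be the group of upper triangular matrices and \<open>y\<^sup>2 = \<tau> y - \<nu>\<close>. If the lower left
  entry of \<open>y\<close> does not vanish, then \<open>y\<close> can be conjugated by \<open>B\<close> so that its first and last
  coordinates split off in a standard form, leaving a smaller matrix satisfying the same equation.
  By induction, finitely many \<open>B\<close>-orbits meet each class in a dense subset, and one of them is dense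
  since the class is irreducible.
\<close>

section \<open>Regular functions and irreducible sets of matrices\<close>

text \<open>A spherical class comes with some Borel subgroup, not with the triangular one, so the
  theorem of Lie and Kolchin is proved for arbitrary connected solvable subgroups. Applied to the
  quotients by the standard flag, the same theorem shows that the triangular group is maximal, which
  the converse needs. The relation between the three numbers is chosen with \<open>(a, b)\<close>
  nonzero; otherwise \<open>M\<close> would be scalar for every \<open>g\<close>. That
  \<open>M\<close> is scalar follows by looking at all matrices whose conjugates are killed by
  \<open>w\<close> and \<open>v\<close>: they form a subspace closed under conjugation, and one
  nonscalar member brings in all off-diagonal matrix units and the differences of diagonal ones,
  which no nonzero pair \<open>w\<close>, \<open>v\<close> survives. The standard form in the
  converse is the companion block of \<open>X^2 - \<tau> X + \<nu>\<close>, obtained by replacing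
  the last basis vector by the image of the first. Connectedness acts through one fact: a regular
  function with finitely many values is constant. Irreducibility is obtained by joining points with
  rational curves. Both arguments are the same in every characteristic.\<close>

locale fun_algebra =
  fixes D :: "'x set" and R :: "('x \<Rightarrow> 'a::comm_ring_1) set"
  assumes const: "(\<lambda>_. c) \<in> R"
    and add: "f \<in> R \<Longrightarrow> g \<in> R \<Longrightarrow> (\<lambda>x. f x + g x) \<in> R"
    and mult: "f \<in> R \<Longrightarrow> g \<in> R \<Longrightarrow> (\<lambda>x. f x * g x) \<in> R"
    and cong: "f \<in> R \<Longrightarrow> (\<And>x. x \<in> D \<Longrightarrow> f x = g x) \<Longrightarrow> g \<in> R"
begin

text \<open>Matrix-valued maps with entries in the algebra. Two instances share the closure lemmas:
  functions of a matrix, which give Zariski-continuous maps, and polynomials in one parameter, which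
  give curves.\<close>

definition regular :: "nat \<Rightarrow> ('x \<Rightarrow> 'a mat) \<Rightarrow> bool" where
  "regular m \<Phi> \<longleftrightarrow> (\<forall>x\<in>D. \<Phi> x \<in> carrier_mat m m) \<and> (\<forall>i<m. \<forall>j<m. (\<lambda>x. \<Phi> x $$ (i, j)) \<in> R)"

lemma regularI:
  assumes "\<And>x. x \<in> D \<Longrightarrow> \<Phi> x \<in> carrier_mat m m"
    and "\<And>i j. i < m \<Longrightarrow> j < m \<Longrightarrow> (\<lambda>x. \<Phi> x $$ (i, j)) \<in> R"
  shows "regular m \<Phi>"
  using assms by (auto simp: regular_def)

lemma regular_carrier: "regular m \<Phi> \<Longrightarrow> x \<in> D \<Longrightarrow> \<Phi> x \<in> carrier_mat m m"
  by (auto simp: regular_def)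

lemma regular_entry: "regular m \<Phi> \<Longrightarrow> i < m \<Longrightarrow> j < m \<Longrightarrow> (\<lambda>x. \<Phi> x $$ (i, j)) \<in> R"
  by (auto simp: regular_def)

lemma uminus: "f \<in> R \<Longrightarrow> (\<lambda>x. - f x) \<in> R"
  using mult[OF const[of "-1"], of f] by simp

lemma diff: "f \<in> R \<Longrightarrow> g \<in> R \<Longrightarrow> (\<lambda>x. f x - g x) \<in> R"
  using add[of f, OF _ uminus, of g] by simp

lemma sum:
  assumes "\<And>i. i \<in> I \<Longrightarrow> f i \<in> R"
  shows "(\<lambda>x. \<Sum>i\<in>I. f i x) \<in> R"
  using assms by (induction I rule: infinite_finite_induct) (auto intro: const add)

lemma prod:
  assumes "\<And>i. i \<in> I \<Longrightarrow> f i \<in> R"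
  shows "(\<lambda>x. \<Prod>i\<in>I. f i x) \<in> R"
  using assms by (induction I rule: infinite_finite_induct) (auto intro: const mult)

lemma regular_const: "A \<in> carrier_mat m m \<Longrightarrow> regular m (\<lambda>_. A)"
  by (auto simp: regular_def intro: const)

lemma regular_mult:
  assumes "regular m \<Phi>" "regular m \<Psi>"
  shows "regular m (\<lambda>x. \<Phi> x * \<Psi> x)"
proof (rule regularI)
  fix x assume "x \<in> D"
  then show "\<Phi> x * \<Psi> x \<in> carrier_mat m m"
    using assms by (auto dest!: regular_carrier)
next
  fix i j assume ij: "i < m" "j < m"
  have "(\<lambda>x. \<Sum>k\<in>{0..<m}. \<Phi> x $$ (i, k) * \<Psi> x $$ (k, j)) \<in> R"
    using assms ij by (intro sum mult) (auto dest: regular_entry)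
  then show "(\<lambda>x. (\<Phi> x * \<Psi> x) $$ (i, j)) \<in> R"
  proof (rule cong)
    fix x assume "x \<in> D"
    then have "\<Phi> x \<in> carrier_mat m m" "\<Psi> x \<in> carrier_mat m m"
      using assms regular_carrier by auto
    then show "(\<Sum>k = 0..<m. \<Phi> x $$ (i, k) * \<Psi> x $$ (k, j)) = (\<Phi> x * \<Psi> x) $$ (i, j)"
      using ij by (auto simp: scalar_prod_def intro!: sum.cong)
  qed
qed

lemma regular_add:
  assumes "regular m \<Phi>" "regular m \<Psi>"
  shows "regular m (\<lambda>x. \<Phi> x + \<Psi> x)"
proof (rule regularI)
  fix i j assume ij: "i < m" "j < m"
  have "(\<lambda>x. \<Phi> x $$ (i, j) + \<Psi> x $$ (i, j)) \<in> R"
    using assms ij by (intro add) (auto dest: regular_entry)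
  then show "(\<lambda>x. (\<Phi> x + \<Psi> x) $$ (i, j)) \<in> R"
    by (rule cong) (use assms ij in \<open>auto dest!: regular_carrier\<close>)
qed (use assms in \<open>auto dest!: regular_carrier\<close>)

lemma regular_smult:
  assumes "f \<in> R" "regular m \<Phi>"
  shows "regular m (\<lambda>x. f x \<cdot>\<^sub>m \<Phi> x)"
proof (rule regularI)
  fix i j assume ij: "i < m" "j < m"
  have "(\<lambda>x. f x * \<Phi> x $$ (i, j)) \<in> R"
    using assms ij by (intro mult) (auto dest: regular_entry)
  then show "(\<lambda>x. (f x \<cdot>\<^sub>m \<Phi> x) $$ (i, j)) \<in> R"
    by (rule cong) (use assms ij in \<open>auto dest!: regular_carrier\<close>)
qed (use assms in \<open>auto dest!: regular_carrier\<close>)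

lemma regular_det:
  assumes "regular m \<Phi>"
  shows "(\<lambda>x. det (\<Phi> x)) \<in> R"
proof -
  have "(\<lambda>x. \<Sum>p\<in>{p. p permutes {0..<m}}. signof p * (\<Prod>i\<in>{0..<m}. \<Phi> x $$ (i, p i))) \<in> R"
    using assms by (intro sum mult const prod regular_entry) (auto simp: permutes_def)
  then show ?thesis
    by (rule cong) (use assms in \<open>auto dest!: regular_carrier simp: det_def'\<close>)
qed

text \<open>The adjugate is a polynomial substitute for the inverse: on \<open>SL m\<close> it is
  the inverse, and for other invertible matrices it is the inverse times the determinant.\<close>

lemma regular_adj_mat:
  assumes "regular m \<Phi>"
  shows "regular m (\<lambda>x. adj_mat (\<Phi> x))"
proof (rule regularI)
  fix x assume "x \<in> D"
  then show "adj_mat (\<Phi> x) \<in> carrier_mat m m"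
    using assms adj_mat(1) regular_carrier by blast
next
  fix i j assume ij: "i < m" "j < m"
  have "regular (m - 1) (\<lambda>x. mat_delete (\<Phi> x) j i)"
  proof (rule regularI)
    fix x assume "x \<in> D"
    then show "mat_delete (\<Phi> x) j i \<in> carrier_mat (m - 1) (m - 1)"
      using assms ij by (auto dest!: regular_carrier)
  next
    fix a b assume ab: "a < m - 1" "b < m - 1"
    define a' where "a' = (if a < j then a else Suc a)"
    define b' where "b' = (if b < i then b else Suc b)"
    have "(\<lambda>x. \<Phi> x $$ (a', b')) \<in> R"
      using assms ab ij by (intro regular_entry) (auto simp: a'_def b'_def)
    then show "(\<lambda>x. mat_delete (\<Phi> x) j i $$ (a, b)) \<in> R"
      by (rule cong)
        (use assms ij ab in \<open>auto dest!: regular_carrier simp: mat_delete_def a'_def b'_def\<close>)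
  qed
  then have "(\<lambda>x. (-1)^(j + i) * det (mat_delete (\<Phi> x) j i)) \<in> R"
    by (intro mult const regular_det)
  then show "(\<lambda>x. adj_mat (\<Phi> x) $$ (i, j)) \<in> R"
    by (rule cong) (use assms ij in \<open>auto dest!: regular_carrier simp: adj_mat_def cofactor_def\<close>)
qed

lemma regular_comp:
  assumes "f \<in> poly_funs m" "regular m \<Phi>"
  shows "(\<lambda>x. f (\<Phi> x)) \<in> R"
  using assms by (induction f) (auto intro: const add mult regular_entry)

end

text \<open>
  Entries and products of matrices are unspecified outside \<open>carrier_mat m m\<close>, so closure properties
  of \<open>poly_funs m\<close> only hold up to the values there.
\<close>

definition regular_funs :: "nat \<Rightarrow> ('a::comm_ring_1 mat \<Rightarrow> 'a) set" where
  "regular_funs m = {f. \<exists>g\<in>poly_funs m. \<forall>A\<in>carrier_mat m m. f A = g A}"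

lemma poly_funs_regular: "f \<in> poly_funs m \<Longrightarrow> f \<in> regular_funs m"
  by (auto simp: regular_funs_def)

interpretation Mat: fun_algebra "carrier_mat m m" "regular_funs m" for m
proof
  fix f g :: "'a mat \<Rightarrow> 'a" and c
  show "(\<lambda>_. c) \<in> regular_funs m"
    by (intro poly_funs_regular poly_funs.const)
  assume "f \<in> regular_funs m"
  then obtain f' where f': "f' \<in> poly_funs m" "\<forall>A\<in>carrier_mat m m. f A = f' A"
    by (auto simp: regular_funs_def)
  show "g \<in> regular_funs m" if "\<And>x. x \<in> carrier_mat m m \<Longrightarrow> f x = g x"
    unfolding regular_funs_def using f' that by force
  assume "g \<in> regular_funs m"
  then obtain g' where g': "g' \<in> poly_funs m" "\<forall>A\<in>carrier_mat m m. g A = g' A"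
    by (auto simp: regular_funs_def)
  show "(\<lambda>x. f x + g x) \<in> regular_funs m"
    unfolding regular_funs_def using f' g' poly_funs.add[OF f'(1) g'(1)] by force
  show "(\<lambda>x. f x * g x) \<in> regular_funs m"
    unfolding regular_funs_def using f' g' poly_funs.mult[OF f'(1) g'(1)] by force
qed

lemma regular_id: "Mat.regular m m (\<lambda>A. A)"
  by (auto simp: Mat.regular_def intro!: poly_funs_regular poly_funs.entry)

interpretation Poly: fun_algebra UNIV "range (poly :: 'a::comm_ring_1 poly \<Rightarrow> 'a \<Rightarrow> 'a)"
proof
  fix f g :: "'a \<Rightarrow> 'a" and c
  show "(\<lambda>_. c) \<in> range poly"
    by (intro range_eqI[of _ _ "[:c:]"]) auto
  show "(\<lambda>x. f x + g x) \<in> range poly" "(\<lambda>x. f x * g x) \<in> range poly"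
    if "f \<in> range poly" "g \<in> range poly"
  proof -
    obtain p q where "f = poly p" "g = poly q"
      using \<open>f \<in> range poly\<close> \<open>g \<in> range poly\<close> by auto
    then show "(\<lambda>x. f x + g x) \<in> range poly" "(\<lambda>x. f x * g x) \<in> range poly"
      using range_eqI[of "\<lambda>x. f x + g x" poly "p + q"] range_eqI[of "\<lambda>x. f x * g x" poly "p * q"]
      by (auto simp: fun_eq_iff)
  qed
  show "g \<in> range poly" if "f \<in> range poly" "\<And>x. x \<in> UNIV \<Longrightarrow> f x = g x"
    using that by (metis ext UNIV_I)
qed

lemma poly_linear: "(\<lambda>c. a + c * b) \<in> range poly"
  by (intro range_eqI[of _ _ "[:a, b:]"]) auto

text \<open>Over a finite field, adding 1 to the product of all \<open>X - a\<close> would give a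
  nonconstant polynomial without roots.\<close>

lemma infinite_UNIV_alg_closed: "infinite (UNIV :: 'a::alg_closed_field set)"
proof
  assume fin: "finite (UNIV :: 'a set)"
  define p where "p = (\<Prod>a\<in>(UNIV :: 'a set). [:- a, 1:])"
  have "degree p = card (UNIV :: 'a set)"
    unfolding p_def by (subst degree_prod_eq_sum_degree) auto
  then have "degree (p + 1) > 0"
    using fin by (subst degree_add_eq_left) (auto simp: card_gt_0_iff)
  then obtain x where "poly (p + 1) x = 0"
    using alg_closed_imp_poly_has_root by blast
  moreover have "poly p x = 0"
    using fin by (auto simp: p_def poly_prod)
  ultimately show False
    by simp
qed

section \<open>Zariski-closed sets, continuity and connectedness\<close>

lemma regular_funsE:
  assumes "f \<in> regular_funs m"
  obtains g where "g \<in> poly_funs m" "\<And>A. A \<in> carrier_mat m m \<Longrightarrow> g A = f A"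
  using assms unfolding regular_funs_def by fastforce

lemma closedin_regular:
  assumes "f \<in> regular_funs m"
  shows "closedin (zariski m) {A \<in> carrier_mat m m. (f A :: 'a::idom) = 0}"
proof -
  obtain g where "g \<in> poly_funs m" "\<And>A. A \<in> carrier_mat m m \<Longrightarrow> g A = f A"
    using regular_funsE[OF assms] by blast
  then show ?thesis
    unfolding closedin_zariski by (intro exI[of _ "{g}"]) (auto simp: zero_locus_def)
qed

lemma continuous_map_zariski:
  fixes \<Phi> :: "'a::idom mat \<Rightarrow> 'a mat"
  assumes "Mat.regular m n \<Phi>"
  shows "continuous_map (zariski m) (zariski n) \<Phi>"
  unfolding continuous_map_closedin
proof (intro conjI allI impI)
  show "\<Phi> \<in> topspace (zariski m) \<rightarrow> topspace (zariski n)"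
    using assms by (auto simp: Mat.regular_def)
  fix Z :: "'a mat set" assume "closedin (zariski n) Z"
  then obtain F where F: "F \<subseteq> poly_funs n" "Z = zero_locus n F"
    unfolding closedin_zariski by blast
  have "closedin (zariski m) {A \<in> carrier_mat m m. f (\<Phi> A) = 0}" if "f \<in> F" for f
    using F(1) that assms by (intro closedin_regular Mat.regular_comp) auto
  \<comment> \<open>Intersecting with the whole space keeps the set inside
    \<open>carrier_mat m m\<close> when \<open>F\<close> is empty.\<close>
  then have "closedin (zariski m) (topspace (zariski m) \<inter> (\<Inter>f\<in>F. {A \<in> carrier_mat m m. f (\<Phi> A) = 0}))"
    using closedin_topspace[of "zariski m :: 'a mat topology"]
    by (cases "F = {}") (auto simp del: closedin_topspace intro!: closedin_Int closedin_Inter)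
  also have "topspace (zariski m) \<inter> (\<Inter>f\<in>F. {A \<in> carrier_mat m m. f (\<Phi> A) = 0})
      = {A \<in> topspace (zariski m). \<Phi> A \<in> Z}"
    using assms by (auto simp: F(2) zero_locus_def Mat.regular_def)
  finally show "closedin (zariski m) {A \<in> topspace (zariski m). \<Phi> A \<in> Z}" .
qed

lemma connectedin_regular_image:
  assumes "Mat.regular m n \<Phi>" "connectedin (zariski m) (S :: 'a::idom mat set)"
  shows "connectedin (zariski n) (\<Phi> ` S)"
  using connectedin_continuous_map_image[OF continuous_map_zariski] assms by blast

text \<open>The level set of \<open>f x\<close> and the union of the finitely many other level sets
  are closed, cover \<open>S\<close> and are disjoint on it. In the proof of Lie and Kolchin this
  takes the place of letting a connected group act on a finite set.\<close>

lemma connectedin_regular_const: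
  fixes S :: "'a::idom mat set"
  assumes S: "connectedin (zariski m) S" and f: "f \<in> regular_funs m"
    and fin: "finite (f ` S)" and xy: "x \<in> S" "y \<in> S"
  shows "f x = f y"
proof (rule ccontr)
  assume ne: "f x \<noteq> f y"
  define V where "V = f ` S - {f x}"
  have "finite V"
    using fin by (simp add: V_def)
  define E1 where "E1 = {A \<in> carrier_mat m m. f A - f x = 0}"
  define E2 where "E2 = {A \<in> carrier_mat m m. (\<Prod>v\<in>V. f A - v) = 0}"
  have "closedin (zariski m) E1" "closedin (zariski m) E2"
    unfolding E1_def E2_def using f
    by (intro closedin_regular Mat.diff Mat.prod Mat.const f)+
  moreover have "S \<subseteq> carrier_mat m m"
    using connectedin_subset_topspace[OF S] by simp
  then have "S \<subseteq> E1 \<union> E2" "E1 \<inter> E2 \<inter> S = {}" "E1 \<inter> S \<noteq> {}" "E2 \<inter> S \<noteq> {}"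
    using xy ne \<open>finite V\<close> by (auto simp: E1_def E2_def V_def)
  ultimately show False
    using S unfolding connectedin_closedin by blast
qed

section \<open>Irreducible sets, rational curves and density\<close>

text \<open>For nonempty \<open>S\<close> this says that the functions vanishing on \<open>S\<close>
  form a prime ideal. The formulation by functions applies directly to sets that are not closed,
  such as orbits.\<close>

definition irreducible_set :: "nat \<Rightarrow> 'a::comm_ring_1 mat set \<Rightarrow> bool" where
  "irreducible_set m S \<longleftrightarrow> (\<forall>f\<in>poly_funs m. \<forall>g\<in>poly_funs m.
     (\<forall>A\<in>S. f A * g A = 0) \<longrightarrow> (\<forall>A\<in>S. f A = 0) \<or> (\<forall>A\<in>S. g A = 0))"

lemma irreducible_set_connectedin:
  fixes S :: "'a::idom mat set"
  assumes S: "S \<subseteq> carrier_mat m m" and irr: "irreducible_set m S"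
  shows "connectedin (zariski m) S"
  unfolding connectedin_closedin
proof (intro conjI notI)
  show "S \<subseteq> topspace (zariski m)"
    using S by simp
  assume "\<exists>E1 E2. closedin (zariski m) E1 \<and> closedin (zariski m) E2 \<and> S \<subseteq> E1 \<union> E2 \<and>
    E1 \<inter> E2 \<inter> S = {} \<and> E1 \<inter> S \<noteq> {} \<and> E2 \<inter> S \<noteq> {}"
  then obtain F1 F2 where F: "F1 \<subseteq> poly_funs m" "F2 \<subseteq> poly_funs m"
    and c: "S \<subseteq> zero_locus m F1 \<union> zero_locus m F2" "zero_locus m F1 \<inter> zero_locus m F2 \<inter> S = {}"
      "zero_locus m F1 \<inter> S \<noteq> {}" "zero_locus m F2 \<inter> S \<noteq> {}"
    unfolding closedin_zariski by blast
  \<comment> \<open>A point of \<open>S\<close> in one of the closed sets lies outside the other, so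
    each of them misses some point of \<open>S\<close>.\<close>
  obtain A1 A2 where A: "A1 \<in> S" "A1 \<notin> zero_locus m F1" "A2 \<in> S" "A2 \<notin> zero_locus m F2"
    using c by blast
  obtain f1 f2 where f: "f1 \<in> F1" "f1 A1 \<noteq> 0" "f2 \<in> F2" "f2 A2 \<noteq> 0"
    using A S unfolding zero_locus_def by blast
  have "\<forall>A\<in>S. f1 A * f2 A = 0"
    using c(1) f(1,3) by (auto simp: zero_locus_def)
  then have "(\<forall>A\<in>S. f1 A = 0) \<or> (\<forall>A\<in>S. f2 A = 0)"
    using irr F f unfolding irreducible_set_def by blast
  then show False
    using A f by blast
qed

text \<open>Nonvanishing of \<open>f\<close> and of \<open>g\<close> is witnessed by one point each,
  so it suffices to join pairs of points by irreducible subsets. For the triangular group and for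
  conjugacy classes these subsets are rational curves.\<close>

lemma irreducible_setI:
  fixes S :: "'a::idom mat set"
  assumes "\<And>x y. x \<in> S \<Longrightarrow> y \<in> S \<Longrightarrow> \<exists>I\<subseteq>S. irreducible_set m I \<and> x \<in> I \<and> y \<in> I"
  shows "irreducible_set m S"
  unfolding irreducible_set_def
proof (intro ballI impI)
  fix f g assume fg: "f \<in> poly_funs m" "g \<in> poly_funs m" and 0: "\<forall>A\<in>S. f A * g A = 0"
  show "(\<forall>A\<in>S. f A = 0) \<or> (\<forall>A\<in>S. g A = 0)"
  proof (rule ccontr)
    assume "\<not> ?thesis"
    then obtain x y where xy: "x \<in> S" "f x \<noteq> 0" "y \<in> S" "g y \<noteq> 0"
      by blast
    obtain I where I: "I \<subseteq> S" "irreducible_set m I" "x \<in> I" "y \<in> I"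
      using assms xy by blast
    have "\<forall>A\<in>I. f A * g A = 0"
      using 0 I(1) by blast
    then show False
      using I(2-4) fg xy unfolding irreducible_set_def by blast
  qed
qed

lemma irreducible_set_prod:
  fixes S :: "'a::idom mat set"
  assumes "irreducible_set m S" "finite I" "\<And>i. i \<in> I \<Longrightarrow> f i \<in> poly_funs m"
    and "\<And>A. A \<in> S \<Longrightarrow> (\<Prod>i\<in>I. f i A) = 0" and "S \<noteq> {}"
  shows "\<exists>i\<in>I. \<forall>A\<in>S. f i A = 0"
  using assms(2-4)
proof (induction I rule: finite_induct)
  case empty
  then show ?case using assms(5) by auto
next
  case (insert i I)
  have P: "(\<lambda>A. \<Prod>i\<in>J. f i A) \<in> poly_funs m" if "finite J" "J \<subseteq> insert i I" for J
    using that insert.prems(1) by (induction J rule: finite_induct) (auto intro: poly_funs.const poly_funs.mult)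
  have "\<forall>A\<in>S. f i A * (\<Prod>i\<in>I. f i A) = 0"
    using insert by auto
  moreover have "f i \<in> poly_funs m" "(\<lambda>A. \<Prod>i\<in>I. f i A) \<in> poly_funs m"
    using insert P by auto
  ultimately have "(\<forall>A\<in>S. f i A = 0) \<or> (\<forall>A\<in>S. (\<Prod>i\<in>I. f i A) = 0)"
    using assms(1)[unfolded irreducible_set_def, rule_format, of "f i" "\<lambda>A. \<Prod>i\<in>I. f i A"] by auto
  then show ?case
    using insert.IH insert.prems(1) by blast
qed

text \<open>Clearing denominators: \<open>N\<close> bounds the degree of \<open>f\<close>, and
  multiplying by the \<open>N\<close>-th power of \<open>q\<close> turns a polynomial in the entries
  of \<open>P / q\<close> into a polynomial in the parameter.\<close>

lemma poly_fun_rational_curve: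
  fixes P :: "'a::field \<Rightarrow> 'a mat"
  assumes "f \<in> poly_funs m" "Poly.regular m P"
  shows "\<exists>N p. \<forall>c. poly q c \<noteq> 0 \<longrightarrow> f (inverse (poly q c) \<cdot>\<^sub>m P c) * poly q c ^ N = poly p c"
  using assms(1)
proof induction
  case (const c)
  show ?case
    by (intro exI[of _ 0] exI[of _ "[:c:]"]) auto
next
  case (entry i j)
  obtain p where p: "(\<lambda>x. P x $$ (i, j)) = poly p"
    using Poly.regular_entry[OF assms(2) entry] by auto
  have "P c \<in> carrier_mat m m" for c
    using Poly.regular_carrier[OF assms(2)] by auto
  then show ?case
    using entry fun_cong[OF p] by (intro exI[of _ "1::nat"] exI[of _ p]) (auto simp: carrier_matD[of _ m m])
next
  case (add f g)
  then obtain N p M r where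
    "\<forall>c. poly q c \<noteq> 0 \<longrightarrow> f (inverse (poly q c) \<cdot>\<^sub>m P c) * poly q c ^ N = poly p c"
    "\<forall>c. poly q c \<noteq> 0 \<longrightarrow> g (inverse (poly q c) \<cdot>\<^sub>m P c) * poly q c ^ M = poly r c"
    by blast
  then show ?case
    by (intro exI[of _ "N + M"] exI[of _ "p * q ^ M + r * q ^ N"])
      (auto simp: power_add algebra_simps simp flip: poly_power)
next
  case (mult f g)
  then obtain N p M r where
    "\<forall>c. poly q c \<noteq> 0 \<longrightarrow> f (inverse (poly q c) \<cdot>\<^sub>m P c) * poly q c ^ N = poly p c"
    "\<forall>c. poly q c \<noteq> 0 \<longrightarrow> g (inverse (poly q c) \<cdot>\<^sub>m P c) * poly q c ^ M = poly r c"
    by blast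
  then have "f (inverse (poly q c) \<cdot>\<^sub>m P c) * g (inverse (poly q c) \<cdot>\<^sub>m P c) * poly q c ^ (N + M) = poly (p * r) c"
    if "poly q c \<noteq> 0" for c
  proof -
    have "f (inverse (poly q c) \<cdot>\<^sub>m P c) * g (inverse (poly q c) \<cdot>\<^sub>m P c) * poly q c ^ (N + M)
        = (f (inverse (poly q c) \<cdot>\<^sub>m P c) * poly q c ^ N) * (g (inverse (poly q c) \<cdot>\<^sub>m P c) * poly q c ^ M)"
      by (simp add: power_add mult_ac)
    then show ?thesis
      using that \<open>\<forall>c. poly q c \<noteq> 0 \<longrightarrow> f _ * _ = _\<close> \<open>\<forall>c. poly q c \<noteq> 0 \<longrightarrow> g _ * _ = _\<close> by simp
  qed
  then show ?case
    by blast
qed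

lemma rational_curve_irreducible:
  fixes P :: "'a::alg_closed_field \<Rightarrow> 'a mat"
  assumes P: "Poly.regular m P" and q: "q \<in> range poly" "q c0 \<noteq> 0"
  shows "irreducible_set m {inverse (q c) \<cdot>\<^sub>m P c | c. q c \<noteq> 0}"
  unfolding irreducible_set_def
proof (intro ballI impI)
  obtain Q where Q: "q = poly Q"
    using q by auto
  have "Q \<noteq> 0"
    using q(2) Q by auto
  let ?S = "{inverse (q c) \<cdot>\<^sub>m P c | c. q c \<noteq> 0}"
  fix f g assume fg: "f \<in> poly_funs m" "g \<in> poly_funs m" and 0: "\<forall>A\<in>?S. f A * g A = 0"
  obtain N p where p: "\<And>c. q c \<noteq> 0 \<Longrightarrow> f (inverse (q c) \<cdot>\<^sub>m P c) * q c ^ N = poly p c"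
    using poly_fun_rational_curve[OF fg(1) P] unfolding Q by blast
  obtain M r where r: "\<And>c. q c \<noteq> 0 \<Longrightarrow> g (inverse (q c) \<cdot>\<^sub>m P c) * q c ^ M = poly r c"
    using poly_fun_rational_curve[OF fg(2) P] unfolding Q by blast
  \<comment> \<open>The factor \<open>Q\<close> makes the product vanish also at the parameters
    where the curve is undefined, so that \<open>p * r * Q\<close> has infinitely many
    roots.\<close>
  have "poly (p * r * Q) c = 0" for c
  proof (cases "q c = 0")
    case True
    then show ?thesis by (simp add: Q)
  next
    case False
    then have "f (inverse (q c) \<cdot>\<^sub>m P c) * g (inverse (q c) \<cdot>\<^sub>m P c) = 0"
      using 0 by blast
    then show ?thesis
      using p[OF False] r[OF False] by (auto simp flip: p r)
  qed
  then have "infinite {c. poly (p * r * Q) c = 0}"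
    using infinite_UNIV_alg_closed by simp
  then have "p * r * Q = 0"
    using poly_roots_finite by blast
  then have "p = 0 \<or> r = 0"
    using \<open>Q \<noteq> 0\<close> by auto
  then show "(\<forall>A\<in>?S. f A = 0) \<or> (\<forall>A\<in>?S. g A = 0)"
    using p r by auto
qed

text \<open>Both directions of the main equivalence pass through this criterion: from a dense orbit
  to a statement about functions vanishing on it, and back.\<close>

lemma closure_of_zariski_eq_iff:
  fixes X C :: "'a::idom mat set"
  assumes "X \<subseteq> C" "C \<subseteq> carrier_mat m m"
  shows "Abstract_Topology.closure_of (subtopology (zariski m) C) X = C \<longleftrightarrow>
    (\<forall>f\<in>poly_funs m. (\<forall>A\<in>X. f A = 0) \<longrightarrow> (\<forall>A\<in>C. f A = 0))" (is "?L \<longleftrightarrow> ?R")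
proof
  assume L: ?L
  show ?R
  proof (intro ballI impI)
    fix f A assume f: "f \<in> poly_funs m" "\<forall>A\<in>X. f A = 0" and A: "A \<in> C"
    have "closedin (subtopology (zariski m) C) (C \<inter> {A \<in> carrier_mat m m. f A = 0})"
      by (intro closedin_subtopology_Int_closed closedin_regular poly_funs_regular f)
    moreover have "X \<subseteq> C \<inter> {A \<in> carrier_mat m m. f A = 0}"
      using assms f by auto
    ultimately have "C \<subseteq> C \<inter> {A \<in> carrier_mat m m. f A = 0}"
      using closure_of_minimal L by metis
    then show "f A = 0"
      using A by auto
  qed
next
  assume R: ?R
  let ?K = "Abstract_Topology.closure_of (subtopology (zariski m) C) X"
  have "closedin (subtopology (zariski m) C) ?K"
    by simp
  then obtain Z where Z: "closedin (zariski m) Z" "?K = Z \<inter> C"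
    unfolding closedin_subtopology by auto
  obtain F where F: "F \<subseteq> poly_funs m" "Z = zero_locus m F"
    using Z(1) unfolding closedin_zariski by blast
  have "X \<subseteq> ?K"
    using assms by (intro closure_of_subset) auto
  then have "\<forall>f\<in>F. \<forall>A\<in>X. f A = 0"
    unfolding Z(2) F(2) zero_locus_def by blast
  then have "\<forall>f\<in>F. \<forall>A\<in>C. f A = 0"
    using R F(1) by blast
  then have "C \<subseteq> Z"
    using F(2) assms(2) by (auto simp: zero_locus_def)
  then show ?L
    using Z(2) by auto
qed

section \<open>Connected subgroups and eigenvectors modulo a flag\<close>

lemma SL_carrier_iff: "A \<in> carrier (SL m) \<longleftrightarrow> A \<in> carrier_mat m m \<and> det A = 1"
  by (simp add: special_linear_group_def)

lemma SL_mult [simp]: "A \<otimes>\<^bsub>SL m\<^esub> B = A * B"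
  by (simp add: special_linear_group_def)

lemma SL_one [simp]: "\<one>\<^bsub>SL m\<^esub> = 1\<^sub>m m"
  by (simp add: special_linear_group_def)

lemma SL_adj_mat:
  assumes "A \<in> carrier (SL m)"
  shows "A \<in> carrier_mat m m" "adj_mat A \<in> carrier_mat m m" "A * adj_mat A = 1\<^sub>m m" "adj_mat A * A = 1\<^sub>m m"
  using assms adj_mat[of A m] by (auto simp: SL_carrier_iff)

lemma SL_inv:
  assumes "(A :: 'a::field mat) \<in> carrier (SL m)"
  shows "inv\<^bsub>SL m\<^esub> A = adj_mat A"
proof -
  interpret group "SL m :: 'a mat monoid" by (rule group_SL)
  note * = SL_adj_mat[OF assms]
  have "det (adj_mat A) * det A = 1"
    using *(1,2,4) det_mult[of "adj_mat A" m A] by simp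
  then have "adj_mat A \<in> carrier (SL m)"
    using assms *(2) by (simp add: SL_carrier_iff)
  then show ?thesis
    using assms *(4) by (intro inv_equality) auto
qed

lemma connectedin_pointwise:
  assumes "\<And>x. x \<in> S \<Longrightarrow> \<exists>K\<subseteq>S. connectedin X K \<and> a \<in> K \<and> x \<in> K"
  shows "connectedin X S"
proof (cases "S = {}")
  case False
  define \<K> where "\<K> = {K. K \<subseteq> S \<and> connectedin X K \<and> a \<in> K}"
  have "connectedin X (\<Union>\<K>)"
    by (rule connectedin_Union) (auto simp: \<K>_def)
  moreover have "\<Union>\<K> = S"
    using assms unfolding \<K>_def by blast
  ultimately show ?thesis
    by simp
qed auto

text \<open>For fixed \<open>a\<close> the commutators of \<open>a\<close> with the elements of
  \<open>S\<close> form a regular image of \<open>S\<close> that contains the identity. Inverses are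
  a regular image again, and products are reached by translation.\<close>

lemma connectedin_derived:
  fixes S :: "'a::field mat set"
  assumes S: "subgroup S (SL m)" and conn: "connectedin (zariski m) S"
  shows "connectedin (zariski m) (derived (SL m) S)"
proof (rule connectedin_pointwise)
  interpret group "SL m :: 'a mat monoid" by (rule group_SL)
  let ?D = "derived (SL m) S"
  note subgroup.mem_carrier[OF S, simp]
  have SD: "subgroup ?D (SL m)"
    by (rule derived_is_subgroup[OF subgroup.subset[OF S]])
  have D_carrier: "x \<in> carrier (SL m)" if "x \<in> ?D" for x
    by (rule subgroup.mem_carrier[OF SD that])
  have id_mem: "1\<^sub>m m \<in> S" "1\<^sub>m m \<in> ?D"
    using subgroup.one_closed[OF S] subgroup.one_closed[OF SD] by simp_all
  have comm: "\<exists>K\<subseteq>?D. connectedin (zariski m) K \<and> 1\<^sub>m m \<in> K \<and> h \<in> K" if h: "h \<in> derived_set (SL m) S" for h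
  proof -
    obtain a b where ab': "a \<in> S" "b \<in> S"
      "h = a \<otimes>\<^bsub>SL m\<^esub> b \<otimes>\<^bsub>SL m\<^esub> inv\<^bsub>SL m\<^esub> a \<otimes>\<^bsub>SL m\<^esub> inv\<^bsub>SL m\<^esub> b"
      using h by blast
    then have ab: "a \<in> S" "b \<in> S" "h = a * b * adj_mat a * adj_mat b"
      by (simp_all add: SL_inv)
    let ?\<Phi> = "\<lambda>x. a * x * adj_mat a * adj_mat x"
    have a: "a \<in> carrier_mat m m" "adj_mat a \<in> carrier_mat m m" "a * adj_mat a = 1\<^sub>m m"
      using ab SL_adj_mat[of a m] by auto
    have "connectedin (zariski m) (?\<Phi> ` S)"
      by (intro connectedin_regular_image[OF _ conn] Mat.regular_mult Mat.regular_const
          Mat.regular_adj_mat regular_id a)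
    moreover have "?\<Phi> x \<in> ?D" if that: "x \<in> S" for x
    proof -
      have "a \<otimes>\<^bsub>SL m\<^esub> x \<otimes>\<^bsub>SL m\<^esub> inv\<^bsub>SL m\<^esub> a \<otimes>\<^bsub>SL m\<^esub> inv\<^bsub>SL m\<^esub> x \<in> ?D"
        unfolding derived_def by (intro generate.incl UN_I[OF ab(1)] UN_I[OF that] singletonI)
      then show ?thesis
        using ab that by (simp add: SL_inv)
    qed
    moreover have "1\<^sub>m m = ?\<Phi> (1\<^sub>m m)"
      using a SL_adj_mat[of "1\<^sub>m m :: 'a mat" m] by (simp add: SL_carrier_iff)
    then have "1\<^sub>m m \<in> ?\<Phi> ` S"
      using id_mem(1) by (rule image_eqI)
    moreover have "h \<in> ?\<Phi> ` S"
      using ab(3,2) by (rule image_eqI)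
    ultimately show ?thesis
      by (intro exI[of _ "?\<Phi> ` S"]) (simp add: image_subset_iff)
  qed
  show "\<exists>K\<subseteq>?D. connectedin (zariski m) K \<and> 1\<^sub>m m \<in> K \<and> x \<in> K" if "x \<in> ?D" for x
    using that unfolding derived_def
  proof (induction rule: generate.induct)
    case one
    then show ?case
      using id_mem(2) connectedin_sing[of "zariski m" "1\<^sub>m m"]
      by (intro exI[of _ "{1\<^sub>m m}"]) (simp add: derived_def)
  next
    case (incl h)
    then show ?case
      using comm[OF incl] unfolding derived_def by -
  next
    case (inv h)
    then obtain K where K: "K \<subseteq> ?D" "connectedin (zariski m) K" "1\<^sub>m m \<in> K" "h \<in> K"
      using comm by meson
    have eq: "adj_mat x = inv\<^bsub>SL m\<^esub> x" if "x \<in> K" for x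
      using that D_carrier K(1) by (subst SL_inv) auto
    have "connectedin (zariski m) (adj_mat ` K)"
      by (intro connectedin_regular_image[OF _ K(2)] Mat.regular_adj_mat regular_id)
    moreover have "adj_mat ` K \<subseteq> ?D"
      using K(1) eq subgroup.m_inv_closed[OF SD] by auto
    moreover have "1\<^sub>m m \<in> adj_mat ` K"
      using eq[OF K(3)] K(3) inv_one by force
    moreover have "inv\<^bsub>SL m\<^esub> h \<in> adj_mat ` K"
      using eq K(4) by force
    ultimately show ?case
      unfolding derived_def by meson
  next
    case (eng h1 h2)
    obtain K1 where K1: "K1 \<subseteq> ?D" "connectedin (zariski m) K1" "1\<^sub>m m \<in> K1" "h1 \<in> K1"
      using eng.IH(1) unfolding derived_def by meson
    obtain K2 where K2: "K2 \<subseteq> ?D" "connectedin (zariski m) K2" "1\<^sub>m m \<in> K2" "h2 \<in> K2"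
      using eng.IH(2) unfolding derived_def by meson
    have h1: "h1 \<in> carrier_mat m m" "h1 \<in> ?D"
      using K1 D_carrier by (auto simp: SL_carrier_iff)
    \<comment> \<open>The translate of \<open>K2\<close> by \<open>h1\<close> meets
      \<open>K1\<close> in \<open>h1\<close> and contains \<open>h1 * h2\<close>, so the union joins
      the identity to the product.\<close>
    have "connectedin (zariski m) ((\<lambda>x. h1 * x) ` K2)"
      by (intro connectedin_regular_image[OF _ K2(2)] Mat.regular_mult Mat.regular_const regular_id h1)
    moreover have h1K: "h1 \<in> (\<lambda>x. h1 * x) ` K2"
      using K2(3) h1 by force
    ultimately have "connectedin (zariski m) (K1 \<union> (\<lambda>x. h1 * x) ` K2)"
      using K1 by (intro connectedin_Un) auto
    moreover have "(\<lambda>x. h1 * x) ` K2 \<subseteq> ?D"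
      using K2(1) h1(2) subgroup.m_closed[OF SD] by auto
    ultimately show ?case
      using K1 K2 by (intro exI[of _ "K1 \<union> (\<lambda>x. h1 * x) ` K2"]) (auto simp: derived_def)
  qed
qed

section \<open>Vectors modulo the standard flag\<close>

text \<open>Congruence modulo the span of the first \<open>k\<close> unit vectors, which is
  \<open>flag_space k m\<close>. The quotient space is represented by this relation between vectors,
  without choosing coordinates on it.\<close>

definition tail_eq :: "nat \<Rightarrow> nat \<Rightarrow> 'a vec \<Rightarrow> 'a vec \<Rightarrow> bool" where
  "tail_eq k m x y \<longleftrightarrow> (\<forall>i. k \<le> i \<and> i < m \<longrightarrow> x $ i = y $ i)"

definition flag_space :: "nat \<Rightarrow> nat \<Rightarrow> 'a::zero vec set" where
  "flag_space k m = {x \<in> carrier_vec m. tail_eq k m x (0\<^sub>v m)}"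

definition invariant :: "'a::semiring_0 vec set \<Rightarrow> 'a mat \<Rightarrow> bool" where
  "invariant W A \<longleftrightarrow> (\<forall>x\<in>W. A *\<^sub>v x \<in> W)"

definition vec_subspace :: "nat \<Rightarrow> 'a::field vec set \<Rightarrow> bool" where
  "vec_subspace m W \<longleftrightarrow> W \<subseteq> carrier_vec m \<and> 0\<^sub>v m \<in> W \<and> (\<forall>x\<in>W. \<forall>y\<in>W. x + y \<in> W)
     \<and> (\<forall>c. \<forall>x\<in>W. c \<cdot>\<^sub>v x \<in> W)"

lemma vec_subspaceD:
  assumes "vec_subspace m W"
  shows "W \<subseteq> carrier_vec m" "0\<^sub>v m \<in> W" "x \<in> W \<Longrightarrow> y \<in> W \<Longrightarrow> x + y \<in> W" "x \<in> W \<Longrightarrow> c \<cdot>\<^sub>v x \<in> W"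
    "x \<in> W \<Longrightarrow> x \<in> carrier_vec m"
  using assms by (auto simp: vec_subspace_def)

lemma vec_subspace_diff_smult:
  assumes "vec_subspace m W" "x \<in> W" "y \<in> W"
  shows "x - c \<cdot>\<^sub>v y \<in> W"
proof -
  have "x - c \<cdot>\<^sub>v y = x + (- c) \<cdot>\<^sub>v y"
    using assms vec_subspaceD(5)[OF assms(1)] by (intro eq_vecI) auto
  then show ?thesis
    using vec_subspaceD(3,4)[OF assms(1)] assms by auto
qed

lemma vec_subspace_flag_space: "vec_subspace m (flag_space k m)"
  by (auto simp: vec_subspace_def flag_space_def tail_eq_def)

lemma vec_subspace_carrier_vec: "vec_subspace m (carrier_vec m)"
  by (simp add: vec_subspace_def)

lemma flag_space_0: "flag_space 0 m = {0\<^sub>v m :: 'a::field vec}"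
proof -
  have "x = 0\<^sub>v m" if "x \<in> flag_space 0 m" for x :: "'a vec"
    by (rule eq_vecI) (use that in \<open>auto simp: flag_space_def tail_eq_def\<close>)
  then show ?thesis
    using vec_subspaceD(2)[OF vec_subspace_flag_space] by blast
qed

lemma tail_eq_refl: "tail_eq k m x x"
  and tail_eq_sym: "tail_eq k m x y \<Longrightarrow> tail_eq k m y x"
  and tail_eq_trans: "tail_eq k m x y \<Longrightarrow> tail_eq k m y z \<Longrightarrow> tail_eq k m x z"
  by (auto simp: tail_eq_def)

lemma tail_eq_mult:
  fixes A :: "'a::comm_ring_1 mat"
  assumes A: "A \<in> carrier_mat m m" "invariant (flag_space k m) A"
    and xy: "x \<in> carrier_vec m" "y \<in> carrier_vec m" "tail_eq k m x y"
  shows "tail_eq k m (A *\<^sub>v x) (A *\<^sub>v y)"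
proof -
  have "x - y \<in> flag_space k m"
    using xy by (auto simp: flag_space_def tail_eq_def)
  then have "A *\<^sub>v (x - y) \<in> flag_space k m"
    using A by (auto simp: invariant_def)
  then have "A *\<^sub>v x - A *\<^sub>v y \<in> flag_space k m"
    using A xy by (simp add: mult_minus_distrib_mat_vec)
  then show ?thesis
    using A xy by (auto simp: flag_space_def tail_eq_def simp del: index_mult_mat_vec)
qed

lemma tail_eq_mult_smult:
  fixes A :: "'a::field mat"
  assumes A: "A \<in> carrier_mat m m" "invariant (flag_space k m) A"
    and xy: "x \<in> carrier_vec m" "y \<in> carrier_vec m" "tail_eq k m x (c \<cdot>\<^sub>v y)"
  shows "tail_eq k m (A *\<^sub>v x) (c \<cdot>\<^sub>v (A *\<^sub>v y))"
  using tail_eq_mult[OF A xy(1) _ xy(3)] A xy by (simp add: mult_mat_vec)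

section \<open>Dimension arguments by pivot positions\<close>

text \<open>The leading positions of an echelon form. For a subspace their number is the dimension,
  so it is a measure that detects proper inclusion.\<close>

definition pivots :: "nat \<Rightarrow> 'a::zero vec set \<Rightarrow> nat set" where
  "pivots m W = {i. i < m \<and> (\<exists>x\<in>W. x $ i \<noteq> 0 \<and> (\<forall>j<i. x $ j = 0))}"

text \<open>A vector of \<open>W\<close> loses its leading entry when a multiple of a vector of
  \<open>V\<close> with the same pivot is subtracted; \<open>l\<close> counts the coordinates that
  may still be nonzero.\<close>

lemma vec_subspace_eqI:
  assumes W: "vec_subspace m W" and V: "vec_subspace m V" and VW: "V \<subseteq> W"
    and piv: "pivots m W \<subseteq> pivots m V"
  shows "V = W"
proof -
  have "x \<in> V" if "l \<le> m" "x \<in> W" "\<forall>j<m - l. x $ j = 0" for l x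
    using that
  proof (induction l arbitrary: x)
    case 0
    then have "x = 0\<^sub>v m"
      using vec_subspaceD(5)[OF W] by (intro eq_vecI) auto
    then show ?case
      using vec_subspaceD(2)[OF V] by simp
  next
    case (Suc l)
    define i where "i = m - Suc l"
    have i: "i < m" "m - l = Suc i"
      using Suc.prems by (auto simp: i_def)
    show ?case
    proof (cases "x $ i = 0")
      case True
      then show ?thesis
        using Suc.prems i by (intro Suc.IH) (auto simp: less_Suc_eq i_def)
    next
      case False
      then have "i \<in> pivots m W"
        using Suc.prems i by (auto simp: pivots_def i_def)
      then obtain y where y: "y \<in> V" "y $ i \<noteq> 0" "\<forall>j<i. y $ j = 0"
        using piv by (auto simp: pivots_def)
      let ?c = "x $ i / y $ i"
      have dims: "x \<in> carrier_vec m" "y \<in> carrier_vec m"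
        using vec_subspaceD(5)[OF W] Suc.prems y VW by auto
      have "x - ?c \<cdot>\<^sub>v y \<in> W"
        using vec_subspace_diff_smult[OF W] Suc.prems y VW by auto
      moreover have "(x - ?c \<cdot>\<^sub>v y) $ j = 0" if "j < m - l" for j
        using that i Suc.prems(3) y dims by (cases "j = i") (auto simp: i_def less_Suc_eq)
      ultimately have "x - ?c \<cdot>\<^sub>v y \<in> V"
        using Suc by auto
      then have "x - ?c \<cdot>\<^sub>v y + ?c \<cdot>\<^sub>v y \<in> V"
        using vec_subspaceD(3,4)[OF V] y by auto
      moreover have "x - ?c \<cdot>\<^sub>v y + ?c \<cdot>\<^sub>v y = x"
        using dims by (intro eq_vecI) auto
      ultimately show ?thesis
        by simp
    qed
  qed
  from this[of m] show ?thesis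
    using VW by auto
qed

text \<open>Fewest pivots means least dimension. Applied to invariant subspaces, this yields the
  irreducible quotient in the proof of Lie and Kolchin.\<close>

lemma minimal_vec_subspace:
  assumes "Q W0" "\<And>W. Q W \<Longrightarrow> vec_subspace m W"
  obtains W where "Q W" "\<And>V. Q V \<Longrightarrow> V \<subseteq> W \<Longrightarrow> V = W"
proof -
  obtain W where W: "Q W" "\<And>V. Q V \<Longrightarrow> card (pivots m W) \<le> card (pivots m V)"
    using ex_has_least_nat[of Q W0 "\<lambda>W. card (pivots m W)"] assms(1) by auto
  have "V = W" if "Q V" "V \<subseteq> W" for V
  proof -
    have "pivots m V \<subseteq> pivots m W" "finite (pivots m W)"
      using that by (auto simp: pivots_def)
    then have "pivots m V = pivots m W"
      using W(2)[OF that(1)] by (intro card_subset_eq) (auto intro: antisym card_mono)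
    then show ?thesis
      using that W(1) assms(2) by (intro vec_subspace_eqI) auto
  qed
  with W(1) that show ?thesis
    by blast
qed

section \<open>Products of linear factors and eigenvectors on quotients\<close>

text \<open>The product of the factors \<open>A - a\<close>, with \<open>a\<close> running through
  the list, applied to \<open>x\<close>. Keeping the factors in a list allows them to be applied one
  at a time.\<close>

definition shift_prod :: "'a::comm_ring_1 mat \<Rightarrow> 'a list \<Rightarrow> 'a vec \<Rightarrow> 'a vec" where
  "shift_prod A as x = foldr (\<lambda>a y. A *\<^sub>v y - a \<cdot>\<^sub>v y) as x"

lemma shift_prod_simps [simp]:
  "shift_prod A [] x = x"
  "shift_prod A (a # as) x = A *\<^sub>v shift_prod A as x - a \<cdot>\<^sub>v shift_prod A as x"
  by (simp_all add: shift_prod_def)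

lemma shift_prod_carrier:
  "A \<in> carrier_mat m m \<Longrightarrow> x \<in> carrier_vec m \<Longrightarrow> shift_prod A as x \<in> carrier_vec m"
  by (induction as) auto

text \<open>The powers of \<open>A\<close> with exponents from 0 to \<open>m * m\<close> are
  linearly dependent, since the space of matrices has dimension \<open>m * m\<close>.\<close>

lemma annihilating_poly:
  fixes A :: "'a::field mat"
  assumes A: "A \<in> carrier_mat m m"
  obtains p where "p \<noteq> 0" "\<And>i j. i < m \<Longrightarrow> j < m \<Longrightarrow> (\<Sum>l\<le>degree p. coeff p l * (A ^\<^sub>m l) $$ (i, j)) = 0"
proof -
  define N where "N = m * m + 1"
  \<comment> \<open>Column \<open>l\<close> lists the entries of \<open>A ^\<^sub>m l\<close>. The
    extra last row of zeros makes the square matrix singular, and a kernel vector supplies the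
    coefficients of \<open>p\<close>.\<close>
  define B where "B = mat N N (\<lambda>(r, l). if r < m * m then (A ^\<^sub>m l) $$ (r div m, r mod m) else 0)"
  have B: "B \<in> carrier_mat N N"
    by (simp add: B_def)
  have "det B = 0"
    using laplace_expansion_row[OF B, of "m * m"] by (simp add: B_def N_def)
  then obtain v where v: "v \<in> carrier_vec N" "v \<noteq> 0\<^sub>v N" "B *\<^sub>v v = 0\<^sub>v N"
    using det_0_iff_vec_prod_zero_field[OF B] by auto
  define p where "p = Abs_poly (\<lambda>l. if l < N then v $ l else 0)"
  have coeff_p: "coeff p l = (if l < N then v $ l else 0)" for l
    unfolding p_def by (subst Abs_poly_inverse) (auto simp: MOST_nat intro!: exI[of _ N])
  obtain l where "l < N" "v $ l \<noteq> 0"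
    using v(1,2) by (metis carrier_vecD eq_vecI index_zero_vec)
  then have "p \<noteq> 0"
    using coeff_p[of l] by auto
  moreover have "(\<Sum>l\<le>degree p. coeff p l * (A ^\<^sub>m l) $$ (i, j)) = 0" if ij: "i < m" "j < m" for i j
  proof -
    define r where "r = i * m + j"
    have r: "r < m * m" "r div m = i" "r mod m = j"
    proof -
      have "i * m + j < i * m + m" using ij by simp
      also have "\<dots> \<le> m * m" using ij by (metis Suc_leI mult_Suc add.commute mult_le_mono1)
      finally show "r < m * m" by (simp add: r_def)
    qed (use ij in \<open>auto simp: r_def\<close>)
    have "degree p < N"
    proof (rule ccontr)
      assume "\<not> degree p < N"
      then have "coeff p (degree p) = 0" by (simp add: coeff_p)
      then show False using \<open>p \<noteq> 0\<close> by simp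
    qed
    then have "(\<Sum>l\<le>degree p. coeff p l * (A ^\<^sub>m l) $$ (i, j)) = (\<Sum>l<N. coeff p l * (A ^\<^sub>m l) $$ (i, j))"
      by (intro sum.mono_neutral_left) (auto simp: coeff_eq_0)
    also have "\<dots> = (B *\<^sub>v v) $ r"
      using r v(1) by (auto simp: B_def N_def scalar_prod_def coeff_p lessThan_atLeast0 mult.commute intro!: sum.cong)
    also have "\<dots> = 0"
      using v(3) r by (simp add: N_def)
    finally show ?thesis .
  qed
  ultimately show ?thesis
    using that by blast
qed

text \<open>An annihilating polynomial splits into linear factors. Its roots form a finite list that
  contains the eigenvalues of \<open>A\<close> on every quotient by an invariant flag space; the
  finiteness arguments below rest on this.\<close>

lemma exists_shift_prod_zero:
  fixes A :: "'a::alg_closed_field mat"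
  assumes A: "A \<in> carrier_mat m m"
  obtains as where "\<And>x. x \<in> carrier_vec m \<Longrightarrow> shift_prod A as x = 0\<^sub>v m"
proof -
  \<comment> \<open>\<open>ev p x\<close> is the value of \<open>p\<close> at \<open>A\<close>,
    applied to \<open>x\<close>, written by coordinates so that all sums are sums of field
    elements.\<close>
  define ev where "ev = (\<lambda>p x. vec m (\<lambda>i. \<Sum>l\<le>degree p. coeff p l * (A ^\<^sub>m l *\<^sub>v x) $ i))"
  have ev_bound: "ev p x = vec m (\<lambda>i. \<Sum>l\<le>D. coeff p l * (A ^\<^sub>m l *\<^sub>v x) $ i)" if "degree p \<le> D" for p x D
    unfolding ev_def using that
    by (intro eq_vecI) (auto intro!: sum.mono_neutral_left le_degree)
  have pow: "A ^\<^sub>m l \<in> carrier_mat m m" for l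
    using A by simp
  have ev_linear_factor: "ev ([:- a, 1:] * p) x = A *\<^sub>v ev p x - a \<cdot>\<^sub>v ev p x"
    if x: "x \<in> carrier_vec m" for a p x
  proof (intro eq_vecI)
    fix i assume "i < dim_vec (A *\<^sub>v ev p x - a \<cdot>\<^sub>v ev p x)"
    then have i: "i < m"
      by (simp add: ev_def)
    define D where "D = degree p"
    have Apow: "(A ^\<^sub>m Suc l *\<^sub>v x) $ i = (\<Sum>j<m. A $$ (i, j) * (A ^\<^sub>m l *\<^sub>v x) $ j)" for l
    proof -
      \<comment> \<open>The recursion for powers puts the new factor on the right, whereas the
        expansion needs it on the left.\<close>
      have "A ^\<^sub>m Suc l *\<^sub>v y = A *\<^sub>v (A ^\<^sub>m l *\<^sub>v y)" if "y \<in> carrier_vec m" for y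
        using that
      proof (induction l arbitrary: y)
        case (Suc l)
        have "A ^\<^sub>m Suc (Suc l) *\<^sub>v y = A ^\<^sub>m Suc l *\<^sub>v (A *\<^sub>v y)"
          using assoc_mult_mat_vec[OF pow[of "Suc l"] A Suc.prems] by simp
        also have "\<dots> = A *\<^sub>v (A ^\<^sub>m l *\<^sub>v (A *\<^sub>v y))"
          using A Suc.prems by (intro Suc.IH) simp
        also have "A ^\<^sub>m l *\<^sub>v (A *\<^sub>v y) = A ^\<^sub>m Suc l *\<^sub>v y"
          using assoc_mult_mat_vec[OF pow[of l] A Suc.prems] by simp
        finally show ?case .
      qed (use A in simp)
      from this[OF x] show ?thesis
        using i A by (simp add: scalar_prod_def lessThan_atLeast0)
    qed
    have "(A *\<^sub>v ev p x) $ i = (\<Sum>j<m. A $$ (i, j) * (\<Sum>l\<le>D. coeff p l * (A ^\<^sub>m l *\<^sub>v x) $ j))"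
      using i A by (simp add: ev_def scalar_prod_def D_def lessThan_atLeast0)
    also have "\<dots> = (\<Sum>l\<le>D. coeff p l * (A ^\<^sub>m Suc l *\<^sub>v x) $ i)"
      unfolding Apow sum_distrib_left by (subst sum.swap) (simp add: mult_ac)
    also have "\<dots> = (\<Sum>l\<le>Suc D. coeff (pCons 0 p) l * (A ^\<^sub>m l *\<^sub>v x) $ i)"
      by (subst sum.atMost_Suc_shift) simp
    finally have "(A *\<^sub>v ev p x) $ i = \<dots>" .
    moreover have "ev p x $ i = (\<Sum>l\<le>Suc D. coeff p l * (A ^\<^sub>m l *\<^sub>v x) $ i)"
      using i by (simp add: ev_bound[of p "Suc D"] D_def)
    moreover have "ev ([:- a, 1:] * p) x $ i = (\<Sum>l\<le>Suc D. coeff ([:- a, 1:] * p) l * (A ^\<^sub>m l *\<^sub>v x) $ i)"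
      using i degree_mult_le[of "[:- a, 1:]" p] by (subst ev_bound[of _ "Suc D"]) (auto simp: D_def)
    moreover have "(\<Sum>l\<le>Suc D. coeff ([:- a, 1:] * p) l * (A ^\<^sub>m l *\<^sub>v x) $ i)
        = (\<Sum>l\<le>Suc D. coeff (pCons 0 p) l * (A ^\<^sub>m l *\<^sub>v x) $ i)
          - a * (\<Sum>l\<le>Suc D. coeff p l * (A ^\<^sub>m l *\<^sub>v x) $ i)"
      unfolding sum_distrib_left sum_subtractf[symmetric]
      by (intro sum.cong refl) (simp add: left_diff_distrib)
    moreover have "(A *\<^sub>v ev p x - a \<cdot>\<^sub>v ev p x) $ i = (A *\<^sub>v ev p x) $ i - a * ev p x $ i"
      using i by (simp add: ev_def del: index_mult_mat_vec)
    ultimately show "ev ([:- a, 1:] * p) x $ i = (A *\<^sub>v ev p x - a \<cdot>\<^sub>v ev p x) $ i"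
      by metis
  qed (use A in \<open>simp_all add: ev_def\<close>)
  have ev_prod: "ev (\<Prod>a\<leftarrow>as. [:- a, 1:]) x = shift_prod A as x" if x: "x \<in> carrier_vec m" for as x
  proof (induction as)
    case Nil
    then show ?case
      using x A by (intro eq_vecI) (auto simp: ev_def)
  next
    case (Cons a as)
    then show ?case
      using ev_linear_factor[OF x] by simp
  qed
  obtain p where p: "p \<noteq> 0" "\<And>i j. i < m \<Longrightarrow> j < m \<Longrightarrow> (\<Sum>l\<le>degree p. coeff p l * (A ^\<^sub>m l) $$ (i, j)) = 0"
    using annihilating_poly[OF A] by blast
  obtain M where M: "p = Polynomial.smult (lead_coeff p) (\<Prod>x\<in>#M. [:-x, 1:])"
    using alg_closed_imp_factorization[OF p(1)] by blast
  obtain as where "mset as = M"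
    using ex_mset by blast
  then have "(\<Prod>x\<in>#M. [:-x, 1:]) = (\<Prod>a\<leftarrow>as. [:- a, 1:])" (is "_ = ?q")
    by (simp flip: prod_mset_prod_list)
  with M have p_eq: "Polynomial.smult (lead_coeff p) ?q = p"
    by (metis (no_types))
  have "shift_prod A as x = 0\<^sub>v m" if x: "x \<in> carrier_vec m" for x
  proof (rule eq_vecI)
    fix i assume "i < dim_vec (0\<^sub>v m :: 'a vec)"
    then have i: "i < m" by simp
    have deg: "degree ?q = degree p"
      using arg_cong[OF p_eq, of degree] p(1) by simp
    have "(\<Sum>l\<le>degree p. coeff p l * (A ^\<^sub>m l *\<^sub>v x) $ i)
        = (\<Sum>j<m. (\<Sum>l\<le>degree p. coeff p l * (A ^\<^sub>m l) $$ (i, j)) * x $ j)"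
      using i x A unfolding sum_distrib_right
      by (subst sum.swap) (auto simp: scalar_prod_def lessThan_atLeast0 sum_distrib_left mult.assoc intro!: sum.cong)
    also have "\<dots> = 0"
      using p(2)[OF i] by simp
    finally have "0 = (\<Sum>l\<le>degree p. coeff p l * (A ^\<^sub>m l *\<^sub>v x) $ i)"
      by simp
    also have "\<dots> = (\<Sum>l\<le>degree p. (lead_coeff p * coeff ?q l) * (A ^\<^sub>m l *\<^sub>v x) $ i)"
      by (simp only: p_eq flip: coeff_smult)
    also have "\<dots> = lead_coeff p * ev ?q x $ i"
      using i by (simp add: ev_def deg sum_distrib_left mult.assoc)
    finally show "shift_prod A as x $ i = 0\<^sub>v m $ i"
      using p(1) ev_prod[OF x] i by simp
  qed (use shift_prod_carrier[OF A] x in auto)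
  then show ?thesis
    using that by blast
qed

lemma shift_prod_eigenvector:
  fixes A :: "'a::field mat"
  assumes "A \<in> carrier_mat m m" "invariant (flag_space k m) A" "x \<in> carrier_vec m"
    "tail_eq k m (A *\<^sub>v x) (c \<cdot>\<^sub>v x)"
  shows "tail_eq k m (shift_prod A as x) ((\<Prod>a\<leftarrow>as. c - a) \<cdot>\<^sub>v x)"
proof (induction as)
  case Nil
  then show ?case using assms(3) by (simp add: tail_eq_refl)
next
  case (Cons a as)
  let ?y = "shift_prod A as x" and ?P = "\<Prod>a\<leftarrow>as. c - a"
  have y: "?y \<in> carrier_vec m"
    using shift_prod_carrier assms by blast
  have "tail_eq k m (A *\<^sub>v ?y) (?P \<cdot>\<^sub>v (A *\<^sub>v x))"
    using tail_eq_mult_smult[OF assms(1,2) y assms(3) Cons] .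
  then show ?case
    using Cons assms(1,3,4) y by (auto simp: tail_eq_def algebra_simps simp del: index_mult_mat_vec)
qed

text \<open>On the quotient each factor \<open>A - a\<close> multiplies the eigenvector by
  \<open>c - a\<close>; the whole product is zero, so some factor is.\<close>

lemma tail_eigenvalue_mem:
  fixes A :: "'a::field mat"
  assumes "A \<in> carrier_mat m m" "invariant (flag_space k m) A"
    and as: "\<And>x. x \<in> carrier_vec m \<Longrightarrow> shift_prod A as x = 0\<^sub>v m"
    and "x \<in> carrier_vec m" "x \<notin> flag_space k m" "tail_eq k m (A *\<^sub>v x) (c \<cdot>\<^sub>v x)"
  shows "c \<in> set as"
proof -
  obtain i where i: "k \<le> i" "i < m" "x $ i \<noteq> 0"
    using assms(4,5) by (auto simp: flag_space_def tail_eq_def)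
  have "tail_eq k m (0\<^sub>v m) ((\<Prod>a\<leftarrow>as. c - a) \<cdot>\<^sub>v x)"
    using shift_prod_eigenvector[OF assms(1,2,4,6), of as] as[OF assms(4)] by simp
  then have "(\<Prod>a\<leftarrow>as. c - a) = 0"
    using i assms(4) by (auto simp: tail_eq_def)
  then show ?thesis
    by (auto simp: prod_list_zero_iff)
qed

text \<open>The factors, applied one by one, eventually move \<open>x\<close> into the flag space;
  the last vector outside it is an eigenvector on the quotient.\<close>

lemma exists_tail_eigenvector:
  fixes A :: "'a::alg_closed_field mat"
  assumes A: "A \<in> carrier_mat m m" and W: "vec_subspace m W" "invariant W A" "x \<in> W - flag_space k m"
  shows "\<exists>c. \<exists>y\<in>W - flag_space k m. tail_eq k m (A *\<^sub>v y) (c \<cdot>\<^sub>v y)"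
proof -
  obtain as where as: "\<And>x. x \<in> carrier_vec m \<Longrightarrow> shift_prod A as x = 0\<^sub>v m"
    using exists_shift_prod_zero[OF A] by blast
  have inW: "shift_prod A bs x \<in> W" for bs
  proof (induction bs)
    case (Cons b bs)
    then show ?case
      using vec_subspace_diff_smult[OF W(1)] W(2) by (auto simp: invariant_def)
  qed (use W in auto)
  have "shift_prod A bs x \<in> flag_space k m \<Longrightarrow> ?thesis" for bs
  proof (induction bs)
    case (Cons b bs)
    let ?y = "shift_prod A bs x"
    show ?case
    proof (cases "?y \<in> flag_space k m")
      case False
      moreover have "tail_eq k m (A *\<^sub>v ?y) (b \<cdot>\<^sub>v ?y)"
        using Cons.prems A carrier_vecD[OF vec_subspaceD(5)[OF W(1) inW]]
        by (auto simp: flag_space_def tail_eq_def simp del: index_mult_mat_vec)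
      ultimately show ?thesis
        using inW by blast
    qed (rule Cons.IH)
  qed (use W in auto)
  moreover have "shift_prod A as x \<in> flag_space k m"
    using as W vec_subspaceD(5)[OF W(1)] by (auto simp: flag_space_def tail_eq_def)
  ultimately show ?thesis
    by blast
qed

section \<open>The theorem of Lie and Kolchin\<close>

lemma (in fun_algebra) regular_mult_mat_vec:
  assumes "regular m \<Phi>" "v \<in> carrier_vec m" "i < m"
  shows "(\<lambda>x. (\<Phi> x *\<^sub>v v) $ i) \<in> R"
proof -
  have "(\<lambda>x. \<Sum>j\<in>{0..<m}. \<Phi> x $$ (i, j) * v $ j) \<in> R"
    using assms by (intro sum mult const) (auto dest: regular_entry)
  then show ?thesis
  proof (rule cong)
    fix x assume "x \<in> D"
    then have "\<Phi> x \<in> carrier_mat m m"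
      using assms regular_carrier by auto
    then show "(\<Sum>j = 0..<m. \<Phi> x $$ (i, j) * v $ j) = (\<Phi> x *\<^sub>v v) $ i"
      using assms by (auto simp: scalar_prod_def intro!: sum.cong)
  qed
qed

lemma vec_subspace_tail_eigenspace:
  fixes S :: "'a::field mat set"
  assumes W: "vec_subspace m W" and S: "\<And>s. s \<in> S \<Longrightarrow> s \<in> carrier_mat m m"
  shows "vec_subspace m {w \<in> W. \<forall>s\<in>S. tail_eq k m (s *\<^sub>v w) (\<chi> s \<cdot>\<^sub>v w)}"
  unfolding vec_subspace_def
proof (intro conjI ballI allI)
  show "{w \<in> W. \<forall>s\<in>S. tail_eq k m (s *\<^sub>v w) (\<chi> s \<cdot>\<^sub>v w)} \<subseteq> carrier_vec m"
    using vec_subspaceD(1)[OF W] by auto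
  show "0\<^sub>v m \<in> {w \<in> W. \<forall>s\<in>S. tail_eq k m (s *\<^sub>v w) (\<chi> s \<cdot>\<^sub>v w)}"
    using vec_subspaceD(2)[OF W] S by (auto simp: tail_eq_def carrier_matD[of _ m m])
next
  fix x y assume x: "x \<in> {w \<in> W. \<forall>s\<in>S. tail_eq k m (s *\<^sub>v w) (\<chi> s \<cdot>\<^sub>v w)}"
    and y: "y \<in> {w \<in> W. \<forall>s\<in>S. tail_eq k m (s *\<^sub>v w) (\<chi> s \<cdot>\<^sub>v w)}"
  have xy: "x \<in> carrier_vec m" "y \<in> carrier_vec m"
    using x y vec_subspaceD(5)[OF W] by auto
  have "tail_eq k m (s *\<^sub>v (x + y)) (\<chi> s \<cdot>\<^sub>v (x + y))" if "s \<in> S" for s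
    using x y that S[OF that] xy
    by (simp add: mult_add_distrib_mat_vec[of s m m x y] tail_eq_def distrib_left del: index_mult_mat_vec)
  then show "x + y \<in> {w \<in> W. \<forall>s\<in>S. tail_eq k m (s *\<^sub>v w) (\<chi> s \<cdot>\<^sub>v w)}"
    using x y vec_subspaceD(3)[OF W] by auto
next
  fix c x assume x: "x \<in> {w \<in> W. \<forall>s\<in>S. tail_eq k m (s *\<^sub>v w) (\<chi> s \<cdot>\<^sub>v w)}"
  have cx: "x \<in> carrier_vec m"
    using x vec_subspaceD(5)[OF W] by auto
  have "tail_eq k m (s *\<^sub>v (c \<cdot>\<^sub>v x)) (\<chi> s \<cdot>\<^sub>v (c \<cdot>\<^sub>v x))" if "s \<in> S" for s
    using x that S[OF that] cx
    by (simp add: mult_mat_vec[of s m m x] tail_eq_def mult.left_commute del: index_mult_mat_vec)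
  then show "c \<cdot>\<^sub>v x \<in> {w \<in> W. \<forall>s\<in>S. tail_eq k m (s *\<^sub>v w) (\<chi> s \<cdot>\<^sub>v w)}"
    using x vec_subspaceD(4)[OF W] by auto
qed

lemma flag_space_tail_eigenvector:
  assumes "invariant (flag_space k m) A" "x \<in> flag_space k m"
  shows "tail_eq k m (A *\<^sub>v x) (c \<cdot>\<^sub>v (x :: 'a::comm_ring_1 vec))"
  using assms unfolding invariant_def flag_space_def tail_eq_def by auto

text \<open>
  The Lie--Kolchin theorem for the action on the quotient of an invariant subspace by a member of
  the standard flag: passing to quotients of this kind avoids block decompositions when the theorem
  is iterated.
\<close>

theorem lie_kolchin_tail:
  fixes S :: "'a::alg_closed_field mat set"
  assumes "subgroup S (SL m)" "connectedin (zariski m) S" "(derived (SL m) ^^ d) S = {1\<^sub>m m}"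
    and "\<And>s. s \<in> S \<Longrightarrow> invariant (flag_space k m) s"
    and "vec_subspace m W0" "flag_space k m \<subset> W0" "\<And>s. s \<in> S \<Longrightarrow> invariant W0 s"
  shows "\<exists>w\<in>W0 - flag_space k m. \<forall>s\<in>S. \<exists>c. tail_eq k m (s *\<^sub>v w) (c \<cdot>\<^sub>v w)"
  using assms
proof (induction d arbitrary: S W0)
  case 0
  then obtain w where w: "w \<in> W0 - flag_space k m"
    by blast
  then have "w \<in> carrier_vec m"
    using vec_subspaceD(5)[OF 0(5)] by auto
  then have "tail_eq k m (s *\<^sub>v w) (1 \<cdot>\<^sub>v w)" if "s \<in> S" for s
    using that 0(3) by (simp add: tail_eq_refl)
  then show ?case
    using w by blast
next
  case (Suc d)
  interpret group "SL m :: 'a mat monoid" by (rule group_SL)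
  let ?U = "flag_space k m :: 'a vec set"
  define S' where "S' = derived (SL m) S"
  note S = Suc.prems(1) and conn = Suc.prems(2) and inv_U = Suc.prems(4)
  \<comment> \<open>For a minimal \<open>W\<close> the quotient of \<open>W\<close> by
    \<open>?U\<close> is an irreducible module for \<open>S\<close>. Irreducibility is used below in
    the form \<open>W_eq\<close>.\<close>
  define Q where "Q W \<longleftrightarrow> vec_subspace m W \<and> ?U \<subset> W \<and> (\<forall>s\<in>S. invariant W s) \<and> W \<subseteq> W0" for W
  have "Q W0"
    using Suc.prems by (auto simp: Q_def)
  then obtain W where W: "Q W" and min: "\<And>V. Q V \<Longrightarrow> V \<subseteq> W \<Longrightarrow> V = W"
    using minimal_vec_subspace[of Q W0 m] by (auto simp: Q_def)
  have Wsub: "vec_subspace m W" and UW: "?U \<subset> W" and inv_W: "\<And>s. s \<in> S \<Longrightarrow> invariant W s" and WW0: "W \<subseteq> W0"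
    using W by (auto simp: Q_def)
  have W_eq: "V = W" if "V \<subseteq> W" "vec_subspace m V" "?U \<subseteq> V" "x \<in> V - ?U" "\<And>s. s \<in> S \<Longrightarrow> invariant V s" for V x
    using that WW0 by (intro min) (auto simp: Q_def)
  have Wc: "x \<in> carrier_vec m" if "x \<in> W" for x
    using that vec_subspaceD(5)[OF Wsub] by auto
  have S'S: "S' \<subseteq> S"
    unfolding S'_def using derived_incl[OF subset_refl S] .
  have SL: "s \<in> carrier (SL m)" if "s \<in> S" for s
    by (rule subgroup.mem_carrier[OF S that])
  have Sc: "s \<in> carrier_mat m m" and Sadj: "adj_mat s \<in> carrier_mat m m" "s * adj_mat s = 1\<^sub>m m" "adj_mat s * s = 1\<^sub>m m"
    if "s \<in> S" for s
    using SL_adj_mat[OF SL[OF that]] by auto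
  have S_adj: "adj_mat s \<in> S" if "s \<in> S" for s
    using subgroup.m_inv_closed[OF S that] SL_inv[OF SL[OF that]] by simp
  have S1: "1\<^sub>m m \<in> S"
    using subgroup.one_closed[OF S] by simp
  have S_mult: "s * t \<in> S" if "s \<in> S" "t \<in> S" for s t
    using subgroup.m_closed[OF S that] by simp
  have cancel: "adj_mat s *\<^sub>v (s *\<^sub>v x) = x" if "s \<in> S" "x \<in> carrier_vec m" for s x
    using Sc Sadj that by (simp flip: assoc_mult_mat_vec[of _ m m _ m])
  have notU: "s *\<^sub>v x \<in> W - ?U" if "s \<in> S" "x \<in> W - ?U" for s x
  proof -
    have "s *\<^sub>v x \<in> W"
      using inv_W that by (auto simp: invariant_def)
    moreover have "s *\<^sub>v x \<notin> ?U"
    proof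
      assume "s *\<^sub>v x \<in> ?U"
      then have "adj_mat s *\<^sub>v (s *\<^sub>v x) \<in> ?U"
        using inv_U[OF S_adj[OF that(1)]] by (auto simp: invariant_def)
      moreover have "adj_mat s *\<^sub>v (s *\<^sub>v x) = x"
        using that Wc by (intro cancel) auto
      ultimately show False
        using that by simp
    qed
    ultimately show ?thesis
      by blast
  qed
  \<comment> \<open>The derived subgroup is connected, its derived series is one step shorter, and
    it leaves \<open>W\<close> invariant.\<close>
  have "\<exists>w\<in>W - ?U. \<forall>s\<in>S'. \<exists>c. tail_eq k m (s *\<^sub>v w) (c \<cdot>\<^sub>v w)"
  proof (rule Suc.IH)
    show "subgroup S' (SL m)"
      unfolding S'_def using derived_is_subgroup[OF subgroup.subset[OF S]] .
    show "connectedin (zariski m) S'"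
      unfolding S'_def using connectedin_derived[OF S conn] .
    show "(derived (SL m) ^^ d) S' = {1\<^sub>m m}"
      using Suc.prems(3) by (simp add: S'_def funpow_swap1)
  qed (use S'S inv_U inv_W Wsub UW in auto)
  then obtain v where v: "v \<in> W - ?U" "\<forall>s\<in>S'. \<exists>c. tail_eq k m (s *\<^sub>v v) (c \<cdot>\<^sub>v v)"
    by blast
  have vc: "v \<in> carrier_vec m"
    using v Wc by auto
  then obtain i0 where i0: "k \<le> i0" "i0 < m" "v $ i0 \<noteq> 0"
    using v(1) by (auto simp: flag_space_def tail_eq_def)
  \<comment> \<open>Reading the eigenvalue off at a coordinate where \<open>v\<close> is nonzero
    makes it a regular function of the matrix, to which connectedness applies.\<close>
  define \<chi> where "\<chi> s = (s *\<^sub>v v) $ i0 * inverse (v $ i0)" for s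
  have \<chi>: "tail_eq k m (s *\<^sub>v v) (\<chi> s \<cdot>\<^sub>v v)" if s: "s \<in> S'" for s
  proof -
    obtain c where c: "tail_eq k m (s *\<^sub>v v) (c \<cdot>\<^sub>v v)"
      using v s by blast
    then have "(s *\<^sub>v v) $ i0 = c * v $ i0"
      using i0 vc by (simp add: tail_eq_def del: index_mult_mat_vec)
    then have "\<chi> s = c"
      using i0 by (simp add: \<chi>_def del: index_mult_mat_vec)
    with c show ?thesis
      by simp
  qed
  have \<chi>_regular: "(\<lambda>x. \<chi> (\<Phi> x)) \<in> regular_funs m" if "Mat.regular m m \<Phi>" for \<Phi>
    unfolding \<chi>_def by (intro Mat.mult Mat.const Mat.regular_mult_mat_vec[OF that vc i0(2)])
  have conj_mem: "adj_mat x * s * x \<in> S'" if x: "x \<in> S" and s: "s \<in> S'" for x s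
  proof -
    have "inv\<^bsub>SL m\<lparr>carrier := S\<rparr>\<^esub> x \<otimes>\<^bsub>SL m\<lparr>carrier := S\<rparr>\<^esub> s \<otimes>\<^bsub>SL m\<lparr>carrier := S\<rparr>\<^esub> x \<in> S'"
      unfolding S'_def using derived_subgroup_is_normal[OF S] x s S'_def
      by (intro normal.inv_op_closed1) auto
    then show ?thesis
      using x SL_inv[OF SL[OF x]] m_inv_consistent[OF S x] by simp
  qed
  have conj_act: "tail_eq k m (s *\<^sub>v (x *\<^sub>v y)) (c \<cdot>\<^sub>v (x *\<^sub>v y))"
    if x: "x \<in> S" and s: "s \<in> S'" and y: "y \<in> carrier_vec m"
      and eig: "tail_eq k m ((adj_mat x * s * x) *\<^sub>v y) (c \<cdot>\<^sub>v y)" for x s y c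
  proof -
    have sS: "s \<in> S"
      using s S'S by auto
    have "tail_eq k m (x *\<^sub>v ((adj_mat x * s * x) *\<^sub>v y)) (c \<cdot>\<^sub>v (x *\<^sub>v y))"
      using Sc[OF x] inv_U[OF x] y eig Sc[of "adj_mat x * s * x"] conj_mem[OF x s] S'S
      by (intro tail_eq_mult_smult) auto
    moreover have "x *\<^sub>v ((adj_mat x * s * x) *\<^sub>v y) = (x * (adj_mat x * s * x)) *\<^sub>v y"
      using Sc[OF x] Sc[OF sS] Sadj(1)[OF x] y
      by (intro assoc_mult_mat_vec[symmetric, of _ m m _ m] mult_carrier_mat[of _ m m])
    moreover have "x * (adj_mat x * s * x) = (x * adj_mat x) * (s * x)"
      using Sc[OF x] Sc[OF sS] Sadj(1)[OF x]
      by (simp add: assoc_mult_mat[of _ m m _ m _ m])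
    ultimately show ?thesis
      using Sc[OF x] Sc[OF sS] Sadj(2)[OF x] y by simp
  qed
  have \<chi>_conj: "\<chi> (adj_mat h * s * h) = \<chi> s" if h: "h \<in> S" and s: "s \<in> S'" for h s
  proof -
    have sS: "s \<in> S"
      using s S'S by auto
    obtain as where as: "\<And>x. x \<in> carrier_vec m \<Longrightarrow> shift_prod s as x = 0\<^sub>v m"
      using exists_shift_prod_zero[OF Sc[OF sS]] by blast
    \<comment> \<open>\<open>x *\<^sub>v v\<close> is an eigenvector of \<open>s\<close> with
      eigenvalue \<open>\<chi> (adj_mat x * s * x)\<close>. As a function of \<open>x\<close> this
      takes finitely many values on the connected \<open>S\<close>, so it keeps its value at the
      identity.\<close>
    have fin: "\<chi> (adj_mat x * s * x) \<in> set as" if x: "x \<in> S" for x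
    proof -
      have "tail_eq k m (s *\<^sub>v (x *\<^sub>v v)) (\<chi> (adj_mat x * s * x) \<cdot>\<^sub>v (x *\<^sub>v v))"
        by (rule conj_act[OF x s vc \<chi>[OF conj_mem[OF x s]]])
      then show ?thesis
        using Sc[OF sS] Sc[OF x] inv_U[OF sS] as notU[OF x v(1)] vc
        by (intro tail_eigenvalue_mem[of s m k as "x *\<^sub>v v"]) auto
    qed
    have "\<chi> (adj_mat h * s * h) = \<chi> (adj_mat (1\<^sub>m m) * s * 1\<^sub>m m)"
    proof (rule connectedin_regular_const[OF conn _ _ h S1])
      show "(\<lambda>x. \<chi> (adj_mat x * s * x)) \<in> regular_funs m"
        by (intro \<chi>_regular Mat.regular_mult Mat.regular_const Mat.regular_adj_mat regular_id Sc sS)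
      show "finite ((\<lambda>x. \<chi> (adj_mat x * s * x)) ` S)"
        by (rule finite_subset[of _ "set as"]) (use fin in auto)
    qed
    also have "adj_mat (1\<^sub>m m) * s * 1\<^sub>m m = s"
      using Sadj[OF S1] Sc[OF sS] by simp
    finally show ?thesis .
  qed
  \<comment> \<open>The weight space of \<open>\<chi>\<close> is stable under \<open>S\<close>
    because \<open>\<chi>\<close> is invariant under conjugation. By irreducibility it is all of
    \<open>W\<close>: the derived subgroup acts on the quotient by scalars.\<close>
  define V where "V = {w \<in> W. \<forall>s\<in>S'. tail_eq k m (s *\<^sub>v w) (\<chi> s \<cdot>\<^sub>v w)}"
  have "V = W"
  proof (rule W_eq)
    show "V \<subseteq> W"
      by (auto simp: V_def)
    show "vec_subspace m V"
      unfolding V_def using S'S Sc by (intro vec_subspace_tail_eigenspace Wsub) auto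
    show "?U \<subseteq> V"
      unfolding V_def using UW S'S inv_U flag_space_tail_eigenvector by blast
    show "v \<in> V - ?U"
      using v(1) \<chi> by (auto simp: V_def)
    show "invariant V h" if h: "h \<in> S" for h
      unfolding invariant_def
    proof
      fix w assume w: "w \<in> V"
      then have wW: "w \<in> W" and wc: "w \<in> carrier_vec m"
        using Wc by (auto simp: V_def)
      have "tail_eq k m (s *\<^sub>v (h *\<^sub>v w)) (\<chi> s \<cdot>\<^sub>v (h *\<^sub>v w))" if s: "s \<in> S'" for s
      proof -
        have "tail_eq k m ((adj_mat h * s * h) *\<^sub>v w) (\<chi> s \<cdot>\<^sub>v w)"
          using w conj_mem[OF h s] \<chi>_conj[OF h s] by (auto simp: V_def)
        then show ?thesis
          by (rule conj_act[OF h s wc])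
      qed
      then show "h *\<^sub>v w \<in> V"
        using inv_W[OF h] wW by (auto simp: V_def invariant_def)
    qed
  qed
  then have scalar: "tail_eq k m (s *\<^sub>v w) (\<chi> s \<cdot>\<^sub>v w)" if "s \<in> S'" "w \<in> W" for s w
    using that by (auto simp: V_def)
  have commutator: "a * b * adj_mat a * adj_mat b \<in> S'" if ab: "a \<in> S" "b \<in> S" for a b
  proof -
    have "a \<otimes>\<^bsub>SL m\<^esub> b \<otimes>\<^bsub>SL m\<^esub> inv\<^bsub>SL m\<^esub> a \<otimes>\<^bsub>SL m\<^esub> inv\<^bsub>SL m\<^esub> b \<in> S'"
      unfolding S'_def derived_def by (intro generate.incl UN_I[OF ab(1)] UN_I[OF ab(2)] singletonI)
    then show ?thesis
      using SL_inv[OF SL] ab by simp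
  qed
  have commute: "tail_eq k m (a *\<^sub>v (b *\<^sub>v w)) (b *\<^sub>v (a *\<^sub>v w))" if a: "a \<in> S" and b: "b \<in> S" and w: "w \<in> W" for a b w
  proof -
    \<comment> \<open>\<open>\<zeta> x\<close> is the scalar by which the commutator of
      \<open>x\<close> and \<open>b\<close> acts. If \<open>b\<close> has the eigenvalue
      \<open>\<mu>\<close> on \<open>y\<close>, then it has the eigenvalue
      \<open>\<mu> / \<zeta> x\<close> on \<open>x *\<^sub>v y\<close>; so \<open>\<zeta>\<close>
      takes finitely many values on \<open>S\<close> and is constantly 1. This replaces the usual
      determinant argument on the quotient.\<close>
    define \<zeta> where "\<zeta> x = \<chi> (x * b * adj_mat x * adj_mat b)" for x
    have \<zeta>: "tail_eq k m (x *\<^sub>v (b *\<^sub>v y)) (\<zeta> x \<cdot>\<^sub>v (b *\<^sub>v (x *\<^sub>v y)))" if x: "x \<in> S" and y: "y \<in> W" for x y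
    proof -
      let ?c = "x * b * adj_mat x * adj_mat b"
      note c = Sc[OF x] Sc[OF b] Sadj(1)[OF x] Sadj(1)[OF b] Wc[OF y]
      have "b *\<^sub>v (x *\<^sub>v y) \<in> W"
        using inv_W[OF x] inv_W[OF b] y by (auto simp: invariant_def)
      then have "tail_eq k m (?c *\<^sub>v (b *\<^sub>v (x *\<^sub>v y))) (\<zeta> x \<cdot>\<^sub>v (b *\<^sub>v (x *\<^sub>v y)))"
        unfolding \<zeta>_def using scalar[OF commutator[OF x b]] by blast
      also have "?c *\<^sub>v (b *\<^sub>v (x *\<^sub>v y)) = x *\<^sub>v (b *\<^sub>v (adj_mat x *\<^sub>v (adj_mat b *\<^sub>v (b *\<^sub>v (x *\<^sub>v y)))))"
        using c by (simp add: assoc_mult_mat_vec[of _ m m _ m] mult_carrier_mat[of _ m m] del: assoc_mult_mat)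
      also have "\<dots> = x *\<^sub>v (b *\<^sub>v y)"
        using c cancel[OF x] cancel[OF b] by simp
      finally show ?thesis .
    qed
    obtain as where as: "\<And>x. x \<in> carrier_vec m \<Longrightarrow> shift_prod b as x = 0\<^sub>v m"
      using exists_shift_prod_zero[OF Sc[OF b]] by blast
    obtain \<mu> y where y: "y \<in> W - ?U" "tail_eq k m (b *\<^sub>v y) (\<mu> \<cdot>\<^sub>v y)"
      using exists_tail_eigenvector[OF Sc[OF b] Wsub inv_W[OF b] v(1)] by blast
    have yc: "y \<in> carrier_vec m"
      using y Wc by auto
    have \<zeta>_mem: "\<zeta> x \<in> (\<lambda>\<alpha>. \<mu> / \<alpha>) ` set as" if x: "x \<in> S" for x
    proof -
      let ?z = "x *\<^sub>v y"
      have zW: "?z \<in> W - ?U" and bz: "b *\<^sub>v ?z \<in> W - ?U" and by': "b *\<^sub>v y \<in> W - ?U"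
        using notU x b y by auto
      note dims = carrier_matD[OF Sc[OF x]] carrier_matD[OF Sc[OF b]]
      have zc: "?z \<in> carrier_vec m" "b *\<^sub>v ?z \<in> carrier_vec m" "b *\<^sub>v y \<in> carrier_vec m"
        using Wc zW bz by' by auto
      have "tail_eq k m (x *\<^sub>v (b *\<^sub>v y)) (\<mu> \<cdot>\<^sub>v ?z)"
        using Sc[OF x] inv_U[OF x] yc zc y(2) by (intro tail_eq_mult_smult) auto
      moreover have "tail_eq k m (x *\<^sub>v (b *\<^sub>v y)) (\<zeta> x \<cdot>\<^sub>v (b *\<^sub>v ?z))"
        using \<zeta>[OF x] y by auto
      ultimately have eq: "tail_eq k m (\<mu> \<cdot>\<^sub>v ?z) (\<zeta> x \<cdot>\<^sub>v (b *\<^sub>v ?z))"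
        by (metis tail_eq_sym tail_eq_trans)
      have "\<mu> \<noteq> 0"
        using y(2) by' yc zc dims by (auto simp: flag_space_def tail_eq_def simp del: index_mult_mat_vec)
      moreover have "\<zeta> x \<noteq> 0"
      proof
        assume "\<zeta> x = 0"
        then have "?z \<in> ?U"
          using eq zc dims \<open>\<mu> \<noteq> 0\<close> by (auto simp: flag_space_def tail_eq_def simp del: index_mult_mat_vec)
        then show False
          using zW by auto
      qed
      ultimately have "tail_eq k m (b *\<^sub>v ?z) ((\<mu> / \<zeta> x) \<cdot>\<^sub>v ?z)"
        using eq zc dims by (auto simp: tail_eq_def field_simps simp del: index_mult_mat_vec)
      then have "\<mu> / \<zeta> x \<in> set as"
        using Sc[OF b] inv_U[OF b] as zc zW by (intro tail_eigenvalue_mem[of b m k as ?z]) auto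
      moreover have "\<zeta> x = \<mu> / (\<mu> / \<zeta> x)"
        using \<open>\<mu> \<noteq> 0\<close> by simp
      ultimately show ?thesis
        by (rule rev_image_eqI)
    qed
    have "\<zeta> a = \<zeta> (1\<^sub>m m)"
    proof (rule connectedin_regular_const[OF conn _ _ a S1])
      show "\<zeta> \<in> regular_funs m"
        unfolding \<zeta>_def
        by (intro \<chi>_regular Mat.regular_mult Mat.regular_const Mat.regular_adj_mat regular_id Sc[OF b] Sadj(1)[OF b])
      show "finite (\<zeta> ` S)"
        by (rule finite_subset[of _ "(\<lambda>\<alpha>. \<mu> / \<alpha>) ` set as"]) (use \<zeta>_mem in auto)
    qed
    also have "\<zeta> (1\<^sub>m m) = 1"
      using Sadj[OF S1] Sadj[OF b] Sc[OF b] vc i0 by (simp add: \<zeta>_def \<chi>_def del: index_mult_mat_vec)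
    finally show ?thesis
      using \<zeta>[OF a w] by simp
  qed
  have "\<exists>c. tail_eq k m (b *\<^sub>v v) (c \<cdot>\<^sub>v v)" if b: "b \<in> S" for b
  proof -
    obtain \<mu> y where y: "y \<in> W - ?U" "tail_eq k m (b *\<^sub>v y) (\<mu> \<cdot>\<^sub>v y)"
      using exists_tail_eigenvector[OF Sc[OF b] Wsub inv_W[OF b] v(1)] by blast
    \<comment> \<open>As \<open>S\<close> acts commutatively on the quotient, an eigenspace of
      \<open>b\<close> is stable under \<open>S\<close> and fills \<open>W\<close>. So each
      \<open>b\<close> acts by a scalar, and \<open>v\<close> is an eigenvector of all of
      them.\<close>
    define E where "E = {w \<in> W. \<forall>s\<in>{b}. tail_eq k m (s *\<^sub>v w) (\<mu> \<cdot>\<^sub>v w)}"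
    have "E = W"
    proof (rule W_eq)
      show "E \<subseteq> W"
        by (auto simp: E_def)
      show "vec_subspace m E"
        unfolding E_def using Sc[OF b] by (intro vec_subspace_tail_eigenspace Wsub) auto
      show "?U \<subseteq> E"
        unfolding E_def using UW flag_space_tail_eigenvector[OF inv_U[OF b]] by blast
      show "y \<in> E - ?U"
        using y by (auto simp: E_def)
      show "invariant E a" if a: "a \<in> S" for a
        unfolding invariant_def
      proof
        fix w assume w: "w \<in> E"
        have wc: "w \<in> carrier_vec m" "b *\<^sub>v w \<in> carrier_vec m"
          using w Wc Sc[OF b] by (auto simp: E_def)
        have "tail_eq k m (a *\<^sub>v (b *\<^sub>v w)) (\<mu> \<cdot>\<^sub>v (a *\<^sub>v w))"
          using w Sc[OF a] inv_U[OF a] wc by (intro tail_eq_mult_smult) (auto simp: E_def)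
        moreover have "tail_eq k m (b *\<^sub>v (a *\<^sub>v w)) (a *\<^sub>v (b *\<^sub>v w))"
          using w commute[OF b a] by (auto simp: E_def)
        ultimately show "a *\<^sub>v w \<in> E"
          using w inv_W[OF a] tail_eq_trans by (auto simp: E_def invariant_def)
      qed
    qed
    then show ?thesis
      using v(1) by (auto simp: E_def)
  qed
  then show ?case
    using v(1) WW0 by blast
qed

section \<open>The upper triangular Borel subgroup\<close>

text \<open>The derived series may be computed in the ambient group, so the induction on its length
  can stay inside \<open>SL m\<close>.\<close>

lemma (in group) solvable_subgroup_iff:
  assumes "subgroup H G"
  shows "solvable (G\<lparr>carrier := H\<rparr>) \<longleftrightarrow> (\<exists>n. (derived G ^^ n) H = {\<one>})"
proof -
  interpret H: group "G\<lparr>carrier := H\<rparr>"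
    by (rule subgroup_imp_group[OF assms])
  have "(derived G ^^ n) H \<subseteq> H \<and> (derived (G\<lparr>carrier := H\<rparr>) ^^ n) H = (derived G ^^ n) H" for n
    by (induction n) (use assms derived_incl derived_consistent in auto)
  then show ?thesis
    using H.solvable_iff_trivial_derived_seq by simp
qed

lemma (in fun_algebra) regular_transpose:
  assumes "regular m \<Phi>"
  shows "regular m (\<lambda>x. transpose_mat (\<Phi> x))"
proof (rule regularI)
  fix i j assume ij: "i < m" "j < m"
  have "(\<lambda>x. \<Phi> x $$ (j, i)) \<in> R"
    using assms ij by (auto dest: regular_entry)
  then show "(\<lambda>x. transpose_mat (\<Phi> x) $$ (i, j)) \<in> R"
    by (rule cong) (use assms ij in \<open>auto dest!: regular_carrier\<close>)
qed (use assms in \<open>auto dest!: regular_carrier\<close>)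

text \<open>The inverse transpose is the action on linear forms. It turns the statement about
  eigenvectors into the one about eigenforms.\<close>

lemma group_hom_inverse_transpose:
  "group_hom (SL m) (SL m :: 'a::field mat monoid) (\<lambda>A. transpose_mat (adj_mat A))"
proof (rule group_hom.intro[OF group_SL group_SL])
  interpret group "SL m :: 'a mat monoid" by (rule group_SL)
  show "group_hom_axioms (SL m) (SL m :: 'a mat monoid) (\<lambda>A. transpose_mat (adj_mat A))"
  proof (unfold group_hom_axioms_def, rule homI)
    fix A B :: "'a mat" assume A: "A \<in> carrier (SL m)" and B: "B \<in> carrier (SL m)"
    have "adj_mat A \<in> carrier (SL m)"
      using inv_closed[OF A] SL_inv[OF A] by simp
    then show "transpose_mat (adj_mat A) \<in> carrier (SL m)"
      using det_transpose[of "adj_mat A" m] by (simp add: SL_carrier_iff)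
    have "adj_mat (A * B) = adj_mat B * adj_mat A"
      using inv_mult_group[OF A B] SL_inv[OF A] SL_inv[OF B] SL_inv[OF m_closed[OF A B]] by simp
    then show "transpose_mat (adj_mat (A \<otimes>\<^bsub>SL m\<^esub> B)) = transpose_mat (adj_mat A) \<otimes>\<^bsub>SL m\<^esub> transpose_mat (adj_mat B)"
      using transpose_mult[OF SL_adj_mat(2)[OF B] SL_adj_mat(2)[OF A]] by simp
  qed
qed

text \<open>The quotient by the zero flag space, where congruence is equality;
  \<open>m \<ge> 1\<close> makes the whole space nonzero.\<close>

lemma lie_kolchin_eigenvector:
  fixes S :: "'a::alg_closed_field mat set"
  assumes "m \<ge> 1" "subgroup S (SL m)" "connectedin (zariski m) S" "(derived (SL m) ^^ d) S = {1\<^sub>m m}"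
  obtains v where "v \<in> carrier_vec m" "v \<noteq> 0\<^sub>v m" "\<And>s. s \<in> S \<Longrightarrow> \<exists>c. s *\<^sub>v v = c \<cdot>\<^sub>v v"
proof -
  have Sc: "s \<in> carrier_mat m m" if "s \<in> S" for s
    using subgroup.mem_carrier[OF assms(2) that] by (simp add: SL_carrier_iff)
  have "(unit_vec m 0 :: 'a vec) \<in> carrier_vec m - flag_space 0 m"
    using assms(1) by (auto simp: flag_space_0)
  then have "flag_space 0 m \<subset> (carrier_vec m :: 'a vec set)"
    using vec_subspaceD(1)[OF vec_subspace_flag_space] by blast
  moreover have "invariant (flag_space 0 m) s" "invariant (carrier_vec m) s" if "s \<in> S" for s
    using Sc[OF that] by (auto simp: flag_space_0 invariant_def)
  ultimately have "\<exists>w\<in>carrier_vec m - flag_space 0 m. \<forall>s\<in>S. \<exists>c. tail_eq 0 m (s *\<^sub>v w) (c \<cdot>\<^sub>v w)"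
    by (intro lie_kolchin_tail[OF assms(2-4)] vec_subspace_carrier_vec)
  then obtain w where w: "w \<in> carrier_vec m - flag_space 0 m"
    "\<forall>s\<in>S. \<exists>c. tail_eq 0 m (s *\<^sub>v w) (c \<cdot>\<^sub>v w)"
    by blast
  have "s *\<^sub>v w = c \<cdot>\<^sub>v w" if "s \<in> S" "tail_eq 0 m (s *\<^sub>v w) (c \<cdot>\<^sub>v w)" for s c
    using that w(1) Sc by (intro eq_vecI) (auto simp: tail_eq_def carrier_matD[of _ m m] simp del: index_mult_mat_vec)
  note eigen = this
  show ?thesis
  proof (rule that)
    show "w \<in> carrier_vec m" "w \<noteq> 0\<^sub>v m"
      using w(1) flag_space_0 by auto
    show "\<exists>c. s *\<^sub>v w = c \<cdot>\<^sub>v w" if "s \<in> S" for s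
      using w(2) eigen[OF that] that by blast
  qed
qed

lemma lie_kolchin_eigenform:
  fixes S :: "'a::alg_closed_field mat set"
  assumes m: "m \<ge> 1" and S: "subgroup S (SL m)" "connectedin (zariski m) S" "(derived (SL m) ^^ d) S = {1\<^sub>m m}"
  obtains w where "w \<in> carrier_vec m" "w \<noteq> 0\<^sub>v m" "\<And>s. s \<in> S \<Longrightarrow> \<exists>c. transpose_mat s *\<^sub>v w = c \<cdot>\<^sub>v w"
proof -
  interpret \<theta>: group_hom "SL m" "SL m :: 'a mat monoid" "\<lambda>A. transpose_mat (adj_mat A)"
    by (rule group_hom_inverse_transpose)
  let ?\<theta> = "\<lambda>A :: 'a mat. transpose_mat (adj_mat A)"
  have "subgroup (?\<theta> ` S) (SL m)"
    by (rule \<theta>.subgroup_img_is_subgroup[OF S(1)])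
  moreover have "connectedin (zariski m) (?\<theta> ` S)"
    by (intro connectedin_regular_image[OF _ S(2)] Mat.regular_transpose Mat.regular_adj_mat regular_id)
  moreover have "(derived (SL m) ^^ d) (?\<theta> ` S) = {1\<^sub>m m}"
    using \<theta>.exp_of_derived_img[OF subgroup.subset[OF S(1)], of d] \<theta>.hom_one by (simp add: S(3))
  ultimately obtain w where w: "w \<in> carrier_vec m" "w \<noteq> 0\<^sub>v m" "\<And>s. s \<in> ?\<theta> ` S \<Longrightarrow> \<exists>c. s *\<^sub>v w = c \<cdot>\<^sub>v w"
    using lie_kolchin_eigenvector[OF m] by blast
  \<comment> \<open>The transpose of \<open>s\<close> is the image of the inverse of
    \<open>s\<close>, so eigenvectors of the image group are eigenvectors of all transposes.\<close>
  have "transpose_mat s \<in> ?\<theta> ` S" if s: "s \<in> S" for s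
  proof -
    have "s \<in> carrier (SL m)"
      using subgroup.mem_carrier[OF S(1) s] .
    then have "inv\<^bsub>SL m\<^esub> s \<in> S" "s = adj_mat (inv\<^bsub>SL m\<^esub> s)"
      using subgroup.m_inv_closed[OF S(1) s] SL_inv[of "inv\<^bsub>SL m\<^esub> s" m] by simp_all
    then show ?thesis
      by (metis image_eqI)
  qed
  with w that show ?thesis
    by blast
qed

section \<open>Triangular matrices: solvability, irreducibility, maximality\<close>

text \<open>Index 0 means upper triangular, 1 strictly upper triangular, and \<open>m\<close> zero.
  The index adds up under multiplication, which is the source of solvability.\<close>

definition band :: "nat \<Rightarrow> nat \<Rightarrow> 'a::zero mat \<Rightarrow> bool" where
  "band m l A \<longleftrightarrow> A \<in> carrier_mat m m \<and> (\<forall>i<m. \<forall>j<m. j < i + l \<longrightarrow> A $$ (i, j) = 0)"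

lemma band_mult:
  fixes A B :: "'a::semiring_0 mat"
  assumes "band m p A" "band m q B"
  shows "band m (p + q) (A * B)"
  unfolding band_def
proof (intro conjI allI impI)
  show "A * B \<in> carrier_mat m m"
    using assms by (auto simp: band_def)
  fix i j assume ij: "i < m" "j < m" "j < i + (p + q)"
  have "A $$ (i, k) * B $$ (k, j) = 0" if "k < m" for k
    using assms ij that by (cases "k < i + p") (auto simp: band_def)
  then have "(\<Sum>k\<in>{0..<m}. A $$ (i, k) * B $$ (k, j)) = 0"
    by (intro sum.neutral) auto
  moreover have "A \<in> carrier_mat m m" "B \<in> carrier_mat m m"
    using assms by (auto simp: band_def)
  ultimately show "(A * B) $$ (i, j) = 0"
    using ij by (simp add: scalar_prod_def)
qed

lemma band_mono: "band m q A \<Longrightarrow> p \<le> q \<Longrightarrow> band m p A"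
  by (auto simp: band_def)

lemma band_arith:
  fixes A B :: "'a::group_add mat"
  shows band_add: "band m p A \<Longrightarrow> band m p B \<Longrightarrow> band m p (A + B)"
    and band_diff: "band m p A \<Longrightarrow> band m p B \<Longrightarrow> band m p (A - B)"
    and band_uminus: "band m p A \<Longrightarrow> band m p (- A)"
  by (auto simp: band_def)

lemma band_upper_triangular: "A \<in> carrier_mat m m \<Longrightarrow> band m 0 A \<longleftrightarrow> upper_triangular A"
  by (auto simp: band_def upper_triangular_def)

text \<open>Entries of \<open>X * A = 1\<close> are compared column by column: once the earlier
  columns of \<open>X\<close> vanish below the diagonal, an entry below the diagonal in column
  \<open>j\<close>, times the nonzero \<open>A $$ (j, j)\<close>, is 0.\<close>

lemma band_inverse:
  fixes A X :: "'a::field mat"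
  assumes A: "band m 0 A" and X: "X \<in> carrier_mat m m" and XA: "X * A = 1\<^sub>m m"
  shows "band m 0 X"
proof -
  have Ac: "A \<in> carrier_mat m m"
    using A by (simp add: band_def)
  have diag: "A $$ (j, j) \<noteq> 0" if "j < m" for j
  proof
    assume 0: "A $$ (j, j) = 0"
    have "det A = (\<Prod>i = 0..<m. A $$ (i, i))"
      using det_upper_triangular[of A m] A Ac band_upper_triangular[OF Ac] prod_list_diag_prod[of A] by simp
    then have "det A = 0"
      using 0 that by auto
    moreover have "det X * det A = 1"
      using XA det_mult[OF X Ac] by simp
    ultimately show False
      by simp
  qed
  have "\<forall>i<m. j < i \<longrightarrow> X $$ (i, j) = 0" if "j < m" for j
    using that
  proof (induction j rule: less_induct)
    case (less j)
    show ?case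
    proof (intro allI impI)
      fix i assume i: "i < m" "j < i"
      have "0 = (X * A) $$ (i, j)"
        using XA i less.prems by simp
      also have "\<dots> = (\<Sum>k\<in>{0..<m}. X $$ (i, k) * A $$ (k, j))"
        using X Ac i less.prems by (auto simp: scalar_prod_def intro!: sum.cong)
      also have "\<dots> = (\<Sum>k\<in>{j}. X $$ (i, k) * A $$ (k, j))"
      proof (rule sum.mono_neutral_right)
        show "\<forall>k\<in>{0..<m} - {j}. X $$ (i, k) * A $$ (k, j) = 0"
        proof
          fix k assume k: "k \<in> {0..<m} - {j}"
          then consider "k < j" | "j < k" "k < m" by fastforce
          then show "X $$ (i, k) * A $$ (k, j) = 0"
            using less.IH less.prems i A by cases (auto simp: band_def)
        qed
      qed (use less.prems in auto)
      finally show "X $$ (i, j) = 0"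
        using diag[OF less.prems] by simp
    qed
  qed
  then show ?thesis
    using X by (auto simp: band_def)
qed

text \<open>A filtration that bounds the derived series: \<open>l = 0\<close> gives the whole
  triangular group, \<open>l > 0\<close> the unipotent triangular matrices that agree with the
  identity below the \<open>l\<close>-th superdiagonal.\<close>

definition upper_SL :: "nat \<Rightarrow> nat \<Rightarrow> 'a::comm_ring_1 mat set" where
  "upper_SL m l = {A \<in> carrier (SL m). band m 0 A \<and> (l > 0 \<longrightarrow> band m l (A - 1\<^sub>m m))}"

lemma subgroup_upper_SL: "subgroup (upper_SL m l) (SL m :: 'a::field mat monoid)"
proof -
  interpret group "SL m :: 'a mat monoid" by (rule group_SL)
  show ?thesis
  proof (rule subgroupI)
    show "upper_SL m l \<subseteq> carrier (SL m :: 'a mat monoid)"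
      by (auto simp: upper_SL_def)
    have "1\<^sub>m m \<in> (upper_SL m l :: 'a mat set)"
      by (auto simp: upper_SL_def SL_carrier_iff band_def)
    then show "upper_SL m l \<noteq> ({} :: 'a mat set)"
      by blast
    fix A :: "'a mat" assume A: "A \<in> upper_SL m l"
    then have SA: "A \<in> carrier (SL m)"
      by (auto simp: upper_SL_def)
    note a = SL_adj_mat[OF SA]
    have band: "band m 0 (adj_mat A)"
      using A band_inverse[OF _ a(2,4)] by (simp add: upper_SL_def)
    have eqA: "adj_mat A - 1\<^sub>m m = - ((A - 1\<^sub>m m) * adj_mat A)"
      using a(1,2,3) by (subst minus_mult_distrib_mat[of _ m m _ _ m]) (simp_all, rule eq_matI, simp_all)
    have bandA: "band m l (adj_mat A - 1\<^sub>m m)" if "l > 0"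
      unfolding eqA using A band_mult[OF _ band, of l "A - 1\<^sub>m m"] that
      by (intro band_uminus) (simp add: upper_SL_def)
    then show "inv\<^bsub>SL m\<^esub> A \<in> upper_SL m l"
      using band bandA inv_closed[OF SA] SL_inv[OF SA] by (simp add: upper_SL_def)
    fix B :: "'a mat" assume B: "B \<in> upper_SL m l"
    then have SB: "B \<in> carrier (SL m)"
      by (auto simp: upper_SL_def)
    have eqB: "A * B - 1\<^sub>m m = (A - 1\<^sub>m m) * B + (B - 1\<^sub>m m)"
      using a(1) SL_adj_mat(1)[OF SB]
      by (subst minus_mult_distrib_mat[of _ m m _ _ m]) (simp_all, rule eq_matI, simp_all)
    have "band m l (A * B - 1\<^sub>m m)" if "l > 0"
      unfolding eqB using A B band_mult[of m l "A - 1\<^sub>m m" 0 B] that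
      by (intro band_add) (simp_all add: upper_SL_def)
    moreover have "band m 0 (A * B)"
      using A B band_mult[of m 0 A 0 B] by (simp add: upper_SL_def)
    ultimately show "A \<otimes>\<^bsub>SL m\<^esub> B \<in> upper_SL m l"
      using m_closed[OF SA SB] by (simp add: upper_SL_def)
  qed
qed

text \<open>For \<open>l = 0\<close> the diagonal entries commute. For \<open>l > 0\<close> the
  additive commutator is unchanged when 1 is subtracted from both matrices, and the products then
  lie in band \<open>l + l\<close>, which is at least \<open>Suc l\<close>.\<close>

lemma band_commutator:
  assumes A: "A \<in> upper_SL m l" and B: "B \<in> (upper_SL m l :: 'a::field mat set)"
  shows "band m (Suc l) (A * B - B * A)"
proof (cases "l = 0")
  case True
  have c: "A \<in> carrier_mat m m" "B \<in> carrier_mat m m"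
    using A B by (auto simp: upper_SL_def SL_carrier_iff)
  have diag: "(X * Y) $$ (i, i) = X $$ (i, i) * Y $$ (i, i)" if "i < m" "band m 0 X" "band m 0 Y" for X Y :: "'a mat" and i
  proof -
    have "(X * Y) $$ (i, i) = (\<Sum>k\<in>{0..<m}. X $$ (i, k) * Y $$ (k, i))"
      using that by (auto simp: scalar_prod_def band_def intro!: sum.cong)
    also have "\<dots> = (\<Sum>k\<in>{i}. X $$ (i, k) * Y $$ (k, i))"
    proof (rule sum.mono_neutral_right)
      show "\<forall>k\<in>{0..<m} - {i}. X $$ (i, k) * Y $$ (k, i) = 0"
      proof
        fix k assume k: "k \<in> {0..<m} - {i}"
        then consider "k < i" | "i < k" "k < m" by fastforce
        then show "X $$ (i, k) * Y $$ (k, i) = 0"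
          using that by cases (auto simp: band_def)
      qed
    qed (use that in auto)
    finally show ?thesis by simp
  qed
  have AB: "band m 0 A" "band m 0 B"
    using A B by (auto simp: upper_SL_def)
  have "band m 0 (A * B - B * A)"
    using AB band_mult[of m 0 _ 0] by (auto intro!: band_diff)
  moreover have "(A * B - B * A) $$ (i, i) = 0" if "i < m" for i
    using c that diag[OF that AB] diag[OF that AB(2,1)] by (simp add: mult.commute)
  ultimately show ?thesis
    using True by (auto simp: band_def less_Suc_eq)
next
  case False
  let ?X = "A - 1\<^sub>m m" and ?Y = "B - 1\<^sub>m m"
  have c: "A \<in> carrier_mat m m" "B \<in> carrier_mat m m"
    using A B by (auto simp: upper_SL_def SL_carrier_iff)
  have XY: "band m l ?X" "band m l ?Y"
    using A B False by (auto simp: upper_SL_def)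
  have "band m (l + l) (?X * ?Y - ?Y * ?X)"
    by (rule band_diff[OF band_mult[OF XY] band_mult[OF XY(2,1)]])
  moreover have "?X * ?Y - ?Y * ?X = A * B - B * A"
  proof -
    have "(X - 1\<^sub>m m) * (Y - 1\<^sub>m m) = X * Y - X - (Y - 1\<^sub>m m)"
      if "X \<in> carrier_mat m m" "Y \<in> carrier_mat m m" for X Y :: "'a mat"
      using that by (simp add: minus_mult_distrib_mat[of _ m m _ _ m] mult_minus_distrib_mat[of _ m m _ m]
          minus_carrier_mat[of _ m m]) (rule eq_matI, simp_all add: algebra_simps)
    note this[OF c] this[OF c(2,1)]
    then show ?thesis
      using c by (intro eq_matI) auto
  qed
  ultimately show ?thesis
    using False band_mono[of m "l + l" _ "Suc l"] by simp
qed

lemma derived_upper_SL: "derived (SL m) (upper_SL m l) \<subseteq> (upper_SL m (Suc l) :: 'a::field mat set)"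
proof -
  interpret group "SL m :: 'a mat monoid" by (rule group_SL)
  have "A \<otimes>\<^bsub>SL m\<^esub> B \<otimes>\<^bsub>SL m\<^esub> inv\<^bsub>SL m\<^esub> A \<otimes>\<^bsub>SL m\<^esub> inv\<^bsub>SL m\<^esub> B \<in> upper_SL m (Suc l)"
    if A: "A \<in> upper_SL m l" and B: "B \<in> (upper_SL m l :: 'a mat set)" for A B
  proof -
    let ?C = "A \<otimes>\<^bsub>SL m\<^esub> B \<otimes>\<^bsub>SL m\<^esub> inv\<^bsub>SL m\<^esub> A \<otimes>\<^bsub>SL m\<^esub> inv\<^bsub>SL m\<^esub> B"
    note sub = subgroup_upper_SL[of m l]
    have C: "?C \<in> upper_SL m l"
      using A B subgroup.m_closed[OF sub] subgroup.m_inv_closed[OF sub] by blast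
    have S: "A \<in> carrier (SL m)" "B \<in> carrier (SL m)"
      using A B by (auto simp: upper_SL_def)
    note a = SL_adj_mat[OF S(1)] and b = SL_adj_mat[OF S(2)]
    have bands: "band m 0 (adj_mat A)" "band m 0 (adj_mat B)"
      using A B band_inverse[OF _ a(2,4)] band_inverse[OF _ b(2,4)] by (auto simp: upper_SL_def)
    have "B * A * (adj_mat A * adj_mat B) = B * ((A * adj_mat A) * adj_mat B)"
      using a(1,2) b(1,2) by (simp add: assoc_mult_mat[of _ m m _ m _ m])
    also have "\<dots> = 1\<^sub>m m"
      unfolding a(3) using b by simp
    finally have "B * A * (adj_mat A * adj_mat B) = 1\<^sub>m m" .
    \<comment> \<open>The group commutator minus 1 is the additive commutator times a triangular
      matrix, and such a factor preserves the band.\<close>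
    then have "?C - 1\<^sub>m m = (A * B - B * A) * (adj_mat A * adj_mat B)"
      using a(1,2) b(1,2) S
      by (simp add: minus_mult_distrib_mat[of _ m m _ _ m] SL_inv assoc_mult_mat[of _ m m _ m _ m]
          minus_carrier_mat[of _ m m])
    then have "band m (Suc l) (?C - 1\<^sub>m m)"
      using band_mult[OF band_commutator[OF A B] band_mult[OF bands]] by simp
    then show ?thesis
      using C by (auto simp: upper_SL_def)
  qed
  then show ?thesis
    unfolding derived_def by (intro generate_subgroup_incl subgroup_upper_SL) blast
qed

lemma solvable_upper_SL: "(derived (SL m) ^^ m) (upper_SL m 0) = {1\<^sub>m m :: 'a::field mat}"
proof -
  interpret group "SL m :: 'a mat monoid" by (rule group_SL)
  have incl: "(derived (SL m) ^^ l) (upper_SL m 0) \<subseteq> (upper_SL m l :: 'a mat set)" for l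
  proof (induction l)
    case (Suc l)
    then have "derived (SL m) ((derived (SL m) ^^ l) (upper_SL m 0)) \<subseteq> derived (SL m) (upper_SL m l :: 'a mat set)"
      by (rule mono_derived)
    then show ?case
      using derived_upper_SL by simp blast
  qed simp
  have "A = 1\<^sub>m m" if "A \<in> upper_SL m m" for A :: "'a mat"
  proof (rule eq_matI)
    have c: "A \<in> carrier_mat m m"
      using that by (auto simp: upper_SL_def SL_carrier_iff)
    then show "dim_row A = dim_row (1\<^sub>m m :: 'a mat)" "dim_col A = dim_col (1\<^sub>m m :: 'a mat)"
      by auto
    fix i j assume ij: "i < dim_row (1\<^sub>m m :: 'a mat)" "j < dim_col (1\<^sub>m m :: 'a mat)"
    then have "(A - 1\<^sub>m m) $$ (i, j) = 0"
      using that by (auto simp: upper_SL_def band_def)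
    then show "A $$ (i, j) = 1\<^sub>m m $$ (i, j)"
      using ij c by simp
  qed
  then have "(derived (SL m) ^^ m) (upper_SL m 0) \<subseteq> {1\<^sub>m m :: 'a mat}"
    using incl[of m] by auto
  moreover have "1\<^sub>m m \<in> (derived (SL m) ^^ m) (upper_SL m 0 :: 'a mat set)"
    using subgroup.one_closed[OF exp_of_derived_is_subgroup[OF subgroup_upper_SL[of m 0]], of m] by simp
  ultimately show ?thesis
    by blast
qed

text \<open>Two triangular matrices are joined by the line through them. Its determinant
  \<open>q\<close> need not be 1; dividing the last column by \<open>q\<close> repairs this by a
  rational function, while rescaling the whole matrix would call for an \<open>m\<close>-th
  root.\<close>

lemma irreducible_upper_SL:
  assumes "m \<ge> 1"
  shows "irreducible_set m (upper_SL m 0 :: 'a::alg_closed_field mat set)"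
proof (rule irreducible_setI)
  fix A B :: "'a mat" assume A: "A \<in> upper_SL m 0" and B: "B \<in> upper_SL m 0"
  have c: "A \<in> carrier_mat m m" "B \<in> carrier_mat m m" and dets: "det A = 1" "det B = 1"
    and bands: "band m 0 A" "band m 0 B"
    using A B by (auto simp: upper_SL_def SL_carrier_iff)
  define L where "L t = (1 + t * - 1) \<cdot>\<^sub>m A + (0 + t * 1) \<cdot>\<^sub>m B" for t
  define q where "q t = det (L t)" for t
  \<comment> \<open>All columns but the last are multiplied by \<open>q t\<close>, and the later
    factor \<open>inverse (q t)\<close> undoes this, so that in total the last column is divided by
    \<open>q t\<close> with a single scalar denominator. At 0 and 1 nothing changes, since
    \<open>q\<close> is 1 there.\<close>
  define E where "E t = mat m m (\<lambda>(i, j). if i = j then if i = m - 1 then 1 else q t else 0)" for t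
  define P where "P t = L t * E t" for t
  have L: "Poly.regular m L"
    unfolding L_def by (intro Poly.regular_add Poly.regular_smult Poly.regular_const poly_linear c)
  then have q: "q \<in> range poly"
    unfolding q_def by (rule Poly.regular_det)
  have E: "Poly.regular m E"
  proof (rule Poly.regularI)
    fix i j assume "i < m" "j < m"
    then have "(\<lambda>x. E x $$ (i, j)) = (if i = j then if i = m - 1 then (\<lambda>_. 1) else q else (\<lambda>_. 0))"
      by (auto simp: E_def)
    then show "(\<lambda>x. E x $$ (i, j)) \<in> range poly"
      using q Poly.const[of "1 :: 'a"] Poly.const[of "0 :: 'a"]
      by (cases "i = j"; cases "i = m - 1") (simp_all only: simp_thms if_True if_False)
  qed (auto simp: E_def)
  have P: "Poly.regular m P"
    unfolding P_def by (intro Poly.regular_mult L E)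
  have L01: "L 0 = A" "L 1 = B"
    using c by (auto simp: L_def intro!: eq_matI)
  then have q01: "q 0 = 1" "q 1 = 1"
    using dets by (simp_all add: q_def)
  let ?I = "{inverse (q t) \<cdot>\<^sub>m P t | t. q t \<noteq> 0}"
  have "E t = 1\<^sub>m m" if "q t = 1" for t
    using that by (auto simp: E_def intro!: eq_matI)
  then have "A = inverse (q 0) \<cdot>\<^sub>m P 0" "B = inverse (q 1) \<cdot>\<^sub>m P 1"
    using q01 L01 c by (auto simp: P_def intro!: eq_matI)
  then have "A \<in> ?I" "B \<in> ?I"
    using q01 by (metis (mono_tags, lifting) mem_Collect_eq one_neq_zero)+
  moreover have "irreducible_set m ?I"
    using rational_curve_irreducible[OF P q, of 0] q01 by simp
  moreover have "?I \<subseteq> upper_SL m 0"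
  proof clarify
    fix t assume qt: "q t \<noteq> 0"
    have Lc: "L t \<in> carrier_mat m m" and Ec: "E t \<in> carrier_mat m m"
      using c by (auto simp: L_def E_def)
    have "band m 0 (L t)" "band m 0 (E t)"
      using bands c by (auto simp: L_def E_def band_def)
    then have "band m 0 (P t)"
      unfolding P_def using band_mult[of m 0 "L t" 0 "E t"] by simp
    then have "band m 0 (inverse (q t) \<cdot>\<^sub>m P t)"
      by (auto simp: band_def)
    moreover have "det (E t) = q t ^ (m - 1)"
    proof -
      obtain n where n: "m = Suc n"
        using assms by (cases m) auto
      have "det (E t) = (\<Prod>i = 0..<m. E t $$ (i, i))"
        using det_upper_triangular[of "E t" m] prod_list_diag_prod[of "E t"] Ec
          band_upper_triangular[OF Ec] \<open>band m 0 (E t)\<close> by simp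
      also have "\<dots> = (\<Prod>i = 0..<m. if i = n then 1 else q t)"
        by (rule prod.cong) (auto simp: E_def n)
      also have "\<dots> = q t ^ n"
        by (simp add: n)
      finally show ?thesis
        by (simp add: n)
    qed
    then have "det (inverse (q t) \<cdot>\<^sub>m P t) = inverse (q t) ^ m * (q t * q t ^ (m - 1))"
      using Lc Ec by (simp add: P_def det_mult q_def)
    then have "det (inverse (q t) \<cdot>\<^sub>m P t) = 1"
      using qt assms by (simp add: power_inverse flip: power_Suc)
    ultimately show "inverse (q t) \<cdot>\<^sub>m P t \<in> upper_SL m 0"
      by (auto simp: upper_SL_def SL_carrier_iff band_def)
  qed
  ultimately show "\<exists>I\<subseteq>upper_SL m 0. irreducible_set m I \<and> A \<in> I \<and> B \<in> I"
    by blast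
qed

lemma addrow_mat_index:
  "i < n \<Longrightarrow> j < n \<Longrightarrow> addrow_mat n a k l $$ (i, j) = (if i = j then 1 else 0) + (if i = k \<and> j = l then a else (0 :: 'a::comm_ring_1))"
  by (auto simp: addrow_mat_def)

lemma addrow_mat_mult_vec:
  fixes w :: "'a::comm_ring_1 vec"
  assumes "w \<in> carrier_vec n" "i < n" "l < n"
  shows "(addrow_mat n a k l *\<^sub>v w) $ i = w $ i + (if i = k then a * w $ l else 0)"
proof -
  have "(addrow_mat n a k l *\<^sub>v w) $ i = (\<Sum>j\<in>{0..<n}. addrow_mat n a k l $$ (i, j) * w $ j)"
    using assms by (auto simp: scalar_prod_def addrow_mat_def intro!: sum.cong)
  also have "\<dots> = (\<Sum>j\<in>{0..<n}. (if i = j then w $ j else 0) + (if j = l then (if i = k then a * w $ j else 0) else 0))"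
    using assms by (intro sum.cong) (auto simp: addrow_mat_index distrib_right)
  also have "\<dots> = w $ i + (if i = k then a * w $ l else 0)"
    using assms by (simp add: sum.distrib)
  finally show ?thesis .
qed

text \<open>Lie and Kolchin give an eigenvector of \<open>H\<close> modulo each flag space. The
  triangular matrices inside \<open>H\<close> force it to be a multiple of the next unit vector
  modulo that flag space, so the standard flag is stable under \<open>H\<close>.\<close>

lemma connected_solvable_supergroup_upper_SL:
  fixes H :: "'a::alg_closed_field mat set"
  assumes m: "m \<ge> 1" and H: "subgroup H (SL m)" "connectedin (zariski m) H" "(derived (SL m) ^^ d) H = {1\<^sub>m m}"
    and le: "upper_SL m 0 \<subseteq> H"
  shows "H = upper_SL m 0"
proof -
  have Hc: "h \<in> carrier_mat m m" "h \<in> carrier (SL m)" if "h \<in> H" for h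
    using subgroup.mem_carrier[OF H(1) that] by (auto simp: SL_carrier_iff)
  have flags: "k \<le> m \<Longrightarrow> \<forall>h\<in>H. invariant (flag_space k m) h" for k
  proof (induction k)
    case 0
    show ?case
      unfolding invariant_def
    proof (intro ballI)
      fix h and x :: "'a vec" assume "h \<in> H" and x: "x \<in> flag_space 0 m"
      then have "h *\<^sub>v 0\<^sub>v m = 0\<^sub>v m"
        using Hc(1)[of h] by (intro eq_vecI) auto
      then show "h *\<^sub>v x \<in> flag_space 0 m"
        using x unfolding flag_space_0 by auto
    qed
  next
    case (Suc k)
    then have k: "k < m" and IH: "invariant (flag_space k m) h" if "h \<in> H" for h
      using that by auto
    have km: "k < m"
      using Suc.prems by simp
    let ?U = "flag_space k m :: 'a vec set"
    have "unit_vec m k \<in> carrier_vec m - ?U"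
      using km by (auto simp: flag_space_def tail_eq_def)
    then have "?U \<subset> carrier_vec m"
      using vec_subspaceD(1)[OF vec_subspace_flag_space] by blast
    moreover have "invariant (carrier_vec m) h" if "h \<in> H" for h
      using Hc(1)[OF that] by (simp add: invariant_def)
    ultimately have "\<exists>w\<in>carrier_vec m - ?U. \<forall>h\<in>H. \<exists>c. tail_eq k m (h *\<^sub>v w) (c \<cdot>\<^sub>v w)"
      using IH by (intro lie_kolchin_tail[OF H] vec_subspace_carrier_vec)
    then obtain w where w: "w \<in> carrier_vec m" "w \<notin> ?U" and
      eig: "\<And>h. h \<in> H \<Longrightarrow> \<exists>c. tail_eq k m (h *\<^sub>v w) (c \<cdot>\<^sub>v w)"
      by blast
    have w0: "w $ b = 0" if b: "k < b" "b < m" for b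
    proof (rule ccontr)
      assume nz: "w $ b \<noteq> 0"
      \<comment> \<open>This transvection adds coordinate \<open>b\<close> to coordinate
        \<open>k\<close>. If \<open>w $ b\<close> were nonzero, coordinate \<open>b\<close> would
        give the eigenvalue 1, and coordinate \<open>k\<close> would then give
        \<open>w $ b = 0\<close>.\<close>
      have "addrow_mat m 1 k b \<in> upper_SL m 0"
        using b by (auto simp: upper_SL_def SL_carrier_iff det_addrow_mat band_def addrow_mat_index)
      then obtain c where c: "tail_eq k m (addrow_mat m 1 k b *\<^sub>v w) (c \<cdot>\<^sub>v w)"
        using eig le by blast
      have "(addrow_mat m 1 k b *\<^sub>v w) $ i = c * w $ i" if "k \<le> i" "i < m" for i
        using c that w by (simp add: tail_eq_def del: index_mult_mat_vec)
      from this[of b] this[of k] have "w $ b = c * w $ b" "w $ k + w $ b = c * w $ k"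
        using b w addrow_mat_mult_vec[of w m _ b 1 k] by simp_all
      then show False
        using nz by simp
    qed
    then have wk: "w $ k \<noteq> 0"
      using w by (auto simp: flag_space_def tail_eq_def le_less)
    show ?case
      unfolding invariant_def
    proof (intro ballI)
      fix h and x :: "'a vec" assume h: "h \<in> H" and x: "x \<in> flag_space (Suc k) m"
      obtain c where c: "tail_eq k m (h *\<^sub>v w) (c \<cdot>\<^sub>v w)"
        using eig[OF h] by blast
      have xc: "x \<in> carrier_vec m"
        using x by (simp add: flag_space_def)
      \<comment> \<open>\<open>w\<close> spans \<open>flag_space (Suc k) m\<close> modulo
        \<open>flag_space k m\<close>, so its eigenvector property carries over to
        \<open>x\<close>.\<close>
      have "tail_eq k m x ((x $ k / w $ k) \<cdot>\<^sub>v w)"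
        unfolding tail_eq_def
      proof (intro allI impI)
        fix i assume i: "k \<le> i \<and> i < m"
        then show "x $ i = ((x $ k / w $ k) \<cdot>\<^sub>v w) $ i"
          using x w w0[of i] wk by (cases "i = k") (auto simp: flag_space_def tail_eq_def)
      qed
      then have "tail_eq k m (h *\<^sub>v x) ((x $ k / w $ k) \<cdot>\<^sub>v (h *\<^sub>v w))"
        using Hc[OF h] IH[OF h] xc w by (intro tail_eq_mult_smult) auto
      then have "(h *\<^sub>v x) $ i = 0" if "k < i" "i < m" for i
        using c w w0[OF that] that Hc(1)[OF h] by (auto simp: tail_eq_def simp del: index_mult_mat_vec)
      then show "h *\<^sub>v x \<in> flag_space (Suc k) m"
        using Hc(1)[OF h] xc by (simp add: flag_space_def tail_eq_def del: index_mult_mat_vec)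
    qed
  qed
  have "h \<in> upper_SL m 0" if h: "h \<in> H" for h
  proof -
    have "h $$ (i, j) = 0" if ij: "j < i" "i < m" for i j
    proof -
      have "unit_vec m j \<in> flag_space (Suc j) m"
        using ij by (auto simp: flag_space_def tail_eq_def)
      then have "h *\<^sub>v unit_vec m j \<in> flag_space (Suc j) m"
        using flags[of "Suc j"] ij h by (auto simp: invariant_def)
      then have "(h *\<^sub>v unit_vec m j) $ i = 0"
        using ij by (auto simp: flag_space_def tail_eq_def simp del: index_mult_mat_vec)
      moreover have "(h *\<^sub>v unit_vec m j) $ i = h $$ (i, j)"
        using ij Hc(1)[OF h] by simp
      ultimately show ?thesis
        by simp
    qed
    then show ?thesis
      using Hc[OF h] by (auto simp: upper_SL_def band_def)
  qed
  with le show ?thesis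
    by blast
qed

text \<open>Closedness is a condition on entries, solvability comes from the band filtration,
  connectedness from irreducibility, and maximality from Lie and Kolchin.\<close>

theorem Borel_subgroup_upper_SL:
  assumes m: "m \<ge> 1"
  shows "Borel_subgroup m (upper_SL m 0) (SL m :: 'a::alg_closed_field mat monoid)"
proof -
  interpret group "SL m :: 'a mat monoid" by (rule group_SL)
  let ?T = "upper_SL m 0 :: 'a mat set"
  have T_eq: "?T = zero_locus m ((\<lambda>(i, j) A. A $$ (i, j)) ` {(i, j). j < i \<and> i < m}) \<inter> carrier (SL m)"
    by (auto simp: zero_locus_def upper_SL_def band_def SL_carrier_iff)
  have "(\<lambda>(i, j) A. A $$ (i, j)) ` {(i, j). j < i \<and> i < m} \<subseteq> poly_funs m"
    by (auto intro!: poly_funs.entry)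
  then have "closedin (zariski m) (zero_locus m ((\<lambda>(i, j) A. A $$ (i, j) :: 'a) ` {(i, j). j < i \<and> i < m}))"
    unfolding closedin_zariski by blast
  with T_eq have closed: "closedin (subtopology (zariski m) (carrier (SL m))) ?T"
    unfolding closedin_subtopology by (intro exI conjI)
  have conn: "connectedin (zariski m) ?T"
    using irreducible_upper_SL[OF m] by (intro irreducible_set_connectedin) (auto simp: upper_SL_def SL_carrier_iff)
  have solv: "solvable (SL m\<lparr>carrier := ?T\<rparr>)"
    using solvable_upper_SL solvable_subgroup_iff[OF subgroup_upper_SL] by auto
  have max: "H = ?T" if H: "subgroup H (SL m)" "connectedin (zariski m) H" "solvable (SL m\<lparr>carrier := H\<rparr>)"
    "?T \<subseteq> H" for H
  proof -
    obtain d where "(derived (SL m) ^^ d) H = {1\<^sub>m m}"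
      using H(3) solvable_subgroup_iff[OF H(1)] by auto
    then show ?thesis
      using connected_solvable_supergroup_upper_SL[OF m H(1,2) _ H(4)] by blast
  qed
  show ?thesis
    unfolding Borel_subgroup_def Let_def using subgroup_upper_SL closed conn solv max by blast
qed

section \<open>Spherical classes satisfy a quadratic equation\<close>

text \<open>The inverse is carried along as a second matrix \<open>B\<close>; for square matrices
  the one equation \<open>A * B = 1\<^sub>m m\<close> makes it a two-sided inverse.\<close>

definition gl_orbit :: "nat \<Rightarrow> 'a::field mat \<Rightarrow> 'a mat set" where
  "gl_orbit m x = {A * x * B | A B. A \<in> carrier_mat m m \<and> B \<in> carrier_mat m m \<and> A * B = 1\<^sub>m m}"

definition upper_orbit :: "nat \<Rightarrow> 'a::field mat \<Rightarrow> 'a mat set" where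
  "upper_orbit m x = {A * x * B | A B. band m 0 A \<and> B \<in> carrier_mat m m \<and> A * B = 1\<^sub>m m}"

lemma gl_orbitI:
  "A \<in> carrier_mat m m \<Longrightarrow> B \<in> carrier_mat m m \<Longrightarrow> A * B = 1\<^sub>m m \<Longrightarrow> A * x * B \<in> gl_orbit m x"
  unfolding gl_orbit_def by blast

lemma upper_orbitI:
  "band m 0 A \<Longrightarrow> B \<in> carrier_mat m m \<Longrightarrow> A * B = 1\<^sub>m m \<Longrightarrow> A * x * B \<in> upper_orbit m x"
  unfolding upper_orbit_def by blast

lemma gl_orbit_self: "x \<in> carrier_mat m m \<Longrightarrow> x \<in> gl_orbit m x"
  using gl_orbitI[of "1\<^sub>m m" m "1\<^sub>m m" x] by simp

lemma gl_orbit_trans: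
  assumes x: "x \<in> carrier_mat m m" and y: "y \<in> gl_orbit m x" and z: "z \<in> gl_orbit m y"
  shows "z \<in> gl_orbit m x"
proof -
  obtain A B where AB: "A \<in> carrier_mat m m" "B \<in> carrier_mat m m" "A * B = 1\<^sub>m m" "y = A * x * B"
    using y unfolding gl_orbit_def by blast
  obtain A' B' where AB': "A' \<in> carrier_mat m m" "B' \<in> carrier_mat m m" "A' * B' = 1\<^sub>m m" "z = A' * y * B'"
    using z unfolding gl_orbit_def by blast
  have "z = (A' * A) * x * (B * B')"
    using AB(1,2,4) AB'(1,2,4) x by (simp add: assoc_mult_mat[of _ m m _ m _ m])
  moreover have "(A' * A) * (B * B') = A' * (A * B) * B'"
    using AB(1,2) AB'(1,2) by (simp add: assoc_mult_mat[of _ m m _ m _ m])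
  then have "(A' * A) * (B * B') = 1\<^sub>m m"
    using AB AB' by simp
  ultimately show ?thesis
    using gl_orbitI[of "A' * A" m "B * B'" x] AB(1,2) AB'(1,2) mult_carrier_mat by blast
qed

lemma smult_smult_mat: "a \<cdot>\<^sub>m (b \<cdot>\<^sub>m A) = (a * b) \<cdot>\<^sub>m (A :: 'a::semigroup_mult mat)"
  by (rule eq_matI) (auto simp: mult.assoc)

lemma one_smult_mat: "1 \<cdot>\<^sub>m A = (A :: 'a::monoid_mult mat)"
  by (rule eq_matI) auto

lemma smult_mat_mult_vec:
  fixes M :: "'a::comm_semiring_0 mat"
  assumes "M \<in> carrier_mat n m" "v \<in> carrier_vec m"
  shows "(c \<cdot>\<^sub>m M) *\<^sub>v v = c \<cdot>\<^sub>v (M *\<^sub>v v)"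
  using assms by (intro eq_vecI) (auto simp: scalar_prod_def sum_distrib_left mult.assoc)

lemma bilinear_form_add:
  fixes M N :: "'a::comm_ring_1 mat"
  assumes "M \<in> carrier_mat m m" "N \<in> carrier_mat m m" "w \<in> carrier_vec m" "v \<in> carrier_vec m"
  shows "w \<bullet> ((M + N) *\<^sub>v v) = w \<bullet> (M *\<^sub>v v) + w \<bullet> (N *\<^sub>v v)"
  using assms by (simp add: add_mult_distrib_mat_vec[of M m m] scalar_prod_add_distrib[of w m])

text \<open>A scalar factor does not affect conjugation, and an \<open>m\<close>-th root of the
  inverse determinant brings an invertible matrix into \<open>SL m\<close>. Hence orbits of
  \<open>SL m\<close> agree with orbits of all invertible matrices, and likewise for triangular
  matrices.\<close>

lemma scale_to_SL:
  fixes A B :: "'a::alg_closed_field mat"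
  assumes m: "m \<ge> 1" and A: "A \<in> carrier_mat m m" and B: "B \<in> carrier_mat m m" and AB: "A * B = 1\<^sub>m m"
  obtains c where "c \<noteq> 0" "c \<cdot>\<^sub>m A \<in> carrier (SL m)" "adj_mat (c \<cdot>\<^sub>m A) = inverse c \<cdot>\<^sub>m B"
proof -
  have "det A * det B = 1"
    using AB det_mult[OF A B] by simp
  then have dA: "det A \<noteq> 0"
    by auto
  obtain c where c: "c ^ m = inverse (det A)"
    using nth_root_exists[of m "inverse (det A)"] m by auto
  have c0: "c \<noteq> 0"
    using c dA m by (cases "c = 0") (auto simp: power_0_left)
  have S: "c \<cdot>\<^sub>m A \<in> carrier (SL m)"
    using A c dA by (simp add: SL_carrier_iff)
  have "(c \<cdot>\<^sub>m A) * (inverse c \<cdot>\<^sub>m B) = 1\<^sub>m m"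
    using A B AB c0 by (simp add: mult_smult_distrib[of _ m m _ m] mult_smult_assoc_mat[of _ m m _ m] smult_smult_mat one_smult_mat)
  moreover have "adj_mat (c \<cdot>\<^sub>m A) * ((c \<cdot>\<^sub>m A) * (inverse c \<cdot>\<^sub>m B)) = inverse c \<cdot>\<^sub>m B"
    using SL_adj_mat[OF S] B by (simp flip: assoc_mult_mat[of _ m m _ m _ m])
  ultimately have "adj_mat (c \<cdot>\<^sub>m A) = inverse c \<cdot>\<^sub>m B"
    using SL_adj_mat[OF S] by simp
  with c0 S show ?thesis
    using that by blast
qed

lemma conj_smult:
  fixes A B :: "'a::field mat"
  assumes "c \<noteq> 0" "A \<in> carrier_mat m m" "B \<in> carrier_mat m m" "x \<in> carrier_mat m m"
  shows "(c \<cdot>\<^sub>m A) * x * (inverse c \<cdot>\<^sub>m B) = A * x * B"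
  using assms by (simp add: mult_smult_distrib[of _ m m _ m] mult_smult_assoc_mat[of _ m m _ m] smult_smult_mat one_smult_mat)

lemma conjugacy_class_SL:
  fixes x :: "'a::alg_closed_field mat"
  assumes m: "m \<ge> 1" and x: "x \<in> carrier_mat m m"
  shows "conjugacy_class (SL m) x = gl_orbit m x"
proof (intro equalityI subsetI)
  fix y assume "y \<in> conjugacy_class (SL m) x"
  then obtain h where h: "h \<in> carrier (SL m)" "y = h \<otimes>\<^bsub>SL m\<^esub> x \<otimes>\<^bsub>SL m\<^esub> inv\<^bsub>SL m\<^esub> h"
    unfolding conjugates_def by blast
  then show "y \<in> gl_orbit m x"
    unfolding gl_orbit_def using SL_adj_mat[OF h(1)] SL_inv[OF h(1)] by auto
next
  fix y assume "y \<in> gl_orbit m x"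
  then obtain A B where AB: "A \<in> carrier_mat m m" "B \<in> carrier_mat m m" "A * B = 1\<^sub>m m" "y = A * x * B"
    unfolding gl_orbit_def by blast
  obtain c where c: "c \<noteq> 0" "c \<cdot>\<^sub>m A \<in> carrier (SL m)" "adj_mat (c \<cdot>\<^sub>m A) = inverse c \<cdot>\<^sub>m B"
    using scale_to_SL[OF m AB(1-3)] .
  have "y = (c \<cdot>\<^sub>m A) \<otimes>\<^bsub>SL m\<^esub> x \<otimes>\<^bsub>SL m\<^esub> inv\<^bsub>SL m\<^esub> (c \<cdot>\<^sub>m A)"
    using conj_smult[OF c(1) AB(1,2) x] SL_inv[OF c(2)] c(3) AB(4) by simp
  then show "y \<in> conjugacy_class (SL m) x"
    unfolding conjugates_def using c(2) by blast
qed

lemma conjugates_upper_SL: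
  fixes x :: "'a::alg_closed_field mat"
  assumes m: "m \<ge> 1" and x: "x \<in> carrier_mat m m"
  shows "conjugates (SL m) (upper_SL m 0) x = upper_orbit m x"
proof (intro equalityI subsetI)
  fix y assume "y \<in> conjugates (SL m) (upper_SL m 0) x"
  then obtain h where h: "h \<in> upper_SL m 0" "y = h \<otimes>\<^bsub>SL m\<^esub> x \<otimes>\<^bsub>SL m\<^esub> inv\<^bsub>SL m\<^esub> h"
    unfolding conjugates_def by blast
  then have hS: "h \<in> carrier (SL m)" "band m 0 h"
    by (auto simp: upper_SL_def)
  then show "y \<in> upper_orbit m x"
    unfolding upper_orbit_def using SL_adj_mat[OF hS(1)] SL_inv[OF hS(1)] h(2) by auto
next
  fix y assume "y \<in> upper_orbit m x"
  then obtain A B where AB: "band m 0 A" "B \<in> carrier_mat m m" "A * B = 1\<^sub>m m" "y = A * x * B"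
    unfolding upper_orbit_def by blast
  then have A: "A \<in> carrier_mat m m"
    by (simp add: band_def)
  obtain c where c: "c \<noteq> 0" "c \<cdot>\<^sub>m A \<in> carrier (SL m)" "adj_mat (c \<cdot>\<^sub>m A) = inverse c \<cdot>\<^sub>m B"
    using scale_to_SL[OF m A AB(2,3)] .
  have "y = (c \<cdot>\<^sub>m A) \<otimes>\<^bsub>SL m\<^esub> x \<otimes>\<^bsub>SL m\<^esub> inv\<^bsub>SL m\<^esub> (c \<cdot>\<^sub>m A)"
    using conj_smult[OF c(1) A AB(2) x] SL_inv[OF c(2)] c(3) AB(4) by simp
  moreover have "c \<cdot>\<^sub>m A \<in> upper_SL m 0"
    using c(2) AB(1) by (auto simp: upper_SL_def band_def)
  ultimately show "y \<in> conjugates (SL m) (upper_SL m 0) x"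
    unfolding conjugates_def by blast
qed

section \<open>Subspaces of matrices stable under conjugation\<close>

definition unit_mat :: "nat \<Rightarrow> nat \<Rightarrow> nat \<Rightarrow> 'a::zero_neq_one mat" where
  "unit_mat m i j = mat m m (\<lambda>(r, s). if r = i \<and> s = j then 1 else 0)"

lemma unit_mat_carrier [simp]: "unit_mat m i j \<in> carrier_mat m m"
  by (simp add: unit_mat_def)

lemma addrow_conj_index:
  fixes N :: "'a::comm_ring_1 mat"
  assumes N: "N \<in> carrier_mat m m" and ij: "i \<noteq> j" "i < m" "j < m" and rs: "r < m" "s < m"
  shows "(addrow_mat m c i j * N * addrow_mat m (- c) i j) $$ (r, s) =
    N $$ (r, s) + c * ((if r = i then N $$ (j, s) else 0) - (if s = j then N $$ (r, i) else 0))
      - c * c * (if r = i \<and> s = j then N $$ (j, i) else 0)"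
proof -
  have "addrow_mat m c i j * N = addrow c i j N"
    using addrow_mat[OF N ij(3)] by simp
  moreover have "addrow c i j N * addrow_mat m (- c) i j = addcol (- c) j i (addrow c i j N)"
    using N ij by (subst addcol_mat[of _ m m, symmetric]) auto
  ultimately show ?thesis
    using N ij rs by (auto simp: algebra_simps)
qed

text \<open>The lemmas in this context establish a dichotomy valid in every characteristic: either
  all members of \<open>K\<close> are scalar or \<open>K\<close> contains all off-diagonal matrix
  units.\<close>

locale conj_invariant_subspace =
  fixes m :: nat and K :: "'a::alg_closed_field mat set"
  assumes carrier: "N \<in> K \<Longrightarrow> N \<in> carrier_mat m m"
    and add: "N \<in> K \<Longrightarrow> N' \<in> K \<Longrightarrow> N + N' \<in> K"
    and smult: "N \<in> K \<Longrightarrow> c \<cdot>\<^sub>m N \<in> K"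
    and conj: "N \<in> K \<Longrightarrow> A \<in> carrier_mat m m \<Longrightarrow> B \<in> carrier_mat m m \<Longrightarrow> A * B = 1\<^sub>m m \<Longrightarrow> A * N * B \<in> K"
begin

text \<open>
  Conjugating by the elementary matrix \<open>1 + c E\<close>, where \<open>E = unit_mat m i j\<close>, changes \<open>N\<close> by
  \<open>c (E N - N E) - c\<^sup>2 E N E\<close>; two distinct nonzero values of \<open>c\<close> separate the two terms.
\<close>

lemma bracket_and_sandwich:
  assumes N: "N \<in> K" and ij: "i \<noteq> j" "i < m" "j < m"
  shows "mat m m (\<lambda>(r, s). (if r = i then N $$ (j, s) else 0) - (if s = j then N $$ (r, i) else 0)) \<in> K" (is "?X \<in> K")
    and "N $$ (j, i) \<cdot>\<^sub>m unit_mat m i j \<in> K" (is "?Y \<in> K")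
proof -
  note Nc = carrier[OF N]
  define D where "D c = addrow_mat m c i j * N * addrow_mat m (- c) i j + (- 1) \<cdot>\<^sub>m N" for c
  have D: "D c \<in> K" for c
    unfolding D_def using addrow_mat_inv[of i m j c] ij N by (intro add smult conj) auto
  have Dc: "D c \<in> carrier_mat m m" for c
    by (rule carrier[OF D])
  have D_index: "D c $$ (r, s) = c * ?X $$ (r, s) - c * c * ?Y $$ (r, s)" if "r < m" "s < m" for c r s
    using addrow_conj_index[OF Nc ij that, of c] that Nc ij
    by (auto simp: D_def unit_mat_def)
  \<comment> \<open>\<open>D c - c D 1\<close> equals \<open>(c - c * c)\<close> times
    \<open>?Y\<close>, so a \<open>c\<close> different from 0 and 1 isolates the quadratic
    term.\<close>
  have "infinite (UNIV - {0, 1 :: 'a})"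
    using infinite_UNIV_alg_closed by simp
  then obtain c :: 'a where c: "c \<noteq> 0" "c \<noteq> 1"
    by (metis DiffE ex_in_conv finite.emptyI insertCI)
  have "inverse (c - c * c) \<cdot>\<^sub>m (D c + (- c) \<cdot>\<^sub>m D 1) = ?Y"
  proof (rule eq_matI)
    fix r s assume "r < dim_row ?Y" "s < dim_col ?Y"
    then have rs: "r < m" "s < m" by (auto simp: unit_mat_def)
    have "c - c * c \<noteq> 0"
      using c by (simp add: right_diff_distrib[of c 1 c, simplified, symmetric])
    moreover have "(D c + (- c) \<cdot>\<^sub>m D 1) $$ (r, s) = (c - c * c) * ?Y $$ (r, s)"
    proof -
      have "(D c + (- c) \<cdot>\<^sub>m D 1) $$ (r, s) = D c $$ (r, s) - c * D 1 $$ (r, s)"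
        using rs Dc[of c] Dc[of 1] by simp
      also have "\<dots> = (c - c * c) * ?Y $$ (r, s)"
        unfolding D_index[OF rs] by (simp only: ring_distribs mult_1_left mult.assoc) simp
      finally show ?thesis .
    qed
    ultimately show "(inverse (c - c * c) \<cdot>\<^sub>m (D c + (- c) \<cdot>\<^sub>m D 1)) $$ (r, s) = ?Y $$ (r, s)"
      using rs Dc[of c] Dc[of 1] by simp
  qed (use Dc in \<open>auto simp: unit_mat_def\<close>)
  then show Y: "?Y \<in> K"
    using add[OF D smult[OF D]] smult by metis
  have "?X = D 1 + ?Y"
    using D_index[of _ _ 1] Dc[of 1] by (intro eq_matI) (auto simp: unit_mat_def)
  then show "?X \<in> K"
    using add[OF D Y] by simp
qed

text \<open>A matrix unit between two copies of its transpose gives the transpose. Together with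
  brackets, which move one index at a time, this reaches every off-diagonal position.\<close>

lemma unit_mat_transpose:
  assumes "unit_mat m i j \<in> K" "i \<noteq> j" "i < m" "j < m"
  shows "unit_mat m j i \<in> K"
proof -
  have "1 \<cdot>\<^sub>m unit_mat m j i \<in> K"
    using bracket_and_sandwich(2)[OF assms(1), of j i] assms by (simp add: unit_mat_def)
  then show ?thesis
    by (simp add: one_smult_mat)
qed

lemma unit_mat_row:
  assumes "unit_mat m i j \<in> K" "i \<noteq> j" "i < m" "j < m" "p \<noteq> j" "p < m"
  shows "unit_mat m p j \<in> K"
proof (cases "p = i")
  case False
  have "mat m m (\<lambda>(r, s). (if r = p then unit_mat m i j $$ (i, s) else 0)
      - (if s = i then unit_mat m i j $$ (r, p) else 0)) = (unit_mat m p j :: 'a mat)"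
    using assms False by (intro eq_matI) (auto simp: unit_mat_def)
  then show ?thesis
    using bracket_and_sandwich(1)[OF assms(1), of p i] assms False by simp
qed (use assms in simp)

lemma unit_mat_col:
  assumes "unit_mat m i j \<in> K" "i \<noteq> j" "i < m" "j < m" "q \<noteq> i" "q < m"
  shows "unit_mat m i q \<in> K"
  using unit_mat_transpose[OF unit_mat_row[OF unit_mat_transpose[OF assms(1-4)]]] assms by auto

lemma unit_mat_all:
  assumes E: "unit_mat m i j \<in> K" "i \<noteq> j" "i < m" "j < m" and pq: "p \<noteq> q" "p < m" "q < m"
  shows "unit_mat m p q \<in> K"
proof (cases "p = j")
  case True
  then show ?thesis
    using unit_mat_col[OF unit_mat_transpose[OF E], of q] E pq by auto
next
  case False
  then show ?thesis
    using unit_mat_col[OF unit_mat_row[OF E, of p], of q] E pq by auto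
qed

text \<open>A nonzero off-diagonal entry yields a matrix unit by the sandwich. A diagonal nonscalar
  matrix has two different diagonal entries, and the bracket is their difference times a matrix
  unit.\<close>

lemma nonscalar_imp_unit_mat:
  assumes N: "N \<in> K" and ns: "\<And>c. N \<noteq> c \<cdot>\<^sub>m 1\<^sub>m m"
  obtains i j where "i \<noteq> j" "i < m" "j < m" "unit_mat m i j \<in> K"
proof (cases "\<exists>i j. i \<noteq> j \<and> i < m \<and> j < m \<and> N $$ (j, i) \<noteq> 0")
  case True
  then obtain i j where ij: "i \<noteq> j" "i < m" "j < m" "N $$ (j, i) \<noteq> 0"
    by blast
  have "inverse (N $$ (j, i)) \<cdot>\<^sub>m (N $$ (j, i) \<cdot>\<^sub>m unit_mat m i j) \<in> K"
    by (intro smult bracket_and_sandwich(2) N ij)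
  also have "inverse (N $$ (j, i)) \<cdot>\<^sub>m (N $$ (j, i) \<cdot>\<^sub>m unit_mat m i j) = unit_mat m i j"
    using ij by (intro eq_matI) auto
  finally show ?thesis
    using that ij by blast
next
  case False
  note Nc = carrier[OF N]
  have "\<exists>i j. i < m \<and> j < m \<and> N $$ (j, j) \<noteq> N $$ (i, i)"
  proof (rule ccontr)
    assume "\<not> ?thesis"
    then have "N $$ (i, i) = N $$ (0, 0)" if "i < m" for i
      using that by (metis gr_zeroI less_nat_zero_code)
    note diag = this
    have "N = N $$ (0, 0) \<cdot>\<^sub>m 1\<^sub>m m"
    proof (rule eq_matI)
      fix a b assume "a < dim_row (N $$ (0, 0) \<cdot>\<^sub>m 1\<^sub>m m)" "b < dim_col (N $$ (0, 0) \<cdot>\<^sub>m 1\<^sub>m m)"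
      then have "a < m" "b < m" by auto
      then show "N $$ (a, b) = (N $$ (0, 0) \<cdot>\<^sub>m 1\<^sub>m m) $$ (a, b)"
        using False diag[of a] by (cases "a = b") auto
    qed (use Nc in auto)
    then show False
      using ns by blast
  qed
  then obtain i j where ij: "i < m" "j < m" "N $$ (j, j) \<noteq> N $$ (i, i)"
    by blast
  then have ne: "i \<noteq> j" by auto
  let ?X = "mat m m (\<lambda>(r, s). (if r = i then N $$ (j, s) else 0) - (if s = j then N $$ (r, i) else 0))"
  have "inverse (N $$ (j, j) - N $$ (i, i)) \<cdot>\<^sub>m ?X = unit_mat m i j"
  proof (rule eq_matI)
    fix r s assume "r < dim_row (unit_mat m i j :: 'a mat)" "s < dim_col (unit_mat m i j :: 'a mat)"
    then have "r < m" "s < m" by (auto simp: unit_mat_def)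
    moreover have "N $$ (r, i) = 0" if "r \<noteq> i" using False that \<open>r < m\<close> ij by auto
    moreover have "N $$ (j, s) = 0" if "s \<noteq> j" using False that \<open>s < m\<close> ij by auto
    ultimately show "(inverse (N $$ (j, j) - N $$ (i, i)) \<cdot>\<^sub>m ?X) $$ (r, s) = unit_mat m i j $$ (r, s)"
      using ij by (auto simp: unit_mat_def)
  qed (auto simp: unit_mat_def)
  then have "unit_mat m i j \<in> K"
    using smult[OF bracket_and_sandwich(1)[OF N ne ij(1,2)], of "inverse (N $$ (j, j) - N $$ (i, i))"]
    by (simp only:)
  then show ?thesis
    using that ij ne by blast
qed

end

lemma unit_mat_form:
  assumes "w \<in> carrier_vec m" "v \<in> carrier_vec m" "i < m" "j < m"
  shows "w \<bullet> (unit_mat m i j *\<^sub>v v) = w $ i * (v $ j :: 'a::comm_ring_1)"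
proof -
  have "(unit_mat m i j *\<^sub>v v) $ r = (if r = i then v $ j else 0)" if "r < m" for r
  proof -
    have "(unit_mat m i j *\<^sub>v v) $ r = (\<Sum>s\<in>{0..<m}. (unit_mat m i j :: 'a mat) $$ (r, s) * v $ s)"
      using assms that by (simp add: unit_mat_def scalar_prod_def)
    also have "\<dots> = (\<Sum>s\<in>{0..<m}. if s = j then (if r = i then v $ s else 0) else 0)"
      using that by (intro sum.cong) (auto simp: unit_mat_def)
    finally show ?thesis
      using assms by simp
  qed
  note entry = this
  have "w \<bullet> (unit_mat m i j *\<^sub>v v) = (\<Sum>r\<in>{0..<m}. w $ r * (unit_mat m i j *\<^sub>v v) $ r)"
    by (simp add: scalar_prod_def unit_mat_def)
  also have "\<dots> = (\<Sum>r\<in>{0..<m}. if r = i then w $ r * v $ j else 0)"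
    by (intro sum.cong refl) (simp add: entry del: index_mult_mat_vec)
  finally have "w \<bullet> (unit_mat m i j *\<^sub>v v) = \<dots>" .
  then show ?thesis
    using assms by simp
qed

text \<open>\<open>K\<close> collects the matrices all of whose conjugates are killed by the form of
  \<open>w\<close> and \<open>v\<close>. A nonscalar member would put enough matrix units into
  \<open>K\<close> to contradict that \<open>w\<close> and \<open>v\<close> are nonzero.\<close>

lemma vanishing_conj_form_imp_scalar:
  fixes M :: "'a::alg_closed_field mat"
  assumes M: "M \<in> carrier_mat m m" and w: "w \<in> carrier_vec m" "w \<noteq> 0\<^sub>v m" and v: "v \<in> carrier_vec m" "v \<noteq> 0\<^sub>v m"
    and 0: "\<And>N. N \<in> gl_orbit m M \<Longrightarrow> w \<bullet> (N *\<^sub>v v) = 0"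
  shows "\<exists>c. M = c \<cdot>\<^sub>m 1\<^sub>m m"
proof (rule ccontr)
  assume ns: "\<not> ?thesis"
  define K where "K = {N \<in> carrier_mat m m. \<forall>N'\<in>gl_orbit m N. w \<bullet> (N' *\<^sub>v v) = 0}"
  interpret conj_invariant_subspace m K
  proof
    fix N assume N: "N \<in> K"
    then show Nc: "N \<in> carrier_mat m m"
      by (simp add: K_def)
    fix c
    have "w \<bullet> ((A * (c \<cdot>\<^sub>m N) * B) *\<^sub>v v) = 0"
      if AB: "A \<in> carrier_mat m m" "B \<in> carrier_mat m m" "A * B = 1\<^sub>m m" for A B
    proof -
      have "w \<bullet> ((A * N * B) *\<^sub>v v) = 0"
        using N AB unfolding K_def gl_orbit_def by blast
      moreover have "A * (c \<cdot>\<^sub>m N) * B = c \<cdot>\<^sub>m (A * N * B)"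
        using AB Nc by (simp add: mult_smult_distrib[of _ m m _ m] mult_smult_assoc_mat[of _ m m _ m])
      moreover have "(c \<cdot>\<^sub>m (A * N * B)) *\<^sub>v v = c \<cdot>\<^sub>v ((A * N * B) *\<^sub>v v)"
        using AB Nc v by (intro smult_mat_mult_vec) auto
      ultimately show ?thesis
        using AB Nc v w by (simp add: scalar_prod_smult_right[of w "(A * N * B) *\<^sub>v v"])
    qed
    then show "c \<cdot>\<^sub>m N \<in> K"
      using Nc unfolding K_def gl_orbit_def by auto
    show "A * N * B \<in> K" if AB: "A \<in> carrier_mat m m" "B \<in> carrier_mat m m" "A * B = 1\<^sub>m m" for A B
    proof -
      have "w \<bullet> ((A' * (A * N * B) * B') *\<^sub>v v) = 0"
        if AB': "A' \<in> carrier_mat m m" "B' \<in> carrier_mat m m" "A' * B' = 1\<^sub>m m" for A' B'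
      proof -
        have "A' * (A * N * B) * B' \<in> gl_orbit m N"
          by (rule gl_orbit_trans[OF Nc gl_orbitI[OF AB] gl_orbitI[OF AB']])
        then show ?thesis
          using N by (simp add: K_def)
      qed
      then show ?thesis
        using Nc AB unfolding K_def gl_orbit_def by auto
    qed
    fix N' assume N': "N' \<in> K"
    then have N'c: "N' \<in> carrier_mat m m"
      by (simp add: K_def)
    have "w \<bullet> ((A * (N + N') * B) *\<^sub>v v) = 0"
      if AB: "A \<in> carrier_mat m m" "B \<in> carrier_mat m m" "A * B = 1\<^sub>m m" for A B
    proof -
      have "w \<bullet> ((A * N * B) *\<^sub>v v) = 0" "w \<bullet> ((A * N' * B) *\<^sub>v v) = 0"
        using N N' AB unfolding K_def gl_orbit_def by blast+
      moreover have "A * (N + N') * B = A * N * B + A * N' * B"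
        using AB Nc N'c by (simp add: mult_add_distrib_mat[of _ m m _ m] add_mult_distrib_mat[of _ m m _ _ m])
      ultimately show ?thesis
        using AB Nc N'c v w bilinear_form_add[of "A * N * B" m "A * N' * B" w v] by simp
    qed
    then show "N + N' \<in> K"
      using Nc N'c unfolding K_def gl_orbit_def by auto
  qed
  have form0: "w \<bullet> (N *\<^sub>v v) = 0" if "N \<in> K" for N
  proof -
    show ?thesis
      using that gl_orbit_self[OF carrier[OF that]] unfolding K_def by blast
  qed
  have "M \<in> K"
    using M 0 by (simp add: K_def)
  then obtain i j where ij: "i \<noteq> j" "i < m" "j < m" "unit_mat m i j \<in> K"
    using nonscalar_imp_unit_mat ns by metis
  \<comment> \<open>The off-diagonal units force \<open>w\<close> and \<open>v\<close> to be
    supported on one common coordinate. This remaining case is excluded by a diagonal matrix of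
    trace 0.\<close>
  have off: "w $ p * v $ q = 0" if "p \<noteq> q" "p < m" "q < m" for p q
    using form0[OF unit_mat_all[OF ij(4,1-3) that]] unit_mat_form[OF w(1) v(1)] that by simp
  obtain p where p: "p < m" "w $ p \<noteq> 0"
    using w by (metis carrier_vecD eq_vecI index_zero_vec)
  obtain q where q: "q < m" "v $ q \<noteq> 0"
    using v by (metis carrier_vecD eq_vecI index_zero_vec)
  have "p = q"
    using off p q by (metis mult_eq_0_iff)
  obtain r where r: "r < m" "r \<noteq> p"
    using ij by metis
  have w0: "w $ r = 0"
    using off[of r q] q r \<open>p = q\<close> by simp
  \<comment> \<open>The bracket of two opposite matrix units is \<open>E_pp - E_rr\<close>. Since
    \<open>w $ r = 0\<close>, the form takes the value \<open>w $ p * v $ p\<close> on it.\<close>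
  let ?X = "mat m m (\<lambda>(a, b). (if a = p then unit_mat m r p $$ (r, b) else 0) - (if b = r then unit_mat m r p $$ (a, p) else 0))"
  have XK: "?X \<in> K"
    using unit_mat_all[OF ij(4,1-3), of r p] r p by (intro bracket_and_sandwich(1)) auto
  have "?X = unit_mat m p p + (- 1) \<cdot>\<^sub>m (unit_mat m r r :: 'a mat)"
    using r p by (intro eq_matI) (auto simp: unit_mat_def)
  with XK have "w \<bullet> ((unit_mat m p p + (- 1) \<cdot>\<^sub>m unit_mat m r r) *\<^sub>v v) = 0"
    using form0 by metis
  moreover have "((- 1) \<cdot>\<^sub>m unit_mat m r r) *\<^sub>v v = (- 1) \<cdot>\<^sub>v (unit_mat m r r *\<^sub>v v)"
    using v by (intro smult_mat_mult_vec[of _ m m]) auto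
  ultimately have "w $ p * v $ p - w $ r * v $ r = 0"
    using w v r p unit_mat_form[OF w(1) v(1)] mult_mat_vec_carrier[OF unit_mat_carrier v(1)]
      bilinear_form_add[of "unit_mat m p p" m "(- 1) \<cdot>\<^sub>m unit_mat m r r" w v]
    by (simp add: scalar_prod_smult_right[of w "unit_mat m r r *\<^sub>v v"])
  then show False
    using p q w0 \<open>p = q\<close> by simp
qed

section \<open>Quadratic equations and the passage from a dense orbit to an equation\<close>

text \<open>The letters stand for the sum and the product of the roots of
  \<open>X^2 - \<tau> X + \<nu>\<close>. Scalar matrices are included; they satisfy several such
  equations.\<close>

definition quadratic_mat :: "nat \<Rightarrow> 'a::field \<Rightarrow> 'a \<Rightarrow> 'a mat \<Rightarrow> bool" where
  "quadratic_mat m \<tau> \<nu> y \<longleftrightarrow> y \<in> carrier_mat m m \<and> y * y = \<tau> \<cdot>\<^sub>m y - \<nu> \<cdot>\<^sub>m 1\<^sub>m m"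

definition quad_eval :: "nat \<Rightarrow> 'a::comm_ring_1 \<Rightarrow> 'a \<Rightarrow> 'a \<Rightarrow> 'a mat \<Rightarrow> 'a mat" where
  "quad_eval m a b c A = a \<cdot>\<^sub>m (A * A) + (b \<cdot>\<^sub>m A + c \<cdot>\<^sub>m 1\<^sub>m m)"

lemma quad_eval_conj:
  fixes A B x :: "'a::field mat"
  assumes A: "A \<in> carrier_mat m m" and B: "B \<in> carrier_mat m m" and AB: "A * B = 1\<^sub>m m" and x: "x \<in> carrier_mat m m"
  shows "quad_eval m a b c (A * x * B) = A * quad_eval m a b c x * B"
proof -
  have BA: "B * A = 1\<^sub>m m"
    using mat_mult_left_right_inverse[OF A B AB] .
  have "(A * x * B) * (A * x * B) = A * x * (B * A) * x * B"
    using A B x by (simp add: assoc_mult_mat[of _ m m _ m _ m])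
  then have sq: "(A * x * B) * (A * x * B) = A * (x * x) * B"
    unfolding BA using A B x by (simp add: assoc_mult_mat[of _ m m _ m _ m])
  have "A * quad_eval m a b c x * B
      = a \<cdot>\<^sub>m (A * (x * x) * B) + (b \<cdot>\<^sub>m (A * x * B) + c \<cdot>\<^sub>m (A * B))"
    unfolding quad_eval_def using A B x
    by (simp add: mult_add_distrib_mat[of _ m m _ m] add_mult_distrib_mat[of _ m m _ _ m]
        mult_smult_distrib[of _ m m _ m] mult_smult_assoc_mat[of _ m m _ m])
  then show ?thesis
    unfolding quad_eval_def sq AB by simp
qed

theorem spherical_imp_quadratic:
  fixes g :: "'a::alg_closed_field mat"
  assumes m: "m \<ge> 1" and g: "g \<in> carrier (SL m)"
    and sph: "spherical m (SL m) (conjugacy_class (SL m) g)"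
  shows "\<exists>\<tau> \<nu>. quadratic_mat m \<tau> \<nu> g"
proof -
  have gc: "g \<in> carrier_mat m m"
    using g by (simp add: SL_carrier_iff)
  let ?C = "gl_orbit m g"
  have C: "conjugacy_class (SL m) g = ?C"
    by (rule conjugacy_class_SL[OF m gc])
  have Cc: "?C \<subseteq> carrier_mat m m"
    using gc by (auto simp: gl_orbit_def)
  obtain B x where B: "Borel_subgroup m B (SL m)" and x: "x \<in> ?C"
    and dense: "Abstract_Topology.closure_of (subtopology (zariski m) ?C) (conjugates (SL m) B x) = ?C"
    using sph unfolding spherical_def C by blast
  have xc: "x \<in> carrier_mat m m"
    using x Cc by blast
  have Bsub: "subgroup B (SL m)" and Bconn: "connectedin (zariski m) B" and "solvable (SL m\<lparr>carrier := B\<rparr>)"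
    using B unfolding Borel_subgroup_def Let_def by blast+
  then obtain d where d: "(derived (SL m) ^^ d) B = {1\<^sub>m m}"
    using group.solvable_subgroup_iff[OF group_SL Bsub] by auto
  obtain v where v: "v \<in> carrier_vec m" "v \<noteq> 0\<^sub>v m" "\<And>b. b \<in> B \<Longrightarrow> \<exists>c. b *\<^sub>v v = c \<cdot>\<^sub>v v"
    using lie_kolchin_eigenvector[OF m Bsub Bconn d] by blast
  obtain w where w: "w \<in> carrier_vec m" "w \<noteq> 0\<^sub>v m" "\<And>b. b \<in> B \<Longrightarrow> \<exists>c. transpose_mat b *\<^sub>v w = c \<cdot>\<^sub>v w"
    using lie_kolchin_eigenform[OF m Bsub Bconn d] by blast
  define f where "f N = w \<bullet> (N *\<^sub>v v)" for N
  have f_add: "f (M + N) = f M + f N" if "M \<in> carrier_mat m m" "N \<in> carrier_mat m m" for M N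
    unfolding f_def using that w v by (intro bilinear_form_add)
  have f_smult: "f (c \<cdot>\<^sub>m N) = c * f N" if "N \<in> carrier_mat m m" for c N
    using that w v by (simp add: f_def smult_mat_mult_vec[OF that v(1)] scalar_prod_smult_right[of w "N *\<^sub>v v"])
  \<comment> \<open>If \<open>f (1\<^sub>m m)\<close> is nonzero, \<open>a = 0\<close> is possible.
    Otherwise \<open>c\<close> drops out, and \<open>f x\<close> and \<open>f (x * x)\<close> are
    balanced against each other, or are both zero.\<close>
  obtain a b c where abc: "a \<noteq> 0 \<or> b \<noteq> 0" "a * f (x * x) + (b * f x + c * f (1\<^sub>m m)) = 0"
  proof (cases "f (1\<^sub>m m) = 0")
    case True
    then show ?thesis
      using that[of "f x" "- f (x * x)" 0] that[of 0 1 0] by (cases "f x = 0 \<and> f (x * x) = 0") (auto simp: mult.commute)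
  next
    case False
    then show ?thesis
      using that[of 0 "f (1\<^sub>m m)" "- f x"] by (auto simp: mult.commute)
  qed
  let ?q = "quad_eval m a b c"
  have qc: "?q A \<in> carrier_mat m m" if "A \<in> carrier_mat m m" for A
    using that by (simp add: quad_eval_def)
  have fqx: "f (?q x) = 0"
    using abc(2) xc by (simp add: quad_eval_def f_add f_smult)
  have regular: "(\<lambda>A. f (?q A)) \<in> regular_funs m"
  proof -
    have "Mat.regular m m ?q"
      unfolding quad_eval_def
      by (intro Mat.regular_add Mat.regular_smult Mat.regular_mult Mat.regular_const regular_id Mat.const one_carrier_mat)
    then have "(\<lambda>A. \<Sum>i\<in>{0..<m}. w $ i * (?q A *\<^sub>v v) $ i) \<in> regular_funs m"
      by (intro Mat.sum Mat.mult Mat.const Mat.regular_mult_mat_vec) (use v in auto)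
    then show ?thesis
    proof (rule Mat.cong)
      fix A :: "'a mat" assume "A \<in> carrier_mat m m"
      then have "dim_vec (?q A *\<^sub>v v) = m"
        using qc by auto
      then show "(\<Sum>i\<in>{0..<m}. w $ i * (?q A *\<^sub>v v) $ i) = f (?q A)"
        by (simp add: f_def scalar_prod_def del: index_mult_mat_vec dim_mult_mat_vec)
    qed
  qed
  have conj_x: "f (?q y) = 0" and yC: "y \<in> ?C" if y: "y \<in> conjugates (SL m) B x" for y
  proof -
    obtain h where h: "h \<in> B" "y = h \<otimes>\<^bsub>SL m\<^esub> x \<otimes>\<^bsub>SL m\<^esub> inv\<^bsub>SL m\<^esub> h"
      using y unfolding conjugates_def by blast
    have hS: "h \<in> carrier (SL m)"
      using subgroup.mem_carrier[OF Bsub h(1)] .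
    then have hinv: "adj_mat h \<in> B"
      using subgroup.m_inv_closed[OF Bsub h(1)] SL_inv[OF hS] by simp
    note hh = SL_adj_mat[OF hS]
    have y_eq: "y = h * x * adj_mat h"
      using h(2) SL_inv[OF hS] by simp
    obtain \<chi> where \<chi>: "adj_mat h *\<^sub>v v = \<chi> \<cdot>\<^sub>v v"
      using v(3)[OF hinv] by blast
    obtain \<psi> where \<psi>: "transpose_mat h *\<^sub>v w = \<psi> \<cdot>\<^sub>v w"
      using w(3)[OF h(1)] by blast
    \<comment> \<open>Conjugation by \<open>h\<close> acts on \<open>w\<close> through the transpose
      of \<open>h\<close> and on \<open>v\<close> through its inverse. Both are eigenvectors, so the
      value only acquires the factor \<open>\<psi> * \<chi>\<close>.\<close>
    have "f (?q y) = w \<bullet> ((h * ?q x * adj_mat h) *\<^sub>v v)"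
      unfolding f_def y_eq quad_eval_conj[OF hh(1-3) xc] ..
    also have "(h * ?q x * adj_mat h) *\<^sub>v v = h *\<^sub>v (?q x *\<^sub>v (\<chi> \<cdot>\<^sub>v v))"
      using hh(1,2) qc[OF xc] v(1)
      by (simp add: assoc_mult_mat_vec[of _ m m _ m] mult_carrier_mat[of _ m m] \<chi> del: assoc_mult_mat)
    also have "w \<bullet> \<dots> = (transpose_mat h *\<^sub>v w) \<bullet> (?q x *\<^sub>v (\<chi> \<cdot>\<^sub>v v))"
      using hh(1) qc[OF xc] v(1) w(1) by (intro transpose_vec_mult_scalar[symmetric]) auto
    also have "\<dots> = \<psi> * \<chi> * f (?q x)"
      unfolding \<psi> using qc[OF xc] v(1) w(1)
      by (simp add: f_def mult_mat_vec[OF qc[OF xc] v(1)] smult_scalar_prod_distrib[of _ m] scalar_prod_smult_distrib[of _ m])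
    finally show "f (?q y) = 0"
      using fqx by simp
    have "y \<in> conjugacy_class (SL m) x"
      unfolding conjugates_def using h hS by blast
    then have "y \<in> gl_orbit m x"
      using conjugacy_class_SL[OF m xc] by simp
    then show "y \<in> ?C"
      using gl_orbit_trans[OF gc x] by blast
  qed
  obtain F where F: "F \<in> poly_funs m" "\<And>A. A \<in> carrier_mat m m \<Longrightarrow> F A = f (?q A)"
    using regular_funsE[OF regular] by blast
  have "conjugates (SL m) B x \<subseteq> ?C"
    using yC by blast
  moreover have "\<forall>A\<in>conjugates (SL m) B x. F A = 0"
  proof
    fix A assume A: "A \<in> conjugates (SL m) B x"
    then have "A \<in> carrier_mat m m"
      using yC Cc by blast
    then show "F A = 0"
      using F(2) conj_x[OF A] by simp
  qed
  ultimately have "\<forall>A\<in>?C. F A = 0"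
    using dense F(1) closure_of_zariski_eq_iff[OF _ Cc] by blast
  \<comment> \<open>Conjugates of \<open>?q g\<close> are the values of \<open>?q\<close> at
    conjugates of \<open>g\<close>, where \<open>F\<close> vanishes by density.\<close>
  then have "w \<bullet> (N *\<^sub>v v) = 0" if N: "N \<in> gl_orbit m (?q g)" for N
  proof -
    obtain h k where hk: "h \<in> carrier_mat m m" "k \<in> carrier_mat m m" "h * k = 1\<^sub>m m" "N = h * ?q g * k"
      using N unfolding gl_orbit_def by blast
    then have "N = ?q (h * g * k)" "h * g * k \<in> ?C"
      using quad_eval_conj[OF hk(1-3) gc] gl_orbitI by auto
    then show ?thesis
      using \<open>\<forall>A\<in>?C. F A = 0\<close> F(2)[of "h * g * k"] Cc unfolding f_def by (metis subsetD)
  qed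
  then obtain e where e: "?q g = e \<cdot>\<^sub>m 1\<^sub>m m"
    using vanishing_conj_form_imp_scalar[OF qc[OF gc] w(1,2) v(1,2)] by blast
  have entry: "a * (g * g) $$ (i, j) + (b * g $$ (i, j) + c * (1\<^sub>m m) $$ (i, j)) = e * (1\<^sub>m m) $$ (i, j)"
    if "i < m" "j < m" for i j
    using arg_cong[OF e, of "\<lambda>M. M $$ (i, j)"] that gc unfolding quad_eval_def
    by (simp del: index_mult_mat(1) index_one_mat(1))
  show ?thesis
  proof (cases "a = 0")
    case False
    have "g * g = (- b / a) \<cdot>\<^sub>m g - ((c - e) / a) \<cdot>\<^sub>m 1\<^sub>m m"
    proof (rule eq_matI)
      fix i j assume "i < dim_row ((- b / a) \<cdot>\<^sub>m g - ((c - e) / a) \<cdot>\<^sub>m 1\<^sub>m m)"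
        "j < dim_col ((- b / a) \<cdot>\<^sub>m g - ((c - e) / a) \<cdot>\<^sub>m 1\<^sub>m m)"
      then have ij: "i < m" "j < m" by auto
      have "(g * g) $$ (i, j) = (e * (1\<^sub>m m) $$ (i, j) - (b * g $$ (i, j) + c * (1\<^sub>m m) $$ (i, j))) / a"
        using entry[OF ij] False by (metis add_diff_cancel_right' nonzero_mult_div_cancel_left)
      then show "(g * g) $$ (i, j) = ((- b / a) \<cdot>\<^sub>m g - ((c - e) / a) \<cdot>\<^sub>m 1\<^sub>m m) $$ (i, j)"
        using ij gc by (simp add: field_simps False del: index_mult_mat(1))
    qed (use gc in auto)
    then show ?thesis
      unfolding quadratic_mat_def using gc by blast
  next
    case True
    then have "b \<noteq> 0"
      using abc(1) by simp
    \<comment> \<open>With \<open>a = 0\<close> the relation is linear and \<open>g\<close> is the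
      scalar \<open>?s\<close>, which satisfies the quadratic equation
      \<open>X^2 = ?s X\<close>.\<close>
    let ?s = "(e - c) / b"
    have g_eq: "g = ?s \<cdot>\<^sub>m 1\<^sub>m m"
    proof (rule eq_matI)
      fix i j assume "i < dim_row (?s \<cdot>\<^sub>m 1\<^sub>m m)" "j < dim_col (?s \<cdot>\<^sub>m 1\<^sub>m m)"
      then have ij: "i < m" "j < m" by auto
      have "b * g $$ (i, j) = (e - c) * (1\<^sub>m m) $$ (i, j)"
        using entry[OF ij] True by (simp add: algebra_simps)
      then show "g $$ (i, j) = (?s \<cdot>\<^sub>m 1\<^sub>m m) $$ (i, j)"
        using ij \<open>b \<noteq> 0\<close> by (simp add: field_simps)
    qed (use gc in auto)
    have "g * g = (?s \<cdot>\<^sub>m 1\<^sub>m m) * g"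
      using g_eq by (rule arg_cong)
    also have "\<dots> = ?s \<cdot>\<^sub>m g"
      using gc by (simp add: mult_smult_assoc_mat[of _ m m _ m])
    also have "\<dots> = ?s \<cdot>\<^sub>m g - 0 \<cdot>\<^sub>m 1\<^sub>m m"
      using gc by (intro eq_matI) auto
    finally have "quadratic_mat m ?s 0 g"
      unfolding quadratic_mat_def using gc by blast
    then show ?thesis
      by blast
  qed
qed

section \<open>Normal forms of roots of a quadratic polynomial\<close>

lemma gl_orbit_sym:
  assumes x: "x \<in> carrier_mat m m" and y: "y \<in> gl_orbit m x"
  shows "x \<in> gl_orbit m y"
proof -
  obtain A B where AB: "A \<in> carrier_mat m m" "B \<in> carrier_mat m m" "A * B = 1\<^sub>m m" "y = A * x * B"
    using y unfolding gl_orbit_def by blast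
  have BA: "B * A = 1\<^sub>m m"
    using mat_mult_left_right_inverse[OF AB(1-3)] .
  have "B * y * A = (B * A) * x * (B * A)"
    unfolding AB(4) using AB(1,2) x by (simp add: assoc_mult_mat[of _ m m _ m _ m])
  then have "x = B * y * A"
    using BA x by simp
  then show ?thesis
    using gl_orbitI[OF AB(2,1) BA, of y] by simp
qed

lemma gl_orbit_carrier: "x \<in> carrier_mat m m \<Longrightarrow> gl_orbit m x \<subseteq> carrier_mat m m"
  by (auto simp: gl_orbit_def)

lemma upper_orbit_subset_gl_orbit: "upper_orbit m x \<subseteq> gl_orbit m x"
  unfolding upper_orbit_def gl_orbit_def band_def by blast

text \<open>Two conjugates are joined by conjugating one of them with the points of the line from 1
  to \<open>A\<close>. The adjugate keeps the numerator polynomial, and the parameters at which the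
  line is singular are left out of the curve.\<close>

lemma irreducible_gl_orbit:
  fixes x :: "'a::alg_closed_field mat"
  assumes x: "x \<in> carrier_mat m m"
  shows "irreducible_set m (gl_orbit m x)"
proof (rule irreducible_setI)
  fix y z assume y: "y \<in> gl_orbit m x" and "z \<in> gl_orbit m x"
  then have "z \<in> gl_orbit m y"
    using gl_orbit_sym[OF x y] gl_orbit_trans[of y m x z] gl_orbit_carrier[OF x] by blast
  then obtain A B where AB: "A \<in> carrier_mat m m" "B \<in> carrier_mat m m" "A * B = 1\<^sub>m m" "z = A * y * B"
    unfolding gl_orbit_def by blast
  have yc: "y \<in> carrier_mat m m"
    using y gl_orbit_carrier[OF x] by blast
  define L where "L t = (1 + t * - 1) \<cdot>\<^sub>m 1\<^sub>m m + (0 + t * 1) \<cdot>\<^sub>m A" for t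
  define q where "q t = det (L t)" for t
  define P where "P t = L t * y * adj_mat (L t)" for t
  have L: "Poly.regular m L"
    unfolding L_def by (intro Poly.regular_add Poly.regular_smult Poly.regular_const poly_linear AB one_carrier_mat)
  then have q: "q \<in> range poly"
    unfolding q_def by (rule Poly.regular_det)
  have P: "Poly.regular m P"
    unfolding P_def by (intro Poly.regular_mult Poly.regular_adj_mat Poly.regular_const L yc)
  have Lc: "L t \<in> carrier_mat m m" for t
    using AB by (simp add: L_def)
  have L01: "L 0 = 1\<^sub>m m" "L 1 = A"
    using AB(1) by (auto simp: L_def intro!: eq_matI)
  have q0: "q 0 = 1"
    using L01 by (simp add: q_def)
  have "q 1 * det B = 1"
    using AB(3) det_mult[OF AB(1,2)] L01 by (simp add: q_def)
  then have q1: "q 1 \<noteq> 0"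
    by auto
  have inv: "L t * (inverse (q t) \<cdot>\<^sub>m adj_mat (L t)) = 1\<^sub>m m" if "q t \<noteq> 0" for t
    using that adj_mat(1,2)[OF Lc[of t]] Lc[of t]
    by (simp add: mult_smult_distrib[of _ m m _ m] smult_smult_mat q_def one_smult_mat)
  have curve: "inverse (q t) \<cdot>\<^sub>m P t = L t * y * (inverse (q t) \<cdot>\<^sub>m adj_mat (L t))" for t
    unfolding P_def using adj_mat(1)[OF Lc[of t]] Lc[of t] yc
    by (intro mult_smult_distrib[of _ m m _ m, symmetric]) auto
  let ?I = "{inverse (q t) \<cdot>\<^sub>m P t | t. q t \<noteq> 0}"
  have "?I \<subseteq> gl_orbit m x"
  proof clarify
    fix t assume t: "q t \<noteq> 0"
    have "inverse (q t) \<cdot>\<^sub>m P t \<in> gl_orbit m y"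
      unfolding curve using adj_mat(1)[OF Lc[of t]] by (intro gl_orbitI Lc inv t) auto
    then show "inverse (q t) \<cdot>\<^sub>m P t \<in> gl_orbit m x"
      using gl_orbit_trans[OF x y] by blast
  qed
  moreover have "irreducible_set m ?I"
    using rational_curve_irreducible[OF P q, of 0] q0 by simp
  moreover have "y = inverse (q 0) \<cdot>\<^sub>m P 0"
  proof -
    have "adj_mat (1\<^sub>m m :: 'a mat) = 1\<^sub>m m"
      using adj_mat(1,2)[of "1\<^sub>m m :: 'a mat" m] by (simp add: one_smult_mat)
    then show ?thesis
      using yc L01 q0 by (simp add: P_def one_smult_mat)
  qed
  moreover have "z = inverse (q 1) \<cdot>\<^sub>m P 1"
  proof -
    have BA: "B * A = 1\<^sub>m m"
      using mat_mult_left_right_inverse[OF AB(1-3)] .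
    let ?A' = "inverse (q 1) \<cdot>\<^sub>m adj_mat A"
    have A': "?A' \<in> carrier_mat m m"
      using adj_mat(1)[OF AB(1)] by simp
    have "B = B * (A * ?A')"
      using inv[OF q1] L01 AB(2) by simp
    also have "\<dots> = (B * A) * ?A'"
      by (rule assoc_mult_mat[OF AB(2,1) A', symmetric])
    also have "\<dots> = ?A'"
      unfolding BA by (rule left_mult_one_mat[OF A'])
    finally show ?thesis
      unfolding curve AB(4) using L01 by simp
  qed
  ultimately show "\<exists>I\<subseteq>gl_orbit m x. irreducible_set m I \<and> y \<in> I \<and> z \<in> I"
    using q0 q1 by (intro exI[of _ ?I]) (metis (mono_tags, lifting) mem_Collect_eq one_neq_zero)
qed

text \<open>
  The first and last coordinates are singled out because the first basis vector and the last
  coordinate form are fixed, up to scalars, by the upper triangular matrices.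
\<close>

definition frame_mat :: "nat \<Rightarrow> 'a::zero \<Rightarrow> 'a \<Rightarrow> 'a \<Rightarrow> 'a \<Rightarrow> 'a mat \<Rightarrow> 'a mat" where
  "frame_mat k p q r s z = mat (Suc (Suc k)) (Suc (Suc k)) (\<lambda>(i, j).
     if i = 0 then (if j = 0 then p else if j = Suc k then q else 0)
     else if i = Suc k then (if j = 0 then r else if j = Suc k then s else 0)
     else if j = 0 \<or> j = Suc k then 0 else z $$ (i - 1, j - 1))"

lemma frame_mat_carrier [simp]: "frame_mat k p q r s z \<in> carrier_mat (Suc (Suc k)) (Suc (Suc k))"
  by (simp add: frame_mat_def)

lemma sum_frame: "(\<Sum>l = 0..<Suc (Suc k). f l) = f 0 + (\<Sum>l = 0..<k. f (Suc l)) + (f (Suc k) :: 'a::comm_monoid_add)"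
  by (subst sum.atLeast0_lessThan_Suc, subst sum.atLeast0_lessThan_Suc_shift) (simp add: comp_def)

lemma frame_index_cases:
  assumes "i < Suc (Suc k)"
  obtains "i = 0" | "i = Suc k" | l where "l < k" "i = Suc l"
  using assms by (metis less_Suc_eq less_Suc_eq_0_disj)

lemma frame_mat_index [simp]:
  "frame_mat k p q r s z $$ (0, 0) = p" "frame_mat k p q r s z $$ (0, Suc k) = q"
  "frame_mat k p q r s z $$ (Suc k, 0) = r" "frame_mat k p q r s z $$ (Suc k, Suc k) = s"
  "i < k \<Longrightarrow> frame_mat k p q r s z $$ (Suc i, 0) = 0" "i < k \<Longrightarrow> frame_mat k p q r s z $$ (Suc i, Suc k) = 0"
  "i < k \<Longrightarrow> frame_mat k p q r s z $$ (0, Suc i) = 0" "i < k \<Longrightarrow> frame_mat k p q r s z $$ (Suc k, Suc i) = 0"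
  "i < k \<Longrightarrow> j < k \<Longrightarrow> frame_mat k p q r s z $$ (Suc i, Suc j) = z $$ (i, j)"
  by (auto simp: frame_mat_def)

lemma frame_mat_mult:
  fixes y z :: "'a::comm_ring_1 mat"
  assumes y: "y \<in> carrier_mat k k" and z: "z \<in> carrier_mat k k"
  shows "frame_mat k a b c d y * frame_mat k p q r s z =
    frame_mat k (a * p + b * r) (a * q + b * s) (c * p + d * r) (c * q + d * s) (y * z)" (is "?M * ?N = ?R")
proof (rule eq_matI)
  fix i j assume "i < dim_row ?R" "j < dim_col ?R"
  then have ij: "i < Suc (Suc k)" "j < Suc (Suc k)"
    by (simp_all add: frame_mat_def)
  have "(?M * ?N) $$ (i, j) = (\<Sum>l = 0..<Suc (Suc k). ?M $$ (i, l) * ?N $$ (l, j))"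
    using ij by (simp add: scalar_prod_def frame_mat_def)
  also have "\<dots> = ?M $$ (i, 0) * ?N $$ (0, j) + (\<Sum>l = 0..<k. ?M $$ (i, Suc l) * ?N $$ (Suc l, j))
      + ?M $$ (i, Suc k) * ?N $$ (Suc k, j)"
    by (rule sum_frame)
  also have "\<dots> = ?R $$ (i, j)"
    using ij(1)
  proof (cases rule: frame_index_cases)
    case 1
    show ?thesis
      using ij(2) by (cases rule: frame_index_cases) (simp_all add: 1)
  next
    case 2
    show ?thesis
      using ij(2) by (cases rule: frame_index_cases) (simp_all add: 2)
  next
    case (3 i')
    show ?thesis
      using ij(2)
    proof (cases rule: frame_index_cases)
      case (3 j')
      then show ?thesis
        using \<open>i' < k\<close> \<open>i = Suc i'\<close> y z by (simp add: scalar_prod_def)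
    qed (simp_all add: 3)
  qed
  finally show "(?M * ?N) $$ (i, j) = ?R $$ (i, j)" .
qed (simp_all add: frame_mat_def)

lemma frame_mat_one: "frame_mat k 1 0 0 1 (1\<^sub>m k) = 1\<^sub>m (Suc (Suc k))"
proof (rule eq_matI)
  fix i j assume "i < dim_row (1\<^sub>m (Suc (Suc k)) :: 'a mat)" "j < dim_col (1\<^sub>m (Suc (Suc k)) :: 'a mat)"
  then have "i < Suc (Suc k)" "j < Suc (Suc k)" by auto
  then show "frame_mat k 1 0 0 1 (1\<^sub>m k) $$ (i, j) = (1\<^sub>m (Suc (Suc k)) :: 'a mat) $$ (i, j)"
    by (elim frame_index_cases) auto
qed (simp_all add: frame_mat_def)

lemma frame_mat_conj:
  fixes z :: "'a::comm_ring_1 mat"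
  assumes "A \<in> carrier_mat k k" "B \<in> carrier_mat k k" "z \<in> carrier_mat k k"
  shows "frame_mat k 1 0 0 1 A * frame_mat k p q r s z * frame_mat k 1 0 0 1 B = frame_mat k p q r s (A * z * B)"
  using assms by (simp add: frame_mat_mult)

lemma band_frame_mat:
  assumes "band k 0 A"
  shows "band (Suc (Suc k)) 0 (frame_mat k 1 0 0 1 A)"
  unfolding band_def
proof (intro conjI allI impI)
  fix i j assume ij: "i < Suc (Suc k)" "j < Suc (Suc k)" "j < i + 0"
  show "frame_mat k 1 0 0 1 A $$ (i, j) = 0"
    using ij(1)
  proof (cases rule: frame_index_cases)
    case (3 i')
    show ?thesis
      using ij(2) by (cases rule: frame_index_cases) (use ij 3 assms in \<open>auto simp: band_def\<close>)
  next
    case 2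
    show ?thesis
      using ij(2) by (cases rule: frame_index_cases) (use ij 2 in auto)
  qed (use ij in auto)
qed simp

lemma regular_frame_mat:
  "Mat.regular k (Suc (Suc k)) (\<lambda>z. frame_mat k p q r s z)"
proof (rule Mat.regularI)
  fix i j assume ij: "i < Suc (Suc k)" "j < Suc (Suc k)"
  have entry: "(\<lambda>z. z $$ (i', j')) \<in> regular_funs k" if "i' < k" "j' < k" for i' j'
    using that by (intro poly_funs_regular poly_funs.entry)
  show "(\<lambda>z. frame_mat k p q r s z $$ (i, j)) \<in> regular_funs k"
    using ij(1)
  proof (cases rule: frame_index_cases)
    case 1
    show ?thesis
      using ij(2) by (cases rule: frame_index_cases) (simp_all add: 1 Mat.const)
  next
    case 2
    show ?thesis
      using ij(2) by (cases rule: frame_index_cases) (simp_all add: 2 Mat.const)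
  next
    case (3 i')
    show ?thesis
      using ij(2) by (cases rule: frame_index_cases) (simp_all add: 3 Mat.const entry)
  qed
qed simp

text \<open>The equation is the vanishing of \<open>quad_eval\<close>, which commutes with
  conjugation.\<close>

lemma quadratic_gl_orbit:
  assumes y: "quadratic_mat m \<tau> \<nu> y" and z: "z \<in> gl_orbit m y"
  shows "quadratic_mat m \<tau> \<nu> z"
proof -
  have iff: "quadratic_mat m \<tau> \<nu> x \<longleftrightarrow> quad_eval m 1 (- \<tau>) \<nu> x = 0\<^sub>m m m" if x: "x \<in> carrier_mat m m" for x :: "'a mat"
  proof -
    have "x * x = \<tau> \<cdot>\<^sub>m x - \<nu> \<cdot>\<^sub>m 1\<^sub>m m \<longleftrightarrow>
      (\<forall>i<m. \<forall>j<m. (x * x) $$ (i, j) = \<tau> * x $$ (i, j) - \<nu> * (1\<^sub>m m) $$ (i, j))"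
      using x by (auto simp: mat_eq_iff simp del: index_mult_mat(1))
    also have "\<dots> \<longleftrightarrow> (\<forall>i<m. \<forall>j<m. (x * x) $$ (i, j) + (- \<tau> * x $$ (i, j) + \<nu> * (1\<^sub>m m) $$ (i, j)) = 0)"
      by (intro all_cong1 imp_cong refl) (auto simp: algebra_simps simp del: index_mult_mat(1))
    also have "\<dots> \<longleftrightarrow> quad_eval m 1 (- \<tau>) \<nu> x = 0\<^sub>m m m"
      using x by (auto simp: mat_eq_iff quad_eval_def simp del: index_mult_mat(1))
    finally show ?thesis
      using x by (simp add: quadratic_mat_def)
  qed
  have yc: "y \<in> carrier_mat m m"
    using y by (simp add: quadratic_mat_def)
  obtain A B where AB: "A \<in> carrier_mat m m" "B \<in> carrier_mat m m" "A * B = 1\<^sub>m m" "z = A * y * B"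
    using z unfolding gl_orbit_def by blast
  have "quad_eval m 1 (- \<tau>) \<nu> z = A * 0\<^sub>m m m * B"
    using quad_eval_conj[OF AB(1-3) yc] iff[OF yc] y AB(4) by simp
  then show ?thesis
    using iff[of z] AB yc by simp
qed

lemma upper_orbit_conj:
  assumes x: "x \<in> carrier_mat m m" and y: "y \<in> upper_orbit m x"
    and b: "band m 0 b" "b' \<in> carrier_mat m m" "b * b' = 1\<^sub>m m"
  shows "b * y * b' \<in> upper_orbit m x"
proof -
  obtain A B where AB: "band m 0 A" "B \<in> carrier_mat m m" "A * B = 1\<^sub>m m" "y = A * x * B"
    using y unfolding upper_orbit_def by blast
  have c: "A \<in> carrier_mat m m" "b \<in> carrier_mat m m"
    using AB(1) b(1) by (auto simp: band_def)
  have "b * y * b' = (b * A) * x * (B * b')"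
    unfolding AB(4) using AB(2) b(2) c x by (simp add: assoc_mult_mat[of _ m m _ m _ m])
  moreover have "(b * A) * (B * b') = b * (A * B) * b'"
    using AB(2) b(2) c by (simp add: assoc_mult_mat[of _ m m _ m _ m])
  then have "(b * A) * (B * b') = 1\<^sub>m m"
    using AB(3) b(3) c by simp
  moreover have "band m 0 (b * A)"
    using band_mult[OF b(1) AB(1)] by simp
  ultimately show ?thesis
    using upper_orbitI[of m "b * A" "B * b'" x] AB(2) b(2) mult_carrier_mat by metis
qed

lemma frame_mat_gl_orbit:
  assumes "x \<in> carrier_mat k k" "y \<in> gl_orbit k x"
  shows "frame_mat k p q r s y \<in> gl_orbit (Suc (Suc k)) (frame_mat k p q r s x)"
proof -
  obtain A B where AB: "A \<in> carrier_mat k k" "B \<in> carrier_mat k k" "A * B = 1\<^sub>m k" "y = A * x * B"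
    using assms(2) unfolding gl_orbit_def by blast
  have "frame_mat k 1 0 0 1 A * frame_mat k 1 0 0 1 B = 1\<^sub>m (Suc (Suc k))"
    using AB frame_mat_one by (simp add: frame_mat_mult)
  then show ?thesis
    unfolding AB(4) frame_mat_conj[OF AB(1,2) assms(1), symmetric] by (intro gl_orbitI) auto
qed

lemma frame_mat_upper_orbit:
  assumes "x \<in> carrier_mat k k" "y \<in> upper_orbit k x"
  shows "frame_mat k p q r s y \<in> upper_orbit (Suc (Suc k)) (frame_mat k p q r s x)"
proof -
  obtain A B where AB: "band k 0 A" "B \<in> carrier_mat k k" "A * B = 1\<^sub>m k" "y = A * x * B"
    using assms(2) unfolding upper_orbit_def by blast
  have A: "A \<in> carrier_mat k k"
    using AB(1) by (simp add: band_def)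
  have "frame_mat k 1 0 0 1 A * frame_mat k 1 0 0 1 B = 1\<^sub>m (Suc (Suc k))"
    using A AB frame_mat_one by (simp add: frame_mat_mult)
  then show ?thesis
    unfolding AB(4) frame_mat_conj[OF A AB(2) assms(1), symmetric]
    by (intro upper_orbitI band_frame_mat AB(1)) auto
qed

text \<open>The last basis vector is replaced by the image of the first one under \<open>z\<close>,
  which is possible because the corner entry is nonzero; the middle ones are corrected by multiples
  of the first. This change of basis is triangular, and the first and last coordinates then carry
  the companion block of \<open>X^2 - \<tau> X + \<nu>\<close>.\<close>

lemma upper_normal_form:
  fixes z :: "'a::field mat"
  assumes z: "quadratic_mat (Suc (Suc k)) \<tau> \<nu> z" and \<alpha>: "z $$ (Suc k, 0) \<noteq> 0"
  obtains b b' z' where "band (Suc (Suc k)) 0 b" "b' \<in> carrier_mat (Suc (Suc k)) (Suc (Suc k))"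
    "b * b' = 1\<^sub>m (Suc (Suc k))" "quadratic_mat k \<tau> \<nu> z'" "z = b * frame_mat k 0 (- \<nu>) 1 \<tau> z' * b'"
proof -
  let ?m = "Suc (Suc k)" and ?\<alpha> = "z $$ (Suc k, 0)"
  have zc: "z \<in> carrier_mat ?m ?m" and zz: "z * z = \<tau> \<cdot>\<^sub>m z - \<nu> \<cdot>\<^sub>m 1\<^sub>m ?m"
    using z by (auto simp: quadratic_mat_def)
  \<comment> \<open>Column \<open>Suc k\<close> is column 0 of \<open>z\<close>. A middle column is
    the unit vector minus the multiple of the first one for which its image under \<open>z\<close>
    has last coordinate 0.\<close>
  define b where "b = mat ?m ?m (\<lambda>(i, j). if j = Suc k then z $$ (i, 0)
    else if i = j then 1 else if i = 0 then - (z $$ (Suc k, j) / ?\<alpha>) else 0)"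
  have bc: "b \<in> carrier_mat ?m ?m"
    by (simp add: b_def)
  have band: "band ?m 0 b"
    by (auto simp: band_def b_def)
  have "upper_triangular b"
    using band band_upper_triangular[OF bc] by simp
  then have "det b = (\<Prod>i = 0..<?m. b $$ (i, i))"
    using det_upper_triangular[of b ?m] bc prod_list_diag_prod[of b] by simp
  also have "\<dots> \<noteq> 0"
    using \<alpha> by (auto simp: b_def)
  finally have db: "det b \<noteq> 0" .
  define b' where "b' = inverse (det b) \<cdot>\<^sub>m adj_mat b"
  have b'c: "b' \<in> carrier_mat ?m ?m"
    using adj_mat(1)[OF bc] by (simp add: b'_def)
  have bb': "b * b' = 1\<^sub>m ?m"
    unfolding b'_def using adj_mat(1,2)[OF bc] bc db
    by (simp add: mult_smult_distrib[of _ ?m ?m _ ?m] smult_smult_mat one_smult_mat)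
  have b'b: "b' * b = 1\<^sub>m ?m"
    using mat_mult_left_right_inverse[OF bc b'c bb'] .
  define Y where "Y = b' * z * b"
  have Yc: "Y \<in> carrier_mat ?m ?m"
    using b'c bc zc by (simp add: Y_def)
  have "b * Y * b' = (b * b') * z * (b * b')"
    unfolding Y_def using b'c bc zc by (simp add: assoc_mult_mat[of _ ?m ?m _ ?m _ ?m])
  then have z_eq: "z = b * Y * b'"
    using bb' zc by simp
  have "b * Y = (b * b') * (z * b)"
    unfolding Y_def using b'c bc zc by (simp add: assoc_mult_mat[of _ ?m ?m _ ?m _ ?m])
  then have bY: "b * Y = z * b"
    using bb' zc bc by simp
  have "Y \<in> gl_orbit ?m z"
    unfolding Y_def by (rule gl_orbitI[OF b'c bc b'b])
  then have "quadratic_mat ?m \<tau> \<nu> Y"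
    using quadratic_gl_orbit[OF z] by blast
  then have YY: "Y * Y = \<tau> \<cdot>\<^sub>m Y - \<nu> \<cdot>\<^sub>m 1\<^sub>m ?m"
    by (simp add: quadratic_mat_def)
  have prod_entry: "(M * N) $$ (i, j) = M $$ (i, 0) * N $$ (0, j) + (\<Sum>l = 0..<k. M $$ (i, Suc l) * N $$ (Suc l, j))
      + M $$ (i, Suc k) * N $$ (Suc k, j)"
    if "M \<in> carrier_mat ?m ?m" "N \<in> carrier_mat ?m ?m" "i < ?m" "j < ?m" for M N :: "'a mat" and i j
    unfolding sum_frame[symmetric, of "\<lambda>l. M $$ (i, l) * N $$ (l, j)"] using that by (simp add: scalar_prod_def)
  have col0: "Y $$ (i, 0) = (if i = Suc k then 1 else 0)" if i: "i < ?m" for i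
  proof -
    have zb: "(z * b) $$ (l, 0) = b $$ (l, Suc k)" if "l < ?m" for l
      using that by (subst prod_entry[OF zc bc]) (auto simp: b_def)
    have "Y = b' * (z * b)"
      unfolding Y_def using b'c bc zc by (simp add: assoc_mult_mat[of _ ?m ?m _ ?m _ ?m])
    then have "Y $$ (i, 0) = (b' * b) $$ (i, Suc k)"
      using i b'c bc zc mult_carrier_mat[OF zc bc]
      by (simp add: prod_entry[OF b'c mult_carrier_mat[OF zc bc]] prod_entry[OF b'c bc] zb del: index_mult_mat(1))
    then show ?thesis
      using b'b i by simp
  qed
  \<comment> \<open>The last row of \<open>b\<close> is \<open>?\<alpha>\<close> times the last
    coordinate form, so the last row of \<open>Y\<close> lists the last coordinates of the images of
    the new basis, divided by \<open>?\<alpha>\<close>. The entry \<open>\<tau>\<close> comes from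
    the corner of \<open>z * z\<close>, where the identity contributes nothing.\<close>
  have rowk: "Y $$ (Suc k, j) = (if j = 0 then 1 else if j = Suc k then \<tau> else 0)" if j: "j < ?m" for j
  proof -
    have "?\<alpha> * Y $$ (Suc k, j) = (b * Y) $$ (Suc k, j)"
      using j by (subst prod_entry[OF bc Yc]) (auto simp: b_def)
    also have "\<dots> = (z * b) $$ (Suc k, j)"
      by (simp only: bY)
    also have "\<dots> = ?\<alpha> * (if j = 0 then 1 else if j = Suc k then \<tau> else 0)"
      using j
    proof (cases rule: frame_index_cases)
      case 1
      then show ?thesis
        by (subst prod_entry[OF zc bc]) (auto simp: b_def)
    next
      case 2
      have "(z * b) $$ (Suc k, Suc k) = (z * z) $$ (Suc k, 0)"
        by (simp add: prod_entry[OF zc bc] prod_entry[OF zc zc] del: index_mult_mat(1)) (simp add: b_def)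
      also have "\<dots> = ?\<alpha> * \<tau>"
        unfolding zz using zc by simp
      finally show ?thesis
        using 2 by simp
    next
      case (3 l)
      have "(\<Sum>l' = 0..<k. z $$ (Suc k, Suc l') * b $$ (Suc l', Suc l)) = (\<Sum>l' = 0..<k. if l' = l then z $$ (Suc k, Suc l') else 0)"
        using 3 by (intro sum.cong) (auto simp: b_def)
      then show ?thesis
        using 3 \<alpha> by (subst prod_entry[OF zc bc]) (auto simp: b_def)
    qed
    finally show ?thesis
      using \<alpha> by simp
  qed
  have YY_entry: "(Y * Y) $$ (i, j) = \<tau> * Y $$ (i, j) - \<nu> * (if i = j then 1 else 0)" if "i < ?m" "j < ?m" for i j
    unfolding YY using that Yc by simp
  \<comment> \<open>The quadratic equation for \<open>Y\<close> determines the rest of the border: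
    the known first column turns \<open>Y * Y\<close> into the last column, and the known last row
    turns it into the first row plus a known term.\<close>
  have colk: "Y $$ (i, Suc k) = (if i = 0 then - \<nu> else if i = Suc k then \<tau> else 0)" if i: "i < ?m" for i
  proof -
    have "(Y * Y) $$ (i, 0) = Y $$ (i, Suc k)"
      using i by (subst prod_entry[OF Yc Yc]) (auto simp: col0)
    then show ?thesis
      using YY_entry[OF i, of 0] col0[OF i] by auto
  qed
  have row0: "Y $$ (0, j) = (if j = Suc k then - \<nu> else 0)" if j: "j < ?m" for j
  proof -
    have "(Y * Y) $$ (Suc k, j) = Y $$ (0, j) + \<tau> * Y $$ (Suc k, j)"
      using j by (subst prod_entry[OF Yc Yc]) (auto simp: rowk)
    then show ?thesis
      using YY_entry[OF _ j, of "Suc k"] by auto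
  qed
  define z' where "z' = mat k k (\<lambda>(i, j). Y $$ (Suc i, Suc j))"
  have z'c: "z' \<in> carrier_mat k k"
    by (simp add: z'_def)
  have Y_eq: "Y = frame_mat k 0 (- \<nu>) 1 \<tau> z'"
  proof (rule eq_matI)
    fix i j assume "i < dim_row (frame_mat k 0 (- \<nu>) 1 \<tau> z')" "j < dim_col (frame_mat k 0 (- \<nu>) 1 \<tau> z')"
    then have ij: "i < ?m" "j < ?m"
      by (simp_all add: frame_mat_def)
    show "Y $$ (i, j) = frame_mat k 0 (- \<nu>) 1 \<tau> z' $$ (i, j)"
      using ij(1)
    proof (cases rule: frame_index_cases)
      case 1
      show ?thesis
        using ij(2) by (cases rule: frame_index_cases) (simp_all add: 1 row0)
    next
      case 2
      show ?thesis
        using ij(2) by (cases rule: frame_index_cases) (simp_all add: 2 rowk)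
    next
      case (3 l)
      show ?thesis
        using ij(2) col0[OF ij(1)] colk[OF ij(1)]
        by (cases rule: frame_index_cases) (use 3 in \<open>simp_all add: z'_def\<close>)
    qed
  qed (use Yc in \<open>simp_all add: frame_mat_def\<close>)
  have "z' * z' = \<tau> \<cdot>\<^sub>m z' - \<nu> \<cdot>\<^sub>m 1\<^sub>m k"
  proof (rule eq_matI)
    fix i j assume "i < dim_row (\<tau> \<cdot>\<^sub>m z' - \<nu> \<cdot>\<^sub>m 1\<^sub>m k)" "j < dim_col (\<tau> \<cdot>\<^sub>m z' - \<nu> \<cdot>\<^sub>m 1\<^sub>m k)"
    then have ij: "i < k" "j < k" by auto
    have "(z' * z') $$ (i, j) = (Y * Y) $$ (Suc i, Suc j)"
      unfolding Y_eq frame_mat_mult[OF z'c z'c] using ij by (simp del: index_mult_mat(1))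
    also have "\<dots> = \<tau> * Y $$ (Suc i, Suc j) - \<nu> * (if i = j then 1 else 0)"
      using YY_entry ij by simp
    also have "\<dots> = (\<tau> \<cdot>\<^sub>m z' - \<nu> \<cdot>\<^sub>m 1\<^sub>m k) $$ (i, j)"
      using ij by (simp add: z'_def)
    finally show "(z' * z') $$ (i, j) = (\<tau> \<cdot>\<^sub>m z' - \<nu> \<cdot>\<^sub>m 1\<^sub>m k) $$ (i, j)" .
  qed (simp_all add: z'_def)
  then have "quadratic_mat k \<tau> \<nu> z'"
    using z'c by (simp add: quadratic_mat_def)
  with that band b'c bb' z_eq show ?thesis
    unfolding Y_eq by blast
qed

text \<open>The corner entry is the last coordinate form evaluated on the image of the first unit
  vector. If it vanished on the whole orbit, \<open>y\<close> would be scalar; matrices of size at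
  most 1 are scalar anyway.\<close>

lemma nonscalar_orbit_corner:
  fixes y :: "'a::alg_closed_field mat"
  assumes y: "y \<in> carrier_mat m m" and ns: "\<And>c. y \<noteq> c \<cdot>\<^sub>m 1\<^sub>m m"
  obtains k z where "m = Suc (Suc k)" "z \<in> gl_orbit m y" "z $$ (Suc k, 0) \<noteq> 0"
proof -
  have "\<exists>k. m = Suc (Suc k)"
  proof (rule ccontr)
    assume "\<nexists>k. m = Suc (Suc k)"
    then have "m = 0 \<or> m = Suc 0"
      by (metis not0_implies_Suc)
    then have "y = y $$ (0, 0) \<cdot>\<^sub>m 1\<^sub>m m"
      using y by (intro eq_matI) auto
    then show False
      using ns by blast
  qed
  then obtain k where k: "m = Suc (Suc k)"
    by blast
  have "\<exists>z\<in>gl_orbit m y. z $$ (Suc k, 0) \<noteq> 0"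
  proof (rule ccontr)
    assume 0: "\<not> ?thesis"
    have "unit_vec m (Suc k) \<bullet> (N *\<^sub>v unit_vec m 0) = 0" if N: "N \<in> gl_orbit m y" for N
    proof -
      have "N \<in> carrier_mat m m"
        using N gl_orbit_carrier[OF y] by blast
      then show ?thesis
        using 0 N k by simp
    qed
    then have "\<exists>c. y = c \<cdot>\<^sub>m 1\<^sub>m m"
      using k by (intro vanishing_conj_form_imp_scalar[OF y, of "unit_vec m (Suc k)" "unit_vec m 0"]) auto
    then show False
      using ns by blast
  qed
  with k that show ?thesis
    by blast
qed

lemma finite_quadratic_roots: "finite {c :: 'a::field. c * c = \<tau> * c - \<nu>}"
proof -
  have "[:\<nu>, - \<tau>, 1:] \<noteq> 0" by simp
  moreover have "{c. c * c = \<tau> * c - \<nu>} = {c. poly [:\<nu>, - \<tau>, 1:] c = 0}"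
    by (auto simp: algebra_simps)
  ultimately show ?thesis
    using poly_roots_finite[of "[:\<nu>, - \<tau>, 1:]"] by simp
qed

text \<open>
  That finitely many orbits suffice for all conjugacy classes of roots of a fixed quadratic
  polynomial is part of the induction: the blocks \<open>z'\<close> supplied by \<open>upper_normal_form\<close> for the
  points of one conjugacy class need not be known to be conjugate, but by irreducibility one of
  finitely many orbits is dense.
\<close>

lemma dense_upper_orbit:
  fixes \<tau> \<nu> :: "'a::alg_closed_field"
  shows "\<exists>X. finite X \<and> (\<forall>y. quadratic_mat m \<tau> \<nu> y \<longrightarrow> (\<exists>x\<in>X \<inter> gl_orbit m y.
    \<forall>f\<in>poly_funs m. (\<forall>z\<in>upper_orbit m x. f z = 0) \<longrightarrow> (\<forall>z\<in>gl_orbit m y. f z = 0)))"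
proof (induction m rule: less_induct)
  case (less m)
  let ?dense = "\<lambda>m x C. \<forall>f\<in>poly_funs m. (\<forall>z\<in>upper_orbit m x. f z = 0) \<longrightarrow> (\<forall>z\<in>C. f z = (0 :: 'a))"
  \<comment> \<open>The orbit of a scalar matrix is a single point. The identity is added for
    \<open>m = 0\<close>, where \<open>c\<close> need not be a root of the polynomial.\<close>
  define S where "S = insert (1\<^sub>m m) ((\<lambda>c. c \<cdot>\<^sub>m 1\<^sub>m m) ` {c. c * c = \<tau> * c - \<nu>})"
  have finS: "finite S"
    unfolding S_def using finite_quadratic_roots by blast
  have scalar: "\<exists>x\<in>S \<inter> gl_orbit m y. ?dense m x (gl_orbit m y)"
    if y: "quadratic_mat m \<tau> \<nu> y" and c: "y = c \<cdot>\<^sub>m 1\<^sub>m m" for y c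
  proof -
    have yc: "y \<in> carrier_mat m m" and yy: "y * y = \<tau> \<cdot>\<^sub>m y - \<nu> \<cdot>\<^sub>m 1\<^sub>m m"
      using y by (auto simp: quadratic_mat_def)
    have "y \<in> S"
    proof (cases "m = 0")
      case True
      then have "y = 1\<^sub>m m"
        using yc by (intro eq_matI) auto
      then show ?thesis
        by (simp add: S_def)
    next
      case False
      have "y * y = c \<cdot>\<^sub>m y"
        unfolding c by (simp add: mult_smult_assoc_mat[of _ m m _ m])
      then have "c * y $$ (0, 0) = \<tau> * y $$ (0, 0) - \<nu>"
        using arg_cong[OF yy, of "\<lambda>M. M $$ (0, 0)"] False yc by (simp del: index_mult_mat(1))
      then have "c * c = \<tau> * c - \<nu>"
        using False by (simp add: c)
      then show ?thesis
        by (auto simp: S_def c)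
    qed
    have "z = y" if z: "z \<in> gl_orbit m y" for z
    proof -
      obtain A B where AB: "A \<in> carrier_mat m m" "B \<in> carrier_mat m m" "A * B = 1\<^sub>m m" "z = A * y * B"
        using z unfolding gl_orbit_def by blast
      show ?thesis
        unfolding AB(4) c using AB(1-3)
        by (simp add: mult_smult_distrib[of _ m m _ m] mult_smult_assoc_mat[of _ m m _ m])
    qed
    moreover have "y \<in> upper_orbit m y"
      using upper_orbitI[of m "1\<^sub>m m" "1\<^sub>m m" y] yc by (simp add: band_def)
    ultimately have "?dense m y (gl_orbit m y)"
      by metis
    then show ?thesis
      using \<open>y \<in> S\<close> gl_orbit_self[OF yc] by blast
  qed
  show ?case
  proof (cases "\<exists>k. m = Suc (Suc k)")
    case False
    have "\<exists>c. y = c \<cdot>\<^sub>m 1\<^sub>m m" if y: "quadratic_mat m \<tau> \<nu> y" for y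
      using nonscalar_orbit_corner[of y m] that False by (auto simp: quadratic_mat_def)
    then show ?thesis
      using finS scalar by (intro exI[of _ S] conjI allI impI) meson+
  next
    case True
    then obtain k where m: "m = Suc (Suc k)"
      by blast
    obtain X where X: "finite X" and dense_X:
      "\<And>y. quadratic_mat k \<tau> \<nu> y \<Longrightarrow> \<exists>x\<in>X \<inter> gl_orbit k y. ?dense k x (gl_orbit k y)"
      using less.IH[of k] m by auto
    let ?F = "frame_mat k 0 (- \<nu>) 1 \<tau> :: 'a mat \<Rightarrow> 'a mat"
    have "\<exists>x\<in>?F ` X \<inter> gl_orbit m y. ?dense m x (gl_orbit m y)"
      if y: "quadratic_mat m \<tau> \<nu> y" and ns: "\<And>c. y \<noteq> c \<cdot>\<^sub>m 1\<^sub>m m" for y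
    proof (rule ccontr)
      assume contra: "\<not> ?thesis"
      let ?C = "gl_orbit m y"
      define I where "I = ?F ` X \<inter> ?C"
      have yc: "y \<in> carrier_mat m m"
        using y by (simp add: quadratic_mat_def)
      \<comment> \<open>If no candidate has a dense orbit, each has a function that vanishes on its
        orbit but not on the class. The product of these functions and the corner entry will vanish
        on the class, against irreducibility.\<close>
      have "\<forall>x\<in>I. \<exists>f. f \<in> poly_funs m \<and> (\<forall>z\<in>upper_orbit m x. f z = 0) \<and> \<not> (\<forall>z\<in>?C. f z = 0)"
        using contra unfolding I_def by blast
      then obtain f where f: "\<And>x. x \<in> I \<Longrightarrow> f x \<in> poly_funs m"
        "\<And>x z. x \<in> I \<Longrightarrow> z \<in> upper_orbit m x \<Longrightarrow> f x z = 0"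
        "\<And>x. x \<in> I \<Longrightarrow> \<not> (\<forall>z\<in>?C. f x z = 0)"
        by metis
      have finI: "finite I"
        using X by (simp add: I_def)
      have irr: "irreducible_set m ?C"
        by (rule irreducible_gl_orbit[OF yc])
      have "z $$ (Suc k, 0) * (\<Prod>x\<in>I. f x z) = 0" if z: "z \<in> ?C" for z
      proof (cases "z $$ (Suc k, 0) = 0")
        case False
        have "quadratic_mat (Suc (Suc k)) \<tau> \<nu> z"
          using quadratic_gl_orbit[OF y z] m by simp
        then obtain b b' z' where b: "band m 0 b" "b' \<in> carrier_mat m m" "b * b' = 1\<^sub>m m"
          and z': "quadratic_mat k \<tau> \<nu> z'" and z_eq: "z = b * ?F z' * b'"
          using upper_normal_form[of k \<tau> \<nu> z] False m by metis
        have bc: "b \<in> carrier_mat m m"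
          using b by (simp add: band_def)
        have z'c: "z' \<in> carrier_mat k k"
          using z' by (simp add: quadratic_mat_def)
        have Fc: "?F u \<in> carrier_mat m m" for u
          using m by simp
        obtain x' where x': "x' \<in> X" "x' \<in> gl_orbit k z'" "?dense k x' (gl_orbit k z')"
          using dense_X[OF z'] by blast
        have x'c: "x' \<in> carrier_mat k k"
          using x'(2) gl_orbit_carrier[OF z'c] by blast
        have "b * ?F z' * b' \<in> ?C"
          using z z_eq by simp
        moreover have "?F x' \<in> gl_orbit m (?F z')"
          unfolding m by (rule frame_mat_gl_orbit[OF z'c x'(2)])
        moreover have "?F z' \<in> gl_orbit m (b * ?F z' * b')"
          by (rule gl_orbit_sym[OF Fc gl_orbitI[OF bc b(2,3)]])
        \<comment> \<open>The candidate depends on the point \<open>z\<close>, but it is conjugate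
          to \<open>z\<close> and thus one of the finitely many in \<open>I\<close>.\<close>
        ultimately have "?F x' \<in> ?C"
          using gl_orbit_trans[OF yc] gl_orbit_trans[of "b * ?F z' * b'" m "?F z'" "?F x'"]
            gl_orbit_carrier[OF yc] by blast
        then have xI: "?F x' \<in> I"
          using x'(1) by (simp add: I_def)
        \<comment> \<open>Pulled back along the map that sends \<open>u\<close> to
          \<open>b * ?F u * b'\<close>, the function vanishes on the triangular orbit of
          \<open>x'\<close>. That orbit is dense in the class of \<open>z'\<close>, so the function
          vanishes at \<open>z'\<close>, which is mapped to \<open>z\<close>.\<close>
        have "(\<lambda>u. f (?F x') (b * ?F u * b')) \<in> regular_funs k"
          using f(1)[OF xI] m regular_frame_mat[of k 0 "- \<nu>" 1 \<tau>] bc b(2)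
          by (intro Mat.regular_comp[of _ m] Mat.regular_mult Mat.regular_const) auto
        then obtain h where h: "h \<in> poly_funs k" "\<And>u. u \<in> carrier_mat k k \<Longrightarrow> h u = f (?F x') (b * ?F u * b')"
          using regular_funsE by blast
        have "h u = 0" if u: "u \<in> upper_orbit k x'" for u
        proof -
          have "u \<in> carrier_mat k k"
            using u upper_orbit_subset_gl_orbit gl_orbit_carrier[OF x'c] by blast
          moreover have "?F u \<in> upper_orbit m (?F x')"
            unfolding m by (rule frame_mat_upper_orbit[OF x'c u])
          then have "b * ?F u * b' \<in> upper_orbit m (?F x')"
            by (rule upper_orbit_conj[OF Fc _ b])
          ultimately show ?thesis
            using f(2)[OF xI] h(2) by simp
        qed
        then have "h z' = 0"
          using x'(3) h(1) gl_orbit_self[OF z'c] by blast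
        then have "f (?F x') z = 0"
          using h(2)[OF z'c] z_eq by simp
        then show ?thesis
          using xI finI by auto
      qed simp
      moreover have "(\<lambda>z. z $$ (Suc k, 0)) \<in> poly_funs m"
        using m by (intro poly_funs.entry) auto
      moreover have prod_poly: "(\<lambda>z. \<Prod>x\<in>I. f x z) \<in> poly_funs m"
        using finI f(1) by (induction I rule: finite_induct) (auto intro: poly_funs.const poly_funs.mult)
      ultimately have "(\<forall>z\<in>?C. z $$ (Suc k, 0) = 0) \<or> (\<forall>z\<in>?C. (\<Prod>x\<in>I. f x z) = 0)"
        using irr[unfolded irreducible_set_def, rule_format, of "\<lambda>z. z $$ (Suc k, 0)" "\<lambda>z. \<Prod>x\<in>I. f x z"]
        by auto
      moreover have "\<not> (\<forall>z\<in>?C. z $$ (Suc k, 0) = 0)"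
        using nonscalar_orbit_corner[OF yc ns] m by (metis Suc_inject)
      ultimately have "\<forall>z\<in>?C. (\<Prod>x\<in>I. f x z) = 0"
        by blast
      then have "\<exists>x\<in>I. \<forall>z\<in>?C. f x z = 0"
        using gl_orbit_self[OF yc] f(1) by (intro irreducible_set_prod[OF irr finI]) auto
      then show False
        using f(3) by blast
    qed
    note nonscalar = this
    show ?thesis
    proof (intro exI[of _ "S \<union> ?F ` X"] conjI allI impI)
      show "finite (S \<union> ?F ` X)"
        using finS X by simp
      fix y assume y: "quadratic_mat m \<tau> \<nu> y"
      have "\<exists>x\<in>S \<union> ?F ` X. x \<in> gl_orbit m y \<and> ?dense m x (gl_orbit m y)"
      proof (cases "\<exists>c. y = c \<cdot>\<^sub>m 1\<^sub>m m")
        case True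
        then obtain c where "y = c \<cdot>\<^sub>m 1\<^sub>m m" ..
        from scalar[OF y this] obtain x where "x \<in> S \<inter> gl_orbit m y" "?dense m x (gl_orbit m y)"
          by (rule bexE)
        then show ?thesis
          by (intro bexI[of _ x]) simp_all
      next
        case False
        then have "y \<noteq> c \<cdot>\<^sub>m 1\<^sub>m m" for c
          by simp
        from nonscalar[OF y this] obtain x where "x \<in> ?F ` X \<inter> gl_orbit m y" "?dense m x (gl_orbit m y)"
          by (rule bexE)
        then show ?thesis
          by (intro bexI[of _ x]) simp_all
      qed
      then show "\<exists>x\<in>(S \<union> ?F ` X) \<inter> gl_orbit m y. ?dense m x (gl_orbit m y)"
        by (simp add: Bex_def conj_assoc)
    qed
  qed
qed

section \<open>Jordan decompositions of roots of a quadratic polynomial\<close>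

theorem quadratic_imp_spherical:
  fixes g :: "'a::alg_closed_field mat"
  assumes m: "m \<ge> 1" and g: "quadratic_mat m \<tau> \<nu> g"
  shows "spherical m (SL m) (conjugacy_class (SL m) g)"
proof -
  have gc: "g \<in> carrier_mat m m"
    using g by (simp add: quadratic_mat_def)
  obtain X where "\<And>y. quadratic_mat m \<tau> \<nu> y \<Longrightarrow> \<exists>x\<in>X \<inter> gl_orbit m y.
      \<forall>f\<in>poly_funs m. (\<forall>z\<in>upper_orbit m x. f z = 0) \<longrightarrow> (\<forall>z\<in>gl_orbit m y. f z = 0)"
    using dense_upper_orbit[of m \<tau> \<nu>] by auto
  from this[OF g] obtain x where x: "x \<in> gl_orbit m g"
    and dense: "\<forall>f\<in>poly_funs m. (\<forall>z\<in>upper_orbit m x. f z = 0) \<longrightarrow> (\<forall>z\<in>gl_orbit m g. f z = 0)"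
    by (elim bexE IntE)
  have xc: "x \<in> carrier_mat m m"
    using x gl_orbit_carrier[OF gc] by blast
  have "upper_orbit m x \<subseteq> gl_orbit m g"
    using upper_orbit_subset_gl_orbit gl_orbit_trans[OF gc x] by blast
  then have "Abstract_Topology.closure_of (subtopology (zariski m) (gl_orbit m g)) (upper_orbit m x) = gl_orbit m g"
    using closure_of_zariski_eq_iff[OF _ gl_orbit_carrier[OF gc]] dense by blast
  then show ?thesis
    unfolding spherical_def conjugacy_class_SL[OF m gc]
    using Borel_subgroup_upper_SL[OF m] conjugates_upper_SL[OF m xc] x by metis
qed

section \<open>Similarity and the Jordan form of roots of \<open>(X - 1)^2\<close>\<close>

lemma gl_orbit_iff_similar_mat:
  assumes "x \<in> carrier_mat m m"
  shows "y \<in> gl_orbit m x \<longleftrightarrow> similar_mat y x"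
proof
  assume "y \<in> gl_orbit m x"
  then obtain A B where AB: "A \<in> carrier_mat m m" "B \<in> carrier_mat m m" "A * B = 1\<^sub>m m" "y = A * x * B"
    unfolding gl_orbit_def by blast
  then show "similar_mat y x"
    using mat_mult_left_right_inverse[OF AB(1-3)] assms by (intro similar_matI[of y x A B m]) auto
next
  assume "similar_mat y x"
  then obtain n P Q where PQ: "{y, x, P, Q} \<subseteq> carrier_mat n n" "P * Q = 1\<^sub>m n" "y = P * x * Q"
    using similar_matD by blast
  then have "n = m"
    using assms by auto
  then show "y \<in> gl_orbit m x"
    using PQ gl_orbitI by auto
qed

lemma similar_mat_dim:
  assumes "similar_mat A B"
  shows "dim_row A = dim_row B"
proof -
  obtain n P Q where "{A, B, P, Q} \<subseteq> carrier_mat n n"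
    using similar_matD[OF assms] by blast
  then show ?thesis
    by auto
qed

lemma similar_mat_permute:
  fixes A :: "'a::field mat"
  assumes A: "A \<in> carrier_mat m m" and \<sigma>: "inj_on \<sigma> {0..<m}" "\<sigma> ` {0..<m} \<subseteq> {0..<m}"
  shows "similar_mat (mat m m (\<lambda>(i, j). A $$ (\<sigma> i, \<sigma> j))) A"
proof -
  define P where "P = (mat m m (\<lambda>(i, j). if \<sigma> i = j then 1 else 0) :: 'a mat)"
  define Q where "Q = (mat m m (\<lambda>(i, j). if \<sigma> j = i then 1 else 0) :: 'a mat)"
  have c: "P \<in> carrier_mat m m" "Q \<in> carrier_mat m m"
    by (simp_all add: P_def Q_def)
  have \<sigma>m: "\<sigma> i < m" if "i < m" for i
    using \<sigma>(2) that by (simp add: image_subset_iff)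
  have PA: "(P * M) $$ (i, j) = M $$ (\<sigma> i, j)" if "M \<in> carrier_mat m m" "i < m" "j < m" for M i j
  proof -
    have "(P * M) $$ (i, j) = (\<Sum>l\<in>{0..<m}. P $$ (i, l) * M $$ (l, j))"
      using that c by (simp add: scalar_prod_def)
    also have "\<dots> = (\<Sum>l\<in>{0..<m}. if l = \<sigma> i then M $$ (l, j) else 0)"
      using that by (intro sum.cong) (auto simp: P_def)
    finally show ?thesis
      using \<sigma>m that by simp
  qed
  have AQ: "(M * Q) $$ (i, j) = M $$ (i, \<sigma> j)" if "M \<in> carrier_mat m m" "i < m" "j < m" for M i j
  proof -
    have "(M * Q) $$ (i, j) = (\<Sum>l\<in>{0..<m}. M $$ (i, l) * Q $$ (l, j))"
      using that c by (simp add: scalar_prod_def)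
    also have "\<dots> = (\<Sum>l\<in>{0..<m}. if l = \<sigma> j then M $$ (i, l) else 0)"
      using that by (intro sum.cong) (auto simp: Q_def)
    finally show ?thesis
      using \<sigma>m that by simp
  qed
  have PQ: "P * Q = 1\<^sub>m m"
  proof (rule eq_matI)
    fix i j assume "i < dim_row (1\<^sub>m m :: 'a mat)" "j < dim_col (1\<^sub>m m :: 'a mat)"
    then have ij: "i < m" "j < m" by auto
    have "(P * Q) $$ (i, j) = Q $$ (\<sigma> i, j)"
      by (rule PA[OF c(2) ij])
    also have "\<dots> = (if \<sigma> j = \<sigma> i then 1 else 0)"
      using \<sigma>m ij by (simp add: Q_def)
    also have "\<dots> = 1\<^sub>m m $$ (i, j)"
      using inj_on_eq_iff[OF \<sigma>(1), of j i] ij by auto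
    finally show "(P * Q) $$ (i, j) = 1\<^sub>m m $$ (i, j)" .
  qed (use c in auto)
  have "mat m m (\<lambda>(i, j). A $$ (\<sigma> i, \<sigma> j)) = P * A * Q"
  proof (rule eq_matI)
    fix i j assume "i < dim_row (P * A * Q)" "j < dim_col (P * A * Q)"
    then have ij: "i < m" "j < m" using c by auto
    have "(P * A * Q) $$ (i, j) = (P * A) $$ (i, \<sigma> j)"
      by (rule AQ[OF mult_carrier_mat[OF c(1) A] ij])
    also have "\<dots> = A $$ (\<sigma> i, \<sigma> j)"
      by (rule PA[OF A ij(1) \<sigma>m[OF ij(2)]])
    finally show "mat m m (\<lambda>(i, j). A $$ (\<sigma> i, \<sigma> j)) $$ (i, j) = (P * A * Q) $$ (i, j)"
      using ij by simp
  qed (use c in auto)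
  then have "mat m m (\<lambda>(i, j). A $$ (\<sigma> i, \<sigma> j)) \<in> gl_orbit m A"
    using gl_orbitI[OF c PQ, of A] by simp
  then show ?thesis
    using gl_orbit_iff_similar_mat[OF A] by blast
qed

text \<open>The framing block is the companion matrix of \<open>(X - 1)^2\<close>, which is similar
  to a Jordan block of size 2 in every characteristic.\<close>

lemma frame_mat_similar_jordan:
  fixes z :: "'a::field mat"
  assumes z: "z \<in> carrier_mat k k"
  shows "similar_mat (frame_mat k 0 (- 1) 1 2 z) (four_block_mat (jordan_block 2 1) (0\<^sub>m 2 k) (0\<^sub>m k 2) z)"
proof -
  let ?m = "Suc (Suc k)"
  \<comment> \<open>\<open>?P\<close> and \<open>?Q\<close> are inverse to each other and carry the
    Jordan block on the first and last coordinates to the companion block.\<close>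
  let ?P = "frame_mat k (- 1) 1 1 0 (1\<^sub>m k) :: 'a mat" and ?Q = "frame_mat k 0 1 1 1 (1\<^sub>m k) :: 'a mat"
  let ?J = "frame_mat k 1 1 0 1 z"
  have "?P * ?Q = 1\<^sub>m ?m"
    using frame_mat_one[of k] by (simp add: frame_mat_mult)
  moreover have "?P * ?J * ?Q = frame_mat k 0 (- 1) 1 2 z"
    using z by (simp add: frame_mat_mult)
  ultimately have "frame_mat k 0 (- 1) 1 2 z \<in> gl_orbit ?m ?J"
    using gl_orbitI[of ?P ?m ?Q ?J] by simp
  then have 1: "similar_mat (frame_mat k 0 (- 1) 1 2 z) ?J"
    using gl_orbit_iff_similar_mat[of ?J ?m] by simp
  \<comment> \<open>The permutation brings the last coordinate to the second place, so that the
    frame becomes a leading block.\<close>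
  define \<sigma> where "\<sigma> i = (if i = 0 then 0 else if i = 1 then Suc k else i - 1)" for i
  have "similar_mat (mat ?m ?m (\<lambda>(i, j). ?J $$ (\<sigma> i, \<sigma> j))) ?J"
    by (rule similar_mat_permute) (auto simp: inj_on_def \<sigma>_def split: if_splits)
  also have "mat ?m ?m (\<lambda>(i, j). ?J $$ (\<sigma> i, \<sigma> j)) = four_block_mat (jordan_block 2 1) (0\<^sub>m 2 k) (0\<^sub>m k 2) z"
    (is "?L = ?R")
  proof (rule eq_matI)
    fix i j assume "i < dim_row ?R" "j < dim_col ?R"
    then have ij: "i < ?m" "j < ?m"
      using z by simp_all
    consider "i = 0" | "i = 1" | i' where "i = Suc (Suc i')" "i' < k"
      using ij(1) by (metis One_nat_def Suc_less_SucD not0_implies_Suc)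
    then show "?L $$ (i, j) = ?R $$ (i, j)"
    proof cases
      case 1
      then show ?thesis
        using ij z by (auto simp: \<sigma>_def frame_mat_def)
    next
      case 2
      then show ?thesis
        using ij z by (auto simp: \<sigma>_def frame_mat_def)
    next
      case 3
      then show ?thesis
        using ij z by (auto simp: \<sigma>_def frame_mat_def numeral_2_eq_2)
    qed
  qed (use z in auto)
  finally show ?thesis
    using 1 similar_mat_sym similar_mat_trans by blast
qed

lemma jordan_matrix_replicate_one: "jordan_matrix (replicate m (1, 1)) = (1\<^sub>m m :: 'a::comm_ring_1 mat)"
proof (induction m)
  case 0
  then show ?case
    by (auto simp: jordan_matrix_def intro!: eq_matI)
next
  case (Suc m)
  then show ?case
    by (auto simp: jordan_matrix_Cons sum_list_replicate intro!: eq_matI)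
qed

text \<open>The normal form behind the dense orbits also computes the Jordan form: a nonscalar
  matrix splits off a Jordan block of size 2, and a scalar \<open>c\<close> with
  \<open>(c - 1)^2 = 0\<close> is 1.\<close>

lemma quadratic_unipotent_jordan_nf:
  fixes u :: "'a::alg_closed_field mat"
  assumes "quadratic_mat m 2 1 u"
  shows "\<exists>bs. jordan_nf u bs \<and> (\<forall>(d, a)\<in>set bs. d \<le> 2)"
  using assms
proof (induction m arbitrary: u rule: less_induct)
  case (less m)
  have uc: "u \<in> carrier_mat m m" and uu: "u * u = 2 \<cdot>\<^sub>m u - 1 \<cdot>\<^sub>m 1\<^sub>m m"
    using less.prems by (auto simp: quadratic_mat_def)
  show ?case
  proof (cases "\<exists>c. u = c \<cdot>\<^sub>m 1\<^sub>m m")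
    case True
    then obtain c where c: "u = c \<cdot>\<^sub>m 1\<^sub>m m" ..
    have "u = 1\<^sub>m m"
    proof (cases "m = 0")
      case True
      then show ?thesis
        using uc by (intro eq_matI) auto
    next
      case False
      have "u * u = c \<cdot>\<^sub>m u"
        unfolding c by (simp add: mult_smult_assoc_mat[of _ m m _ m])
      then have "c * u $$ (0, 0) = 2 * u $$ (0, 0) - 1"
        using arg_cong[OF uu, of "\<lambda>M. M $$ (0, 0)"] False uc by (simp del: index_mult_mat(1))
      then have "(c - 1) * (c - 1) = 0"
        using False by (simp add: c algebra_simps)
      then show ?thesis
        by (simp add: c one_smult_mat)
    qed
    then have "jordan_nf u (replicate m (1, 1))"
      unfolding jordan_nf_def jordan_matrix_replicate_one using similar_mat_refl[of u m] uc by auto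
    then show ?thesis
      by (intro exI[of _ "replicate m (1, 1)"]) auto
  next
    case False
    then obtain k y where m: "m = Suc (Suc k)" and y: "y \<in> gl_orbit m u" "y $$ (Suc k, 0) \<noteq> 0"
      using nonscalar_orbit_corner[OF uc] by blast
    have "quadratic_mat (Suc (Suc k)) 2 1 y"
      using quadratic_gl_orbit[OF less.prems y(1)] m by simp
    then obtain b b' z where b: "band m 0 b" "b' \<in> carrier_mat m m" "b * b' = 1\<^sub>m m"
      and z: "quadratic_mat k 2 1 z" and y_eq: "y = b * frame_mat k 0 (- 1) 1 2 z * b'"
      using upper_normal_form[of k 2 1 y] y(2) m by metis
    have zc: "z \<in> carrier_mat k k"
      using z by (simp add: quadratic_mat_def)
    obtain bs where bs: "jordan_nf z bs" "\<forall>(d, a)\<in>set bs. d \<le> 2"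
      using less.IH[of k z] z m by auto
    then have sim: "similar_mat z (jordan_matrix bs)" and nz: "0 \<notin> fst ` set bs"
      by (auto simp: jordan_nf_def)
    have k_eq: "k = sum_list (map fst bs)"
      using similar_mat_dim[OF sim] zc by simp
    have "similar_mat u y"
      using gl_orbit_iff_similar_mat[OF uc] y(1) similar_mat_sym by blast
    moreover have "similar_mat y (frame_mat k 0 (- 1) 1 2 z)"
      using gl_orbitI[of b m b' "frame_mat k 0 (- 1) 1 2 z"] b gl_orbit_iff_similar_mat[of "frame_mat k 0 (- 1) 1 2 z" m] m
      by (simp add: y_eq band_def)
    moreover note frame_mat_similar_jordan[OF zc]
    moreover have "similar_mat (four_block_mat (jordan_block 2 1) (0\<^sub>m 2 k) (0\<^sub>m k 2) z)
        (four_block_mat (jordan_block 2 1) (0\<^sub>m 2 k) (0\<^sub>m k 2) (jordan_matrix bs))"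
      by (rule similar_mat_four_block_0_0[OF similar_mat_refl[of _ 2] sim _ zc]) auto
    ultimately have "similar_mat u (jordan_matrix ((2, 1) # bs))"
      unfolding jordan_matrix_Cons k_eq[symmetric] using similar_mat_trans by blast
    then have "jordan_nf u ((2, 1) # bs)"
      using nz by (simp add: jordan_nf_def)
    then show ?thesis
      using bs(2) by (intro exI[of _ "(2, 1) # bs"]) auto
  qed
qed

section \<open>Unipotent, central and semisimple matrices\<close>

lemma unipotent_eigenvalue:
  fixes u :: "'a::field mat"
  assumes u: "unipotent_mat u" "u \<in> carrier_mat m m" and x: "x \<in> carrier_vec m" "x \<noteq> 0\<^sub>v m"
    and ux: "u *\<^sub>v x = c \<cdot>\<^sub>v x"
  shows "c = 1"
proof -
  let ?N = "u - 1\<^sub>m m"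
  obtain k where k: "?N ^\<^sub>m k = 0\<^sub>m m m"
    using u by (auto simp: unipotent_mat_def)
  have "?N *\<^sub>v x = (c - 1) \<cdot>\<^sub>v x"
    using u x ux by (simp add: minus_mult_distrib_mat_vec[of _ m m]) (auto intro!: eq_vecI simp: algebra_simps)
  then have "eigenvector ?N x (c - 1)"
    using x u by (simp add: eigenvector_def)
  then have eq: "0\<^sub>m m m *\<^sub>v x = (c - 1) ^ k \<cdot>\<^sub>v x"
    using eigenvector_pow[of ?N m x "c - 1" k] u k by (simp add: minus_carrier_mat[of _ m m])
  obtain i where i: "i < m" "x $ i \<noteq> 0"
    using x by (metis carrier_vecD eq_vecI index_zero_vec)
  have "0 = (0\<^sub>m m m *\<^sub>v x) $ i"
    using i x by simp
  also have "\<dots> = (c - 1) ^ k * x $ i"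
    unfolding eq using i x by simp
  finally have "(c - 1) ^ k = 0"
    using i by simp
  then show ?thesis
    by simp
qed

text \<open>Commuting with the transvections \<open>1 + E_ij\<close> kills the off-diagonal entries
  and equates the diagonal ones.\<close>

lemma central_imp_scalar:
  fixes s :: "'a::field mat"
  assumes "s \<in> group_center (SL m)"
  shows "\<exists>c. s = c \<cdot>\<^sub>m 1\<^sub>m m"
proof -
  have sc: "s \<in> carrier_mat m m" and comm: "\<And>h. h \<in> carrier (SL m) \<Longrightarrow> s * h = h * s"
    using assms by (auto simp: group_center_def SL_carrier_iff)
  have eq: "s $$ (j, i) = 0" "s $$ (j, j) = s $$ (i, i)" if ij: "i \<noteq> j" "i < m" "j < m" for i j
  proof -
    have c: "addrow_mat m c i j \<in> carrier_mat m m" for c :: 'a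
      by simp
    have "addrow_mat m 1 i j \<in> carrier (SL m)"
      using ij by (simp add: SL_carrier_iff det_addrow_mat)
    from comm[OF this] have "addrow_mat m 1 i j * s * addrow_mat m (- 1) i j = s * addrow_mat m 1 i j * addrow_mat m (- 1) i j"
      by (rule arg_cong[OF sym])
    also have "\<dots> = s"
      using addrow_mat_inv[of i m j "1 :: 'a"] ij sc by (simp add: assoc_mult_mat[OF sc c c])
    finally have "s $$ (a, b) = s $$ (a, b) + 1 * ((if a = i then s $$ (j, b) else 0) - (if b = j then s $$ (a, i) else 0))
        - 1 * 1 * (if a = i \<and> b = j then s $$ (j, i) else 0)" if "a < m" "b < m" for a b
      using addrow_conj_index[OF sc ij that, of 1] by simp
    \<comment> \<open>Entry \<open>(i, i)\<close> gives \<open>s $$ (j, i) = 0\<close>; with this,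
      entry \<open>(i, j)\<close> gives the equality of the diagonal entries.\<close>
    from this[of i i] this[of i j] show "s $$ (j, i) = 0" "s $$ (j, j) = s $$ (i, i)"
      using ij by auto
  qed
  have "s = s $$ (0, 0) \<cdot>\<^sub>m 1\<^sub>m m"
  proof (rule eq_matI)
    fix i j assume "i < dim_row (s $$ (0, 0) \<cdot>\<^sub>m 1\<^sub>m m)" "j < dim_col (s $$ (0, 0) \<cdot>\<^sub>m 1\<^sub>m m)"
    then have "i < m" "j < m" by auto
    then show "s $$ (i, j) = (s $$ (0, 0) \<cdot>\<^sub>m 1\<^sub>m m) $$ (i, j)"
      using eq(1)[of j i] eq(2)[of 0 i] by (cases "i = 0") auto
  qed (use sc in auto)
  then show ?thesis
    by blast
qed

lemma scalar_central:
  fixes s :: "'a::field mat"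
  assumes "s \<in> carrier (SL m)" "s = c \<cdot>\<^sub>m 1\<^sub>m m"
  shows "s \<in> group_center (SL m)"
  using assms(1) unfolding group_center_def assms(2)
  by (auto simp: SL_carrier_iff mult_smult_distrib[of _ m m _ m] mult_smult_assoc_mat[of _ m m _ m])

lemma quadratic_jordan_block: "d \<le> 2 \<Longrightarrow> quadratic_mat d 2 1 (jordan_block d (1 :: 'a::field))"
proof -
  assume "d \<le> 2"
  then consider "d = 0" | "d = 1" | "d = 2" by linarith
  then show ?thesis
    by cases (auto simp: quadratic_mat_def scalar_prod_def numeral_2_eq_2 less_Suc_eq intro!: eq_matI)
qed

lemma quadratic_four_block:
  fixes A B :: "'a::field mat"
  assumes A: "quadratic_mat n \<tau> \<nu> A" and B: "quadratic_mat k \<tau> \<nu> B"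
  shows "quadratic_mat (n + k) \<tau> \<nu> (four_block_mat A (0\<^sub>m n k) (0\<^sub>m k n) B)"
proof -
  have c: "A \<in> carrier_mat n n" "B \<in> carrier_mat k k"
    and sq: "A * A = \<tau> \<cdot>\<^sub>m A - \<nu> \<cdot>\<^sub>m 1\<^sub>m n" "B * B = \<tau> \<cdot>\<^sub>m B - \<nu> \<cdot>\<^sub>m 1\<^sub>m k"
    using A B by (auto simp: quadratic_mat_def)
  let ?M = "four_block_mat A (0\<^sub>m n k) (0\<^sub>m k n) B"
  have "?M * ?M = four_block_mat (A * A) (0\<^sub>m n k) (0\<^sub>m k n) (B * B)"
    using c by (subst mult_four_block_mat[of _ n n _ k _ k _ _ n _ k]) auto
  also have "\<dots> = \<tau> \<cdot>\<^sub>m ?M - \<nu> \<cdot>\<^sub>m 1\<^sub>m (n + k)"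
    unfolding sq using c by (intro eq_matI) auto
  finally show ?thesis
    using c by (auto simp: quadratic_mat_def)
qed

lemma jordan_nf_eigenvalue:
  fixes A :: "'a::field mat"
  assumes A: "A \<in> carrier_mat n n" and jnf: "jordan_nf A bs" and da: "(d, a) \<in> set bs"
  shows "eigenvalue A a"
proof -
  have "d \<noteq> 0"
    using jnf da by (force simp: jordan_nf_def)
  then have "poly ([:- a, 1:] ^ d) a = 0"
    by (simp add: poly_power)
  then have "poly (\<Prod>(n, a)\<leftarrow>bs. [:- a, 1:] ^ n) a = 0"
    using da by (induction bs) auto
  then show ?thesis
    using eigenvalue_root_char_poly[OF A] jordan_nf_char_poly[OF jnf] by simp
qed

text \<open>\<open>jordan_nf\<close> does not prescribe the eigenvalues in \<open>bs\<close>;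
  unipotency makes all of them 1, and Jordan blocks of size at most 2 with eigenvalue 1 are roots of
  \<open>(X - 1)^2\<close>.\<close>

lemma unipotent_jordan_nf_quadratic:
  fixes u :: "'a::field mat"
  assumes u: "unipotent_mat u" "u \<in> carrier_mat m m" and jnf: "jordan_nf u bs" "\<forall>(d, a)\<in>set bs. d \<le> 2"
  shows "quadratic_mat m 2 1 u"
proof -
  have "a = 1" if "(d, a) \<in> set bs" for d a
    using jordan_nf_eigenvalue[OF u(2) jnf(1) that] unipotent_eigenvalue[OF u] u(2)
    by (auto simp: eigenvalue_def eigenvector_def)
  then have "\<forall>(d, a)\<in>set bs. d \<le> 2 \<and> a = 1"
    using jnf(2) by blast
  then have J: "quadratic_mat (sum_list (map fst bs)) 2 1 (jordan_matrix bs)"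
  proof (induction bs)
    case Nil
    then show ?case
      by (auto simp: quadratic_mat_def jordan_matrix_def intro!: eq_matI)
  next
    case (Cons b bs)
    then show ?case
      by (cases b) (auto simp: jordan_matrix_Cons intro!: quadratic_four_block quadratic_jordan_block)
  qed
  have sim: "similar_mat u (jordan_matrix bs)"
    using jnf(1) by (simp add: jordan_nf_def)
  then have "m = sum_list (map fst bs)"
    using similar_mat_dim[OF sim] u(2) by simp
  then show ?thesis
    using quadratic_gl_orbit[of m 2 1 "jordan_matrix bs" u] J sim gl_orbit_iff_similar_mat[of "jordan_matrix bs" m u]
    by simp
qed

lemma semisimple_matE:
  assumes "semisimple_mat s" "s \<in> carrier_mat m m"
  obtains D P Q where "D \<in> carrier_mat m m" "diagonal_mat D" "P \<in> carrier_mat m m" "Q \<in> carrier_mat m m"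
    "P * Q = 1\<^sub>m m" "Q * P = 1\<^sub>m m" "s = P * D * Q"
proof -
  obtain D where D: "diagonal_mat D" "similar_mat s D"
    using assms by (auto simp: semisimple_mat_def)
  obtain n P Q where n: "{s, D, P, Q} \<subseteq> carrier_mat n n" "P * Q = 1\<^sub>m n" "Q * P = 1\<^sub>m n" "s = P * D * Q"
    using similar_matD[OF D(2)] by blast
  have nm: "n = m"
    using n(1) assms(2) by auto
  show ?thesis
  proof (rule that)
    show "D \<in> carrier_mat m m" "P \<in> carrier_mat m m" "Q \<in> carrier_mat m m"
      "P * Q = 1\<^sub>m m" "Q * P = 1\<^sub>m m"
      using n(1-3) unfolding nm by simp_all
  qed (fact D(1) n(4))+
qed

lemma diagonal_mat_mult_index:
  fixes D :: "'a::comm_ring_1 mat"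
  assumes "D \<in> carrier_mat m m" "diagonal_mat D" "A \<in> carrier_mat m m" "i < m" "j < m"
  shows "(A * D) $$ (i, j) = A $$ (i, j) * D $$ (j, j)"
proof -
  have "(A * D) $$ (i, j) = (\<Sum>l\<in>{0..<m}. A $$ (i, l) * D $$ (l, j))"
    using assms by (simp add: scalar_prod_def)
  also have "\<dots> = (\<Sum>l\<in>{0..<m}. if l = j then A $$ (i, l) * D $$ (j, j) else 0)"
    using assms by (intro sum.cong) (auto simp: diagonal_mat_def)
  finally show ?thesis
    using assms by simp
qed

text \<open>The diagonal form is a root of \<open>(X - a) (X - b)\<close> when its entries are among
  \<open>a\<close> and \<open>b\<close>. Equal values of \<open>a\<close> and \<open>b\<close> serve
  for a single eigenvalue.\<close>

lemma semisimple_two_eigenvalues_quadratic: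
  fixes s :: "'a::field mat"
  assumes s: "semisimple_mat s" "s \<in> carrier_mat m m" and card: "card {c. eigenvalue s c} \<le> 2"
  shows "\<exists>\<tau> \<nu>. quadratic_mat m \<tau> \<nu> s"
proof -
  obtain D P Q where D: "D \<in> carrier_mat m m" "diagonal_mat D" and PQ: "P \<in> carrier_mat m m" "Q \<in> carrier_mat m m"
    "P * Q = 1\<^sub>m m" "s = P * D * Q"
    using semisimple_matE[OF s] by metis
  have orbit: "s \<in> gl_orbit m D"
    using gl_orbitI[OF PQ(1-3), of D] PQ(4) by simp
  have "upper_triangular D"
    using D by (auto simp: diagonal_mat_def)
  then have "char_poly s = (\<Prod>a\<leftarrow>diag_mat D. [:- a, 1:])"
    using char_poly_similar[of s D] orbit gl_orbit_iff_similar_mat[OF D(1)] char_poly_upper_triangular[OF D(1)] by simp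
  then have "eigenvalue s c \<longleftrightarrow> c \<in> set (diag_mat D)" for c
    using eigenvalue_root_char_poly[OF s(2), of c] by (auto simp: poly_prod_list prod_list_zero_iff)
  then have "{c. eigenvalue s c} = set (diag_mat D)"
    by auto
  then have "card (set (diag_mat D)) \<le> 2"
    using card by simp
  then consider "card (set (diag_mat D)) = 0" | "card (set (diag_mat D)) = 1" | "card (set (diag_mat D)) = 2"
    by linarith
  then have "\<exists>a b. set (diag_mat D) \<subseteq> {a, b}"
  proof cases
    case 1
    then have "set (diag_mat D) = {}" by simp
    then show ?thesis by simp
  next
    case 2
    then obtain a where "set (diag_mat D) = {a}" by (rule card_1_singletonE)
    then show ?thesis by auto
  next
    case 3
    then obtain a b where "set (diag_mat D) = {a, b}" unfolding card_2_iff by blast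
    then show ?thesis by auto
  qed
  then obtain a b where ab: "set (diag_mat D) \<subseteq> {a, b}"
    by blast
  have "D * D = (a + b) \<cdot>\<^sub>m D - (a * b) \<cdot>\<^sub>m 1\<^sub>m m"
  proof (rule eq_matI)
    fix i j assume "i < dim_row ((a + b) \<cdot>\<^sub>m D - (a * b) \<cdot>\<^sub>m 1\<^sub>m m)" "j < dim_col ((a + b) \<cdot>\<^sub>m D - (a * b) \<cdot>\<^sub>m 1\<^sub>m m)"
    then have ij: "i < m" "j < m" by auto
    have "D $$ (j, j) = a \<or> D $$ (j, j) = b"
      using ab ij D(1) by (auto simp: diag_mat_def image_subset_iff)
    then show "(D * D) $$ (i, j) = ((a + b) \<cdot>\<^sub>m D - (a * b) \<cdot>\<^sub>m 1\<^sub>m m) $$ (i, j)"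
      unfolding diagonal_mat_mult_index[OF D D(1) ij] using ij D
      by (cases "i = j") (auto simp: diagonal_mat_def algebra_simps)
  qed (use D in auto)
  then have "quadratic_mat m (a + b) (a * b) D"
    using D by (simp add: quadratic_mat_def)
  then show ?thesis
    using quadratic_gl_orbit orbit by blast
qed

lemma quadratic_eigenvalue:
  fixes g :: "'a::field mat"
  assumes g: "quadratic_mat m \<tau> \<nu> g" and x: "x \<in> carrier_vec m" "x \<noteq> 0\<^sub>v m" "g *\<^sub>v x = c \<cdot>\<^sub>v x"
  shows "c * c = \<tau> * c - \<nu>"
proof -
  have gc: "g \<in> carrier_mat m m" and gg: "g * g = \<tau> \<cdot>\<^sub>m g - \<nu> \<cdot>\<^sub>m 1\<^sub>m m"
    using g by (auto simp: quadratic_mat_def)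
  obtain i where i: "i < m" "x $ i \<noteq> 0"
    using x by (metis carrier_vecD eq_vecI index_zero_vec)
  have "(g * g) *\<^sub>v x = g *\<^sub>v (c \<cdot>\<^sub>v x)"
    using gc x by (simp add: assoc_mult_mat_vec[OF gc gc])
  also have "\<dots> = c \<cdot>\<^sub>v (c \<cdot>\<^sub>v x)"
    using x by (simp add: mult_mat_vec[OF gc])
  finally have "((g * g) *\<^sub>v x) $ i = c * c * x $ i"
    using i x by simp
  moreover have "(g * g) *\<^sub>v x = \<tau> \<cdot>\<^sub>v (g *\<^sub>v x) - \<nu> \<cdot>\<^sub>v x"
    unfolding gg using gc x
    by (simp add: minus_mult_distrib_mat_vec[of _ m m] smult_mat_mult_vec[of _ m m])
  ultimately have "(c * c - (\<tau> * c - \<nu>)) * x $ i = 0"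
    using i x by (simp add: algebra_simps)
  then show ?thesis
    using i by simp
qed

text \<open>
  On an eigenvector \<open>v\<close> of \<open>s\<close> the relation \<open>(g - a) (g - b) = 0\<close> makes \<open>\<mu> u v - b v\<close> an
  eigenvector of the unipotent matrix \<open>u\<close> for the eigenvalue \<open>a / \<mu>\<close>, unless it vanishes.
\<close>

lemma quadratic_jordan_factor:
  fixes s u :: "'a::field mat"
  assumes s: "s \<in> carrier (SL m)" and u: "u \<in> carrier_mat m m" "unipotent_mat u" and comm: "s * u = u * s"
    and g: "quadratic_mat m (a + b) (a * b) (s * u)"
    and v: "v \<in> carrier_vec m" "v \<noteq> 0\<^sub>v m" "s *\<^sub>v v = \<mu> \<cdot>\<^sub>v v"
  shows "u *\<^sub>v v = v \<or> \<mu> = a"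
proof (rule ccontr)
  assume "\<not> ?thesis"
  then have neq: "u *\<^sub>v v \<noteq> v" "\<mu> \<noteq> a"
    by auto
  have sc: "s \<in> carrier_mat m m"
    using s by (simp add: SL_carrier_iff)
  define w where "w = u *\<^sub>v v"
  define w' where "w' = u *\<^sub>v w"
  have wc: "w \<in> carrier_vec m" "w' \<in> carrier_vec m"
    using u v by (simp_all add: w_def w'_def)
  \<comment> \<open>The divisions by \<open>\<mu>\<close> below are possible since \<open>s\<close>
    is invertible.\<close>
  have l0: "\<mu> \<noteq> 0"
  proof
    assume "\<mu> = 0"
    then have "s *\<^sub>v v = 0\<^sub>v m"
      using v by (intro eq_vecI) auto
    moreover have "det s \<noteq> 0"
      using s by (simp add: SL_carrier_iff)
    ultimately show False
      using det_0_iff_vec_prod_zero_field[OF sc] v by blast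
  qed
  have gv: "(s * u) *\<^sub>v x = u *\<^sub>v (s *\<^sub>v x)" if "x \<in> carrier_vec m" for x
    unfolding comm using assoc_mult_mat_vec[OF u(1) sc that] .
  have g1: "(s * u) *\<^sub>v v = \<mu> \<cdot>\<^sub>v w"
    using gv[OF v(1)] v mult_mat_vec[OF u(1) v(1)] by (simp add: w_def)
  have "(s * u) *\<^sub>v w = s *\<^sub>v w'"
    unfolding w'_def using assoc_mult_mat_vec[OF sc u(1) wc(1)] .
  moreover have sw: "s *\<^sub>v (u *\<^sub>v x) = u *\<^sub>v (s *\<^sub>v x)" if "x \<in> carrier_vec m" for x
    using gv[OF that] assoc_mult_mat_vec[OF sc u(1) that] by simp
  have "s *\<^sub>v w = \<mu> \<cdot>\<^sub>v w"
    using sw[OF v(1)] v mult_mat_vec[OF u(1) v(1)] by (simp add: w_def)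
  then have "s *\<^sub>v w' = \<mu> \<cdot>\<^sub>v w'"
    using sw[OF wc(1)] mult_mat_vec[OF u(1) wc(1)] by (simp add: w'_def)
  ultimately have g2: "(s * u) *\<^sub>v w = \<mu> \<cdot>\<^sub>v w'"
    by simp
  have suc: "s * u \<in> carrier_mat m m"
    using sc u by simp
  have gg: "(s * u) * (s * u) = (a + b) \<cdot>\<^sub>m (s * u) - (a * b) \<cdot>\<^sub>m 1\<^sub>m m"
    using g by (simp add: quadratic_mat_def)
  have "((s * u) * (s * u)) *\<^sub>v v = \<mu> \<cdot>\<^sub>v (\<mu> \<cdot>\<^sub>v w')"
    using assoc_mult_mat_vec[OF suc suc v(1)] g1 g2 mult_mat_vec[OF suc wc(1)] by simp
  moreover have "((s * u) * (s * u)) *\<^sub>v v = (a + b) \<cdot>\<^sub>v ((s * u) *\<^sub>v v) - (a * b) \<cdot>\<^sub>v v"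
    unfolding gg
    using minus_mult_distrib_mat_vec[of "(a + b) \<cdot>\<^sub>m (s * u)" m m "(a * b) \<cdot>\<^sub>m 1\<^sub>m m" v]
      smult_mat_mult_vec[OF suc v(1)] smult_mat_mult_vec[OF one_carrier_mat v(1), of "a * b"] suc v(1) by simp
  ultimately have rel: "\<mu> \<cdot>\<^sub>v (\<mu> \<cdot>\<^sub>v w') = (a + b) \<cdot>\<^sub>v (\<mu> \<cdot>\<^sub>v w) - (a * b) \<cdot>\<^sub>v v"
    using g1 by simp
  have rel_i: "\<mu> * (\<mu> * w' $ i) = (a + b) * (\<mu> * w $ i) - a * b * v $ i" if "i < m" for i
    using arg_cong[OF rel, of "\<lambda>y. y $ i"] that wc v(1) by simp
  define x where "x = \<mu> \<cdot>\<^sub>v w - b \<cdot>\<^sub>v v"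
  have xc: "x \<in> carrier_vec m"
    using wc v by (simp add: x_def)
  have "u *\<^sub>v x = \<mu> \<cdot>\<^sub>v w' - b \<cdot>\<^sub>v w"
    unfolding x_def using mult_minus_distrib_mat_vec[OF u(1), of "\<mu> \<cdot>\<^sub>v w" "b \<cdot>\<^sub>v v"]
      mult_mat_vec[OF u(1) wc(1)] mult_mat_vec[OF u(1) v(1)] wc v by (simp add: w_def w'_def)
  also have "\<dots> = (a / \<mu>) \<cdot>\<^sub>v x"
  proof (rule eq_vecI)
    fix i assume "i < dim_vec ((a / \<mu>) \<cdot>\<^sub>v x)"
    then have i: "i < m" using xc by simp
    have "\<mu> * (\<mu> * w' $ i - b * w $ i) = a * (\<mu> * w $ i - b * v $ i)"
      using rel_i[OF i] by (simp add: algebra_simps)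
    then have "\<mu> * w' $ i - b * w $ i = a / \<mu> * (\<mu> * w $ i - b * v $ i)"
      using l0 by (simp add: field_simps)
    then show "(\<mu> \<cdot>\<^sub>v w' - b \<cdot>\<^sub>v w) $ i = ((a / \<mu>) \<cdot>\<^sub>v x) $ i"
      using i wc v(1) by (simp add: x_def)
  qed (use wc v in \<open>auto simp: x_def\<close>)
  finally have ux: "u *\<^sub>v x = (a / \<mu>) \<cdot>\<^sub>v x" .
  \<comment> \<open>If \<open>x\<close> is nonzero, its eigenvalue \<open>a / \<mu>\<close> must be
    1, against \<open>\<mu> \<noteq> a\<close>. If \<open>x\<close> vanishes, \<open>v\<close>
    itself is an eigenvector of \<open>u\<close>, its eigenvalue \<open>b / \<mu>\<close> must be 1,
    and \<open>u\<close> fixes \<open>v\<close>, which is excluded as well.\<close>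
  have "x = 0\<^sub>v m"
  proof (rule ccontr)
    assume "x \<noteq> 0\<^sub>v m"
    then have "a / \<mu> = 1"
      using unipotent_eigenvalue[OF u(2,1) xc _ ux] by simp
    then show False
      using neq(2) l0 by simp
  qed
  have w_i: "\<mu> * w $ i = b * v $ i" if "i < m" for i
    using arg_cong[OF \<open>x = 0\<^sub>v m\<close>, of "\<lambda>y. y $ i"] that wc v(1) by (simp add: x_def)
  have w_eq: "u *\<^sub>v v = (b / \<mu>) \<cdot>\<^sub>v v"
    unfolding w_def[symmetric]
  proof (rule eq_vecI)
    fix i assume "i < dim_vec ((b / \<mu>) \<cdot>\<^sub>v v)"
    then show "w $ i = ((b / \<mu>) \<cdot>\<^sub>v v) $ i"
      using w_i[of i] l0 v(1) by (simp add: field_simps)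
  qed (use wc v in simp)
  then have "b / \<mu> = 1"
    by (rule unipotent_eigenvalue[OF u(2,1) v(1,2)])
  then show False
    using w_eq neq(1) v(1) by simp
qed

section \<open>From the quadratic equation to the two cases and back\<close>

text \<open>If \<open>u\<close> moves some vector of an eigenbasis of \<open>s\<close>, the
  eigenvalue there equals both roots of the polynomial, which is therefore \<open>(X - a)^2\<close>.
  Then all eigenvalues of \<open>s\<close> are \<open>a\<close>, so \<open>s\<close> is scalar and
  the equation passes to \<open>u\<close>.\<close>

lemma quadratic_imp_jordan_cases:
  fixes s u :: "'a::alg_closed_field mat"
  assumes s: "s \<in> carrier (SL m)" "semisimple_mat s" and u: "u \<in> carrier_mat m m" "unipotent_mat u"
    and comm: "s * u = u * s" and g: "quadratic_mat m \<tau> \<nu> (s * u)"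
  shows "(u = 1\<^sub>m m \<and> card {c. eigenvalue s c} \<le> 2)
    \<or> (u \<noteq> 1\<^sub>m m \<and> s \<in> group_center (SL m) \<and> (\<exists>bs. jordan_nf u bs \<and> (\<forall>(d, a)\<in>set bs. d \<le> 2)))"
proof -
  have sc: "s \<in> carrier_mat m m"
    using s by (simp add: SL_carrier_iff)
  obtain a where a: "poly [:\<nu>, - \<tau>, 1:] a = 0"
    using alg_closed_imp_poly_has_root[of "[:\<nu>, - \<tau>, 1:]"] by auto
  define b where "b = \<tau> - a"
  have ab: "\<tau> = a + b" "\<nu> = a * b"
    using a by (simp_all add: b_def algebra_simps eq_neg_iff_add_eq_0)
  show ?thesis
  proof (cases "u = 1\<^sub>m m")
    case True
    have "s * u = s"
      using True sc by simp
    then have gs: "quadratic_mat m \<tau> \<nu> s"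
      using g by simp
    have "c = a \<or> c = b" if c: "eigenvalue s c" for c
    proof -
      obtain x where "x \<in> carrier_vec m" "x \<noteq> 0\<^sub>v m" "s *\<^sub>v x = c \<cdot>\<^sub>v x"
        using c sc by (auto simp: eigenvalue_def eigenvector_def)
      then have "c * c = \<tau> * c - \<nu>"
        by (rule quadratic_eigenvalue[OF gs])
      then have "(c - a) * (c - b) = 0"
        by (simp add: ab algebra_simps)
      then show ?thesis
        by simp
    qed
    then have "{c. eigenvalue s c} \<subseteq> {a, b}"
      by blast
    then have "card {c. eigenvalue s c} \<le> card {a, b}"
      by (intro card_mono) auto
    also have "\<dots> \<le> 2"
      by (simp add: card_insert_if)
    finally show ?thesis
      using True by simp
  next
    case False
    obtain D P Q where D: "D \<in> carrier_mat m m" "diagonal_mat D" and PQ: "P \<in> carrier_mat m m" "Q \<in> carrier_mat m m"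
      "P * Q = 1\<^sub>m m" "Q * P = 1\<^sub>m m" "s = P * D * Q"
      using semisimple_matE[OF s(2) sc] by metis
    have "s * P = P * D * (Q * P)"
      unfolding PQ(5) using D PQ(1,2) by (simp add: assoc_mult_mat[of _ m m _ m _ m])
    then have sP: "s * P = P * D"
      using PQ D by simp
    have colP: "col P j \<in> carrier_vec m" "col P j \<noteq> 0\<^sub>v m" "s *\<^sub>v col P j = D $$ (j, j) \<cdot>\<^sub>v col P j" if j: "j < m" for j
    proof -
      show c: "col P j \<in> carrier_vec m"
        using PQ j by simp
      show "col P j \<noteq> 0\<^sub>v m"
      proof
        assume 0: "col P j = 0\<^sub>v m"
        have "(Q * P) $$ (j, j) = row Q j \<bullet> col P j"
          using PQ(1,2) j by (intro index_mult_mat(1)) auto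
        then have "(1\<^sub>m m :: 'a mat) $$ (j, j) = row Q j \<bullet> col P j"
          unfolding PQ(4) .
        then show False
          using 0 j PQ(2) by simp
      qed
      have "s *\<^sub>v col P j = col (s * P) j"
        using col_mult2[OF sc PQ(1) j] by simp
      also have "\<dots> = D $$ (j, j) \<cdot>\<^sub>v col P j"
        unfolding sP
      proof (rule eq_vecI)
        fix i assume "i < dim_vec (D $$ (j, j) \<cdot>\<^sub>v col P j)"
        then have i: "i < m" using PQ by simp
        have "col (P * D) j $ i = (P * D) $$ (i, j)"
          using i j PQ(1) D(1) by simp
        then show "col (P * D) j $ i = (D $$ (j, j) \<cdot>\<^sub>v col P j) $ i"
          using diagonal_mat_mult_index[OF D PQ(1) i j] i j PQ(1) by (simp add: mult.commute del: index_mult_mat(1))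
      qed (use PQ D in simp)
      finally show "s *\<^sub>v col P j = D $$ (j, j) \<cdot>\<^sub>v col P j" .
    qed
    \<comment> \<open>The columns of \<open>P\<close> form an eigenbasis of \<open>s\<close>; if
      \<open>u\<close> fixed all of them, it would be the identity.\<close>
    have cols: "\<exists>j<m. u *\<^sub>v col P j \<noteq> col P j"
    proof (rule ccontr)
      assume fixed: "\<not> ?thesis"
      have "u * P = P"
      proof (rule eq_matI)
        fix i j assume "i < dim_row P" "j < dim_col P"
        then have ij: "i < m" "j < m" using PQ by auto
        have "col (u * P) j $ i = col P j $ i"
          using fixed ij col_mult2[OF u(1) PQ(1) ij(2)] by simp
        then show "(u * P) $$ (i, j) = P $$ (i, j)"
          using ij PQ(1) u(1) by simp
      qed (use PQ u in auto)
      moreover have "u = (u * P) * Q"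
        using assoc_mult_mat[OF u(1) PQ(1,2)] PQ(3) u(1) by simp
      ultimately show False
        using False PQ(3) by simp
    qed
    then obtain j0 where j0: "j0 < m" "u *\<^sub>v col P j0 \<noteq> col P j0"
      by blast
    \<comment> \<open>The equation is symmetric in the two roots, so
      \<open>quadratic_jordan_factor\<close> applies in both orders.\<close>
    have "D $$ (j0, j0) = a" "D $$ (j0, j0) = b"
      using quadratic_jordan_factor[OF s(1) u comm g[unfolded ab] colP[OF j0(1)]]
        quadratic_jordan_factor[OF s(1) u comm, of b a, OF _ colP[OF j0(1)]] g j0(2)
      by (auto simp: ab add.commute mult.commute)
    then have "a = b"
      by simp
    note gb = g[unfolded ab, folded \<open>a = b\<close>]
    \<comment> \<open>Either \<open>u\<close> moves the column and its eigenvalue is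
      \<open>a\<close>, or \<open>u\<close> fixes it and the eigenvalue of \<open>s\<close> is also
      one of \<open>s * u\<close>, hence a root of \<open>(X - a)^2\<close>.\<close>
    have "D $$ (j, j) = a" if j: "j < m" for j
    proof (rule ccontr)
      assume ne: "D $$ (j, j) \<noteq> a"
      let ?x = "col P j"
      have "u *\<^sub>v ?x = ?x"
        using quadratic_jordan_factor[OF s(1) u comm gb colP[OF j]] ne by blast
      then have "(s * u) *\<^sub>v ?x = D $$ (j, j) \<cdot>\<^sub>v ?x"
        using assoc_mult_mat_vec[OF sc u(1) colP(1)[OF j]] colP(3)[OF j] by simp
      then have "D $$ (j, j) * D $$ (j, j) = (a + a) * D $$ (j, j) - a * a"
        using quadratic_eigenvalue[OF gb colP(1,2)[OF j]] by blast
      then have "(D $$ (j, j) - a) * (D $$ (j, j) - a) = 0"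
        by (simp add: algebra_simps)
      then show False
        using ne by simp
    qed
    then have "D = a \<cdot>\<^sub>m 1\<^sub>m m"
      using D by (intro eq_matI) (auto simp: diagonal_mat_def)
    then have s_eq: "s = a \<cdot>\<^sub>m 1\<^sub>m m"
      unfolding PQ(5) using PQ(1-3)
      by (simp add: mult_smult_distrib[of _ m m _ m] mult_smult_assoc_mat[of _ m m _ m])
    have su: "s * u = a \<cdot>\<^sub>m u"
      unfolding s_eq using u by (simp add: mult_smult_assoc_mat[of _ m m _ m])
    have "m \<noteq> 0"
      using j0 by auto
    then have a0: "a \<noteq> 0"
      using s(1) by (auto simp: s_eq SL_carrier_iff power_0_left)
    \<comment> \<open>The equation for \<open>a u\<close> is divided by \<open>a^2\<close>, which
      leaves \<open>(u - 1)^2 = 0\<close>.\<close>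
    have "quadratic_mat m 2 1 u"
      unfolding quadratic_mat_def
    proof (intro conjI u(1) eq_matI)
      fix i j assume "i < dim_row (2 \<cdot>\<^sub>m u - 1 \<cdot>\<^sub>m 1\<^sub>m m)" "j < dim_col (2 \<cdot>\<^sub>m u - 1 \<cdot>\<^sub>m 1\<^sub>m m)"
      then have ij: "i < m" "j < m" by auto
      have "(a \<cdot>\<^sub>m u) * (a \<cdot>\<^sub>m u) = (a + a) \<cdot>\<^sub>m (a \<cdot>\<^sub>m u) - (a * a) \<cdot>\<^sub>m 1\<^sub>m m"
        using gb by (simp add: quadratic_mat_def su)
      moreover have "(a \<cdot>\<^sub>m u) * (a \<cdot>\<^sub>m u) = (a * a) \<cdot>\<^sub>m (u * u)"
        using u by (simp add: mult_smult_distrib[of _ m m _ m] mult_smult_assoc_mat[of _ m m _ m] smult_smult_mat)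
      ultimately have eq: "(a * a) \<cdot>\<^sub>m (u * u) = (a + a) \<cdot>\<^sub>m (a \<cdot>\<^sub>m u) - (a * a) \<cdot>\<^sub>m 1\<^sub>m m"
        by simp
      have "(a * a) * (u * u) $$ (i, j) = (a + a) * (a * u $$ (i, j)) - a * a * (1\<^sub>m m) $$ (i, j)"
        using arg_cong[OF eq, of "\<lambda>M. M $$ (i, j)"] ij u by (simp del: index_mult_mat(1))
      then have "(a * a) * (u * u) $$ (i, j) = (a * a) * (2 * u $$ (i, j) - (1\<^sub>m m) $$ (i, j))"
        by (simp only:) (simp add: algebra_simps)
      then have "(u * u) $$ (i, j) = 2 * u $$ (i, j) - (1\<^sub>m m) $$ (i, j)"
        using a0 by (metis mult_cancel_left mult_eq_0_iff)
      then show "(u * u) $$ (i, j) = (2 \<cdot>\<^sub>m u - 1 \<cdot>\<^sub>m 1\<^sub>m m) $$ (i, j)"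
        using ij u by (simp del: index_mult_mat(1))
    qed (use u in auto)
    then show ?thesis
      using False scalar_central[OF s(1) s_eq] quadratic_unipotent_jordan_nf by blast
  qed
qed

lemma jordan_cases_imp_quadratic:
  fixes s u :: "'a::alg_closed_field mat"
  assumes s: "s \<in> carrier (SL m)" "semisimple_mat s" and u: "u \<in> carrier_mat m m" "unipotent_mat u"
    and cases: "(u = 1\<^sub>m m \<and> card {c. eigenvalue s c} \<le> 2)
    \<or> (u \<noteq> 1\<^sub>m m \<and> s \<in> group_center (SL m) \<and> (\<exists>bs. jordan_nf u bs \<and> (\<forall>(d, a)\<in>set bs. d \<le> 2)))"
  shows "\<exists>\<tau> \<nu>. quadratic_mat m \<tau> \<nu> (s * u)"
proof -
  have sc: "s \<in> carrier_mat m m"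
    using s by (simp add: SL_carrier_iff)
  from cases show ?thesis
  proof (elim disjE conjE exE)
    assume "u = 1\<^sub>m m" "card {c. eigenvalue s c} \<le> 2"
    then show ?thesis
      using semisimple_two_eigenvalues_quadratic[OF s(2) sc] sc by simp
  next
    fix bs assume central: "s \<in> group_center (SL m)" and bs: "jordan_nf u bs" "\<forall>(d, a)\<in>set bs. d \<le> 2"
    obtain c where c: "s = c \<cdot>\<^sub>m 1\<^sub>m m"
      using central_imp_scalar[OF central] by blast
    have uu: "u * u = 2 \<cdot>\<^sub>m u - 1 \<cdot>\<^sub>m 1\<^sub>m m"
      using unipotent_jordan_nf_quadratic[OF u(2,1) bs] by (simp add: quadratic_mat_def)
    have su: "s * u = c \<cdot>\<^sub>m u"
      unfolding c using u by (simp add: mult_smult_assoc_mat[of _ m m _ m])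
    \<comment> \<open>The factor \<open>c\<close> turns a root of \<open>(X - 1)^2\<close> into a
      root of \<open>(X - c)^2\<close>.\<close>
    have "(c \<cdot>\<^sub>m u) * (c \<cdot>\<^sub>m u) = (c * c) \<cdot>\<^sub>m (u * u)"
      using u by (simp add: mult_smult_distrib[of _ m m _ m] mult_smult_assoc_mat[of _ m m _ m] smult_smult_mat)
    also have "\<dots> = (2 * c) \<cdot>\<^sub>m (c \<cdot>\<^sub>m u) - (c * c) \<cdot>\<^sub>m 1\<^sub>m m"
      unfolding uu using u by (intro eq_matI) (auto simp: algebra_simps)
    finally have "quadratic_mat m (2 * c) (c * c) (s * u)"
      using u by (simp add: quadratic_mat_def su)
    then show ?thesis
      by blast
  qed
qed

theorem theorem3p16:
  fixes n :: nat and g s u :: "'k::alg_closed_field mat"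
  assumes "n \<ge> 1"
    and "g \<in> carrier (SL (n + 1))"
    and "Jordan_decomposition (SL (n + 1)) g s u"
  shows "spherical (n + 1) (SL (n + 1)) (conjugacy_class (SL (n + 1)) g) \<longleftrightarrow>
      (u = 1\<^sub>m (n + 1) \<and> card {c. eigenvalue s c} \<le> 2)
    \<or> (u \<noteq> 1\<^sub>m (n + 1) \<and> s \<in> group_center (SL (n + 1))
       \<and> (\<exists>bs. jordan_nf u bs \<and> (\<forall>(d, a)\<in>set bs. d \<le> 2)))"
proof -
  have s: "s \<in> carrier (SL (n + 1))" "semisimple_mat s" and u: "u \<in> carrier_mat (n + 1) (n + 1)" "unipotent_mat u"
    and g: "g = s * u" and comm: "s * u = u * s"
    using assms(3) by (auto simp: Jordan_decomposition_def SL_carrier_iff)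
  have "spherical (n + 1) (SL (n + 1)) (conjugacy_class (SL (n + 1)) g) \<longleftrightarrow> (\<exists>\<tau> \<nu>. quadratic_mat (n + 1) \<tau> \<nu> g)"
    using spherical_imp_quadratic[OF _ assms(2)] quadratic_imp_spherical[of "n + 1" _ _ g] by auto
  then show ?thesis
    unfolding g using quadratic_imp_jordan_cases[OF s u comm] jordan_cases_imp_quadratic[OF s u] by blast
qed

end
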